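(* $C^*(\mathcal{D})=\mathcal{T}(\mathbb{D})$.
   Context: Fix an integer $n\ge 1$. $D$ is the open unit disc in $\mathbb{C}$ and $\mathbb{D}=\{z=(z_1,\dots,z_n)\in\mathbb{C}^n:|z_i|<1,\ i=1,\dots,n\}$ is the polydisk. $dv=dA_1\cdots dA_n$ is normalized Lebesgue measure on $\mathbb{D}$ (each $dA_i$ is normalized area measure on $D$). The Bergman space $L^2_a(\mathbb{D})$ is the closed subspace of analytic functions in $L^2(\mathbb{D},dv)$, and $P:L^2(\mathbb{D},dv)\to L^2_a(\mathbb{D})$ is the orthogonal projection. Its normalized reproducing kernels are $k_z(w)=\prod_{i=1}^n\frac{1-|z_i|^2}{(1-w_i\overline{z_i})^2}$, $z,w\in\mathbb{D}$. For vectors $f,g$, $f\otimes g$ is the operator $h\mapsto\langle h,g\rangle f$. For $f\in L^\infty(\mathbb{D},dv)$ the Toeplitz operator on $L^2_a(\mathbb{D})$ is $T_fh=P(fh)$. The Toeplitz algebra $\mathcal{T}(\mathbb{D})$ is the $C^*$-algebra generated by $\{T_f:f\in L^\infty(\mathbb{D},dv)\}$. For $u,v\in D$ let $\varphi_u(v)=(u-v)/(1-v\overline{u})$ and $\beta(u,v)=\frac12\log\frac{1+|\varphi_u(v)|}{1-|\varphi_u(v)|}$. On $\mathbb{D}$ use the metric $d(z,w)=\sum_{i=1}^n\beta(z_i,w_i)$ and write $D(z,a)=\{w\in\mathbb{D}:d(z,w)<a\}$. A set $\Gamma\subset\mathbb{D}$ is separated if there is $a>0$ with $D(u,a)\cap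 D(v,a)=\emptyset$ for all $u\ne v$ in $\Gamma$. $\mathcal{D}_0$ is the collection of operators $\sum_{z\in\Gamma}c_zk_z\otimes k_{\gamma(z)}$ on $L^2_a(\mathbb{D})$, where $\Gamma$ is any separated set in $\mathbb{D}$, $\{c_z:z\in\Gamma\}$ is any bounded set of complex coefficients, and $\gamma:\Gamma\to\mathbb{D}$ is any map for which there is $0\le C<\infty$ with $d(z,\gamma(z))\le C$ for every $z\in\Gamma$ (sums over $\Gamma$ are understood in the strong operator topology). $\mathcal{D}$ is the operator-norm closure of the linear span of $\mathcal{D}_0$, and $C^*(\mathcal{D})$ is the $C^*$-algebra generated by $\mathcal{D}$. *)

theory Defs
  imports "HOL-Analysis.Analysis"
begin

definition polydisk :: "(complex ^ 'n) set" where
  "polydisk = {z. \<forall>i. cmod (z $ i) < 1}"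

text \<open>Lebesgue measure of \<^term>\<open>polydisk\<close>, rescaled to total mass 1. This is the product of the
  normalized area measures of the unit discs.\<close>

definition dv :: "(complex ^ 'n) measure" where
  "dv = uniform_measure lborel polydisk"

lemma open_polydisk [simp]: "open (polydisk :: (complex ^ 'n) set)"
proof -
  have "polydisk = (\<Inter>i\<in>UNIV. {z :: complex ^ 'n. cmod (z $ i) < 1})"
    by (auto simp: polydisk_def)
  also have "open \<dots>"
    by (intro open_INT ballI open_Collect_less continuous_intros) simp
  finally show ?thesis .
qed

lemma zero_in_polydisk [simp]: "0 \<in> polydisk"
  by (simp add: polydisk_def)

lemma bounded_polydisk: "bounded (polydisk :: (complex ^ 'n) set)"
proof (rule boundedI)
  fix z :: "complex ^ 'n" assume "z \<in> polydisk"
  then have "(\<Sum>i\<in>UNIV. cmod (z $ i)) \<le> (\<Sum>i\<in>(UNIV :: 'n set). 1)"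
    by (intro sum_mono) (auto simp: polydisk_def intro: less_imp_le)
  then show "norm z \<le> real CARD('n)"
    using L2_set_le_sum[of UNIV "\<lambda>i. norm (z $ i)"] by (simp add: norm_vec_def)
qed

lemma polydisk_sets [measurable]: "polydisk \<in> sets borel"
  by simp

lemma sets_dv [simp, measurable_cong]: "sets dv = sets borel"
  by (simp add: dv_def)

lemma space_dv [simp]: "space dv = UNIV"
  by (simp add: dv_def)

lemma emeasure_polydisk_finite: "emeasure lborel polydisk < \<infinity>"
  using emeasure_bounded_finite[OF bounded_polydisk] by simp

lemma emeasure_polydisk_nonzero: "emeasure lborel (polydisk :: (complex ^ 'n) set) \<noteq> 0"
proof
  assume "emeasure lborel (polydisk :: (complex ^ 'n) set) = 0"
  then have "polydisk \<in> null_sets (lborel :: (complex ^ 'n) measure)"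
    by (intro null_setsI) auto
  then have "negligible (polydisk :: (complex ^ 'n) set)"
    by (metis negligible_iff_null_sets null_sets_completionI)
  then show False
    using open_not_negligible[OF open_polydisk] zero_in_polydisk by blast
qed

lemma finite_measure_dv: "finite_measure dv"
proof (rule finite_measureI)
  show "emeasure dv (space dv) \<noteq> \<infinity>"
    using emeasure_polydisk_nonzero emeasure_polydisk_finite
    by (simp add: dv_def ennreal_divide_eq_top_iff)
qed

lemma AE_dv_iff: "(AE z in dv. P z) \<longleftrightarrow> (AE z in lborel. z \<in> polydisk \<longrightarrow> P z)"
  unfolding dv_def using emeasure_polydisk_nonzero emeasure_polydisk_finite
  by (intro AE_uniform_measure) auto

text \<open>Analyticity in several variables: complex Frechet differentiability at every point of an
  open set, i.e. the real derivative exists and is complex linear.\<close>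

definition analytic_polydisk :: "(complex ^ 'n \<Rightarrow> complex) \<Rightarrow> bool" where
  "analytic_polydisk f \<longleftrightarrow> (\<forall>z\<in>polydisk. \<exists>f'. (f has_derivative f') (at z) \<and>
     (\<forall>c h. f' (c *s h) = c * f' h))"

text \<open>An element of the Bergman space is represented by its analytic representative, extended by
  \<open>0\<close> outside the polydisk, so that equality of elements is equality of functions.\<close>

definition bergman_set :: "(complex ^ 'n \<Rightarrow> complex) set" where
  "bergman_set = {f. analytic_polydisk f \<and> integrable dv (\<lambda>z. (cmod (f z))\<^sup>2) \<and>
     (\<forall>z. z \<notin> polydisk \<longrightarrow> f z = 0)}"

lemma analytic_polydisk_continuous_on:
  assumes "analytic_polydisk f" shows "continuous_on polydisk f"
proof (rule continuous_at_imp_continuous_on, rule ballI)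
  fix z :: "complex ^ 'a" assume "z \<in> polydisk"
  then obtain f' where "(f has_derivative f') (at z)"
    using assms unfolding analytic_polydisk_def by blast
  then show "isCont f z" by (rule has_derivative_continuous)
qed

lemma bergman_measurable:
  assumes "f \<in> bergman_set" shows "f \<in> borel_measurable borel"
proof -
  have "continuous_on polydisk f"
    using assms by (auto simp: bergman_set_def intro: analytic_polydisk_continuous_on)
  then have "(\<lambda>z. indicator polydisk z *\<^sub>R f z) \<in> borel_measurable borel"
    by (intro borel_measurable_continuous_on_indicator) auto
  moreover have "(\<lambda>z. indicator polydisk z *\<^sub>R f z) = f"
    using assms by (auto simp: bergman_set_def indicator_def fun_eq_iff)
  ultimately show ?thesis by simp
qed

lemma bergman_measurable_dv [measurable]: "f \<in> bergman_set \<Longrightarrow> f \<in> borel_measurable dv"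
  using bergman_measurable by (simp cong: measurable_cong_sets)

lemma bergman_product_integrable:
  assumes f: "f \<in> bergman_set" and g: "g \<in> bergman_set"
  shows "integrable dv (\<lambda>z. f z * cnj (g z))"
proof (rule Bochner_Integration.integrable_bound)
  show "integrable dv (\<lambda>z. (cmod (f z))\<^sup>2 + (cmod (g z))\<^sup>2)"
    using f g by (auto simp: bergman_set_def)
  have [measurable]: "f \<in> borel_measurable dv" "g \<in> borel_measurable dv"
    using f g by (auto intro: bergman_measurable_dv)
  have "cnj \<in> borel_measurable borel"
    by (intro borel_measurable_continuous_onI continuous_intros)
  then show "(\<lambda>z. f z * cnj (g z)) \<in> borel_measurable dv"
    by measurable
  have "cmod a * cmod b \<le> (cmod a)\<^sup>2 + (cmod b)\<^sup>2" for a b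
    using sum_squares_bound[of "cmod a" "cmod b"] mult_nonneg_nonneg[of "cmod a" "cmod b"]
      norm_ge_zero[of a] norm_ge_zero[of b] unfolding mult.assoc by linarith
  then show "AE z in dv. norm (f z * cnj (g z)) \<le> norm ((cmod (f z))\<^sup>2 + (cmod (g z))\<^sup>2)"
    by (simp add: norm_mult)
qed

lemma bergman_set_zero: "(\<lambda>z. 0) \<in> bergman_set"
  by (auto simp: bergman_set_def analytic_polydisk_def intro!: exI[of _ "\<lambda>z. 0"])

lemma bergman_set_scale:
  assumes f: "f \<in> bergman_set" shows "(\<lambda>z. c * f z) \<in> bergman_set"
proof -
  have "analytic_polydisk (\<lambda>z. c * f z)"
    unfolding analytic_polydisk_def
  proof
    fix z :: "complex ^ 'a" assume "z \<in> polydisk"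
    then obtain f' where "(f has_derivative f') (at z)" "\<forall>c h. f' (c *s h) = c * f' h"
      using f unfolding bergman_set_def analytic_polydisk_def by blast
    then show "\<exists>f'. ((\<lambda>z. c * f z) has_derivative f') (at z) \<and> (\<forall>c h. f' (c *s h) = c * f' h)"
      by (intro exI[of _ "\<lambda>h. c * f' h"]) (auto intro!: derivative_intros)
  qed
  then show ?thesis
    using f by (auto simp: bergman_set_def norm_mult power_mult_distrib)
qed

lemma bergman_set_add:
  assumes f: "f \<in> bergman_set" and g: "g \<in> bergman_set"
  shows "(\<lambda>z. f z + g z) \<in> bergman_set"
proof -
  have "analytic_polydisk (\<lambda>z. f z + g z)"
    unfolding analytic_polydisk_def
  proof
    fix z :: "complex ^ 'a" assume z: "z \<in> polydisk"
    obtain f' where "(f has_derivative f') (at z)" "\<forall>c h. f' (c *s h) = c * f' h"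
      using f z unfolding bergman_set_def analytic_polydisk_def by blast
    moreover obtain g' where "(g has_derivative g') (at z)" "\<forall>c h. g' (c *s h) = c * g' h"
      using g z unfolding bergman_set_def analytic_polydisk_def by blast
    ultimately show "\<exists>f'. ((\<lambda>z. f z + g z) has_derivative f') (at z) \<and>
        (\<forall>c h. f' (c *s h) = c * f' h)"
      by (intro exI[of _ "\<lambda>h. f' h + g' h"]) (auto intro!: derivative_intros simp: distrib_left)
  qed
  moreover have "integrable dv (\<lambda>z. (cmod (f z + g z))\<^sup>2)"
  proof (rule Bochner_Integration.integrable_bound)
    show "integrable dv (\<lambda>z. 2 * (cmod (f z))\<^sup>2 + 2 * (cmod (g z))\<^sup>2)"
      using f g by (auto simp: bergman_set_def)
    show "(\<lambda>z. (cmod (f z + g z))\<^sup>2) \<in> borel_measurable dv"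
      using bergman_measurable_dv[OF f] bergman_measurable_dv[OF g] by measurable
    have "(cmod (a + b))\<^sup>2 \<le> 2 * (cmod a)\<^sup>2 + 2 * (cmod b)\<^sup>2" for a b
    proof -
      have "(cmod (a + b))\<^sup>2 \<le> (cmod a + cmod b)\<^sup>2"
        by (intro power_mono norm_triangle_ineq) auto
      also have "\<dots> \<le> 2 * (cmod a)\<^sup>2 + 2 * (cmod b)\<^sup>2"
        using sum_squares_bound[of "cmod a" "cmod b"] by (simp add: power2_sum)
      finally show ?thesis .
    qed
    then show "AE z in dv. norm ((cmod (f z + g z))\<^sup>2)
        \<le> norm (2 * (cmod (f z))\<^sup>2 + 2 * (cmod (g z))\<^sup>2)"
      by simp
  qed
  ultimately show ?thesis
    using f g by (auto simp: bergman_set_def)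
qed

typedef (overloaded) ('n::finite) bergman = "bergman_set :: (complex ^ 'n \<Rightarrow> complex) set"
  morphisms bergman_fun Abs_bergman
  using bergman_set_zero by blast

setup_lifting type_definition_bergman

lemma bergman_eqI: "(\<And>z. bergman_fun f z = bergman_fun g z) \<Longrightarrow> f = g"
  by (simp add: bergman_fun_inject[symmetric] fun_eq_iff)

lift_definition cscale :: "complex \<Rightarrow> 'n::finite bergman \<Rightarrow> 'n bergman" (infixr "*\<^sub>c" 75)
  is "\<lambda>c f z. c * f z"
  by (rule bergman_set_scale)

definition cinner :: "'n::finite bergman \<Rightarrow> 'n bergman \<Rightarrow> complex" where
  "cinner f g = (LINT z|dv. bergman_fun f z * cnj (bergman_fun g z))"

instantiation bergman :: (finite) real_vector
begin

lift_definition zero_bergman :: "'a bergman" is "\<lambda>z. 0"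
  by (rule bergman_set_zero)

lift_definition plus_bergman :: "'a bergman \<Rightarrow> 'a bergman \<Rightarrow> 'a bergman" is "\<lambda>f g z. f z + g z"
  by (rule bergman_set_add)

lift_definition uminus_bergman :: "'a bergman \<Rightarrow> 'a bergman" is "\<lambda>f z. - f z"
  using bergman_set_scale[of _ "-1"] by simp

lift_definition minus_bergman :: "'a bergman \<Rightarrow> 'a bergman \<Rightarrow> 'a bergman" is "\<lambda>f g z. f z - g z"
  using bergman_set_add[OF _ bergman_set_scale[of _ "-1"]] by simp

lift_definition scaleR_bergman :: "real \<Rightarrow> 'a bergman \<Rightarrow> 'a bergman" is "\<lambda>r f z. r *\<^sub>R f z"
  using bergman_set_scale by (simp add: scaleR_conv_of_real)

instance
  by standard (transfer; simp add: fun_eq_iff algebra_simps)+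

end

lemma cinner_add_left: "cinner (f + g) h = cinner f h + cinner g h"
  unfolding cinner_def plus_bergman.rep_eq distrib_right
  by (intro Bochner_Integration.integral_add bergman_product_integrable bergman_fun)

lemma cinner_cscale_left: "cinner (c *\<^sub>c f) g = c * cinner f g"
  by (simp add: cinner_def cscale.rep_eq mult.assoc)

lemma cinner_commute: "cinner f g = cnj (cinner g f)"
proof -
  have "cinner f g = (LINT z|dv. cnj (bergman_fun g z * cnj (bergman_fun f z)))"
    by (simp add: cinner_def mult.commute)
  also have "\<dots> = cnj (cinner g f)"
    unfolding cinner_def by (rule Bochner_Integration.integral_cnj)
  finally show ?thesis .
qed

lemma cinner_self: "cinner f f = of_real (LINT z|dv. (cmod (bergman_fun f z))\<^sup>2)"
  unfolding cinner_def by (simp only: complex_norm_square[symmetric] integral_complex_of_real)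

lemma scaleR_eq_cscale: "r *\<^sub>R f = of_real r *\<^sub>c (f :: 'n::finite bergman)"
  by transfer (simp add: scaleR_conv_of_real)

lemma cinner_self_eq_0:
  assumes "cinner f f = 0" shows "f = (0 :: 'n::finite bergman)"
proof -
  let ?f = "bergman_fun f"
  have "(LINT z|dv. (cmod (?f z))\<^sup>2) = 0"
    using assms by (simp add: cinner_self)
  moreover have "integrable dv (\<lambda>z. (cmod (?f z))\<^sup>2)"
    using bergman_fun[of f] by (simp add: bergman_set_def)
  ultimately have "AE z in dv. (cmod (?f z))\<^sup>2 = 0"
    by (subst (asm) integral_nonneg_eq_0_iff_AE) auto
  then have AE: "AE z in lborel. z \<in> polydisk \<longrightarrow> ?f z = 0"
    by (simp add: AE_dv_iff)
  let ?S = "{z \<in> polydisk. ?f z \<in> - {0}}"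
  have cont: "continuous_on polydisk ?f"
    using bergman_fun[of f] by (auto simp: bergman_set_def intro: analytic_polydisk_continuous_on)
  have "open (polydisk \<inter> ?f -` (- {0}))"
    by (rule continuous_open_preimage[OF cont]) auto
  then have op: "open ?S"
    by (simp add: Int_def vimage_def)
  have "?S \<in> null_sets lborel"
    using AE op by (subst AE_iff_null_sets) (auto elim: eventually_mono)
  then have "negligible ?S"
    by (metis negligible_iff_null_sets null_sets_completionI)
  then have "?S = {}"
    using open_not_negligible[OF op] by blast
  then show ?thesis
    using bergman_fun[of f]
    by (intro bergman_eqI) (auto simp: zero_bergman.rep_eq bergman_set_def)
qed

instantiation bergman :: (finite) real_inner
begin

definition inner_bergman :: "'a bergman \<Rightarrow> 'a bergman \<Rightarrow> real" where
  "inner_bergman f g = Re (cinner f g)"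

definition norm_bergman :: "'a bergman \<Rightarrow> real" where
  "norm_bergman f = sqrt (LINT z|dv. (cmod (bergman_fun f z))\<^sup>2)"

definition sgn_bergman :: "'a bergman \<Rightarrow> 'a bergman" where
  "sgn_bergman f = inverse (norm f) *\<^sub>R f"

definition dist_bergman :: "'a bergman \<Rightarrow> 'a bergman \<Rightarrow> real" where
  "dist_bergman f g = norm (f - g)"

definition uniformity_bergman :: "('a bergman \<times> 'a bergman) filter" where
  "uniformity_bergman = (INF e\<in>{0 <..}. principal {(x, y). dist x y < e})"

definition open_bergman :: "'a bergman set \<Rightarrow> bool" where
  "open_bergman U = (\<forall>x\<in>U. eventually (\<lambda>(x', y). x' = x \<longrightarrow> y \<in> U) uniformity)"

instance
proof
  fix f g h :: "'a bergman" and r :: real and U :: "'a bergman set"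
  show "inner f g = inner g f"
    unfolding inner_bergman_def by (subst cinner_commute) simp
  show "inner (f + g) h = inner f h + inner g h"
    by (simp add: inner_bergman_def cinner_add_left)
  show "inner (r *\<^sub>R f) g = r * inner f g"
    by (simp add: inner_bergman_def scaleR_eq_cscale cinner_cscale_left)
  show "0 \<le> inner f f"
    by (simp add: inner_bergman_def cinner_self)
  show "inner f f = 0 \<longleftrightarrow> f = 0"
  proof
    assume "inner f f = 0"
    then have "cinner f f = 0" by (simp add: inner_bergman_def cinner_self)
    then show "f = 0" by (rule cinner_self_eq_0)
  qed (simp add: inner_bergman_def cinner_def zero_bergman.rep_eq)
  show "norm f = sqrt (inner f f)"
    by (simp add: norm_bergman_def inner_bergman_def cinner_self)
qed (simp_all add: sgn_bergman_def dist_bergman_def uniformity_bergman_def open_bergman_def)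

end

lemma norm_cscale: "norm (c *\<^sub>c f) = cmod c * norm (f :: 'n::finite bergman)"
  by (simp add: norm_bergman_def cscale.rep_eq norm_mult power_mult_distrib real_sqrt_mult)

lemma bounded_linear_cscale: "bounded_linear (\<lambda>f :: 'n::finite bergman. c *\<^sub>c f)"
proof (rule bounded_linear_intro[where K = "cmod c"])
  fix f g :: "'n bergman" and r :: real
  show "c *\<^sub>c (f + g) = c *\<^sub>c f + c *\<^sub>c g"
    by transfer (simp add: distrib_left)
  show "c *\<^sub>c (r *\<^sub>R f) = r *\<^sub>R (c *\<^sub>c f)"
    by transfer simp
qed (simp add: norm_cscale mult.commute)

lemma norm_cinner_le: "cmod (cinner f g) \<le> norm f * norm (g :: 'n::finite bergman)"
proof (cases "cinner f g = 0")
  case False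
  define u where "u = cnj (sgn (cinner f g))"
  have "cmod u = 1" using False by (simp add: u_def norm_sgn)
  have "u * cinner f g = of_real (cmod (cinner f g))"
    using False unfolding u_def
    by (simp add: sgn_div_norm complex_norm_square[symmetric] scaleR_conv_of_real
        power2_eq_square field_simps flip: of_real_mult)
  then have "cmod (cinner f g) = inner (u *\<^sub>c f) g"
    by (simp add: inner_bergman_def cinner_cscale_left)
  also have "\<dots> \<le> norm (u *\<^sub>c f) * norm g"
    by (rule norm_cauchy_schwarz)
  finally show ?thesis using \<open>cmod u = 1\<close> by (simp add: norm_cscale)
qed simp

text \<open>Bounded operators are elements of \<^typ>\<open>'n bergman \<Rightarrow>\<^sub>L 'n bergman\<close>, whose norm is the operator
  norm. That type only demands real linearity; all operators below are complex linear.\<close>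

definition op_cscale ::
  "complex \<Rightarrow> ('n::finite bergman \<Rightarrow>\<^sub>L 'n bergman) \<Rightarrow> ('n bergman \<Rightarrow>\<^sub>L 'n bergman)" where
  "op_cscale c T = Blinfun (\<lambda>f. c *\<^sub>c blinfun_apply T f)"

lemma op_cscale_apply: "blinfun_apply (op_cscale c T) f = c *\<^sub>c blinfun_apply T f"
  unfolding op_cscale_def
  by (subst bounded_linear_Blinfun_apply)
    (auto intro: bounded_linear_compose[OF bounded_linear_cscale] blinfun.bounded_linear_right)

interpretation cop: vector_space "op_cscale :: complex \<Rightarrow> ('n::finite bergman \<Rightarrow>\<^sub>L 'n bergman) \<Rightarrow> _"
proof
  fix a b :: complex and S T :: "'n bergman \<Rightarrow>\<^sub>L 'n bergman"
  show "op_cscale a (S + T) = op_cscale a S + op_cscale a T"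
    by (intro blinfun_eqI) (simp add: op_cscale_apply blinfun.add_left
        linear_add[OF bounded_linear.linear[OF bounded_linear_cscale]])
  show "op_cscale (a + b) T = op_cscale a T + op_cscale b T"
    by (intro blinfun_eqI bergman_eqI)
      (simp add: op_cscale_apply blinfun.add_left cscale.rep_eq plus_bergman.rep_eq distrib_right)
  show "op_cscale a (op_cscale b T) = op_cscale (a * b) T"
    by (intro blinfun_eqI bergman_eqI) (simp add: op_cscale_apply cscale.rep_eq)
  show "op_cscale 1 T = T"
    by (intro blinfun_eqI bergman_eqI) (simp add: op_cscale_apply cscale.rep_eq)
qed

definition complex_linear :: "('n::finite bergman \<Rightarrow>\<^sub>L 'n bergman) \<Rightarrow> bool" where
  "complex_linear T \<longleftrightarrow>
     (\<forall>c f. blinfun_apply T (c *\<^sub>c f) = c *\<^sub>c blinfun_apply T f)"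

definition is_adjoint ::
  "('n::finite bergman \<Rightarrow>\<^sub>L 'n bergman) \<Rightarrow> ('n bergman \<Rightarrow>\<^sub>L 'n bergman) \<Rightarrow> bool" where
  "is_adjoint T S \<longleftrightarrow>
     (\<forall>f g. cinner (blinfun_apply T f) g = cinner f (blinfun_apply S g))"

text \<open>Norm-closed, self-adjoint subalgebras, not required to contain the identity.\<close>

definition cstar_subalgebra :: "('n::finite bergman \<Rightarrow>\<^sub>L 'n bergman) set \<Rightarrow> bool" where
  "cstar_subalgebra A \<longleftrightarrow>
     (\<forall>T\<in>A. complex_linear T) \<and>
     cop.subspace A \<and>
     (\<forall>S\<in>A. \<forall>T\<in>A. S o\<^sub>L T \<in> A) \<and>
     (\<forall>T\<in>A. \<exists>S\<in>A. is_adjoint T S) \<and>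
     closed A"

definition cstar_generated ::
  "('n::finite bergman \<Rightarrow>\<^sub>L 'n bergman) set \<Rightarrow> ('n bergman \<Rightarrow>\<^sub>L 'n bergman) set" where
  "cstar_generated X = cstar_subalgebra hull X"

definition rank_one :: "'n::finite bergman \<Rightarrow> 'n bergman \<Rightarrow> ('n bergman \<Rightarrow>\<^sub>L 'n bergman)"
  (infix "\<otimes>\<^sub>b" 70) where
  "f \<otimes>\<^sub>b g = Blinfun (\<lambda>h. cinner h g *\<^sub>c f)"

lemma rank_one_apply: "blinfun_apply (f \<otimes>\<^sub>b g) h = cinner h g *\<^sub>c f"
proof -
  have "bounded_linear (\<lambda>h. cinner h g *\<^sub>c f)"
  proof (rule bounded_linear_intro[where K = "norm g * norm f"])
    fix h k :: "'a bergman" and r :: real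
    show "cinner (h + k) g *\<^sub>c f = cinner h g *\<^sub>c f + cinner k g *\<^sub>c f"
      by (intro bergman_eqI)
        (simp add: cinner_add_left cscale.rep_eq plus_bergman.rep_eq distrib_right)
    show "cinner (r *\<^sub>R h) g *\<^sub>c f = r *\<^sub>R (cinner h g *\<^sub>c f)"
      by (intro bergman_eqI)
        (simp add: scaleR_eq_cscale cinner_cscale_left cscale.rep_eq)
    show "norm (cinner h g *\<^sub>c f) \<le> norm h * (norm g * norm f)"
      using mult_right_mono[OF norm_cinner_le[of h g], of "norm f"]
      by (simp add: norm_cscale mult.assoc)
  qed
  then show ?thesis
    unfolding rank_one_def by (simp add: bounded_linear_Blinfun_apply)
qed

text \<open>The orthogonal projection onto the Bergman space: for square-integrable \<open>g\<close>, the value is the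
  unique \<open>u\<close> such that \<open>g - u\<close> is orthogonal to every element of the space.\<close>

definition bergman_proj :: "(complex ^ 'n \<Rightarrow> complex) \<Rightarrow> 'n::finite bergman" where
  "bergman_proj g =
     (THE u. \<forall>h. (LINT z|dv. (g z - bergman_fun u z) * cnj (bergman_fun h z)) = 0)"

definition Linfty :: "(complex ^ 'n \<Rightarrow> complex) set" where
  "Linfty = {f \<in> borel_measurable dv. \<exists>B. AE z in dv. cmod (f z) \<le> B}"

text \<open>For \<open>f \<in> Linfty\<close> the map \<open>h \<mapsto> P (f h)\<close> is bounded, so \<^const>\<open>Blinfun\<close> is applied within its
  intended domain.\<close>

definition toeplitz :: "(complex ^ 'n \<Rightarrow> complex) \<Rightarrow> ('n::finite bergman \<Rightarrow>\<^sub>L 'n bergman)" where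
  "toeplitz f = Blinfun (\<lambda>h. bergman_proj (\<lambda>z. f z * bergman_fun h z))"

definition toeplitz_algebra :: "('n::finite bergman \<Rightarrow>\<^sub>L 'n bergman) set" where
  "toeplitz_algebra = cstar_generated (toeplitz ` Linfty)"

definition phi :: "complex \<Rightarrow> complex \<Rightarrow> complex" where
  "phi u v = (u - v) / (1 - v * cnj u)"

definition beta :: "complex \<Rightarrow> complex \<Rightarrow> real" where
  "beta u v = 1 / 2 * ln ((1 + cmod (phi u v)) / (1 - cmod (phi u v)))"

definition polydist :: "complex ^ 'n \<Rightarrow> complex ^ 'n \<Rightarrow> real" where
  "polydist z w = (\<Sum>i\<in>UNIV. beta (z $ i) (w $ i))"

definition polyball :: "complex ^ 'n \<Rightarrow> real \<Rightarrow> (complex ^ 'n) set" where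
  "polyball z a = {w \<in> polydisk. polydist z w < a}"

definition separated_set :: "(complex ^ 'n) set \<Rightarrow> bool" where
  "separated_set \<Gamma> \<longleftrightarrow> \<Gamma> \<subseteq> polydisk \<and>
     (\<exists>a>0. \<forall>u\<in>\<Gamma>. \<forall>v\<in>\<Gamma>. u \<noteq> v \<longrightarrow> polyball u a \<inter> polyball v a = {})"

definition kernel_fun :: "complex ^ 'n \<Rightarrow> complex ^ 'n \<Rightarrow> complex" where
  "kernel_fun z w =
     (\<Prod>i\<in>UNIV. of_real (1 - (cmod (z $ i))\<^sup>2) / (1 - w $ i * cnj (z $ i))\<^sup>2)"

lemma kernel_denom_ge:
  fixes z w :: "complex ^ 'n"
  assumes "z \<in> polydisk" "w \<in> polydisk"
  shows "cmod (1 - w $ i * cnj (z $ i)) \<ge> 1 - cmod (z $ i)" "1 - cmod (z $ i) > 0"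
proof -
  have "cmod (w $ i * cnj (z $ i)) \<le> 1 * cmod (z $ i)"
    unfolding norm_mult complex_mod_cnj using assms
    by (intro mult_right_mono) (auto simp: polydisk_def intro: less_imp_le)
  then show "cmod (1 - w $ i * cnj (z $ i)) \<ge> 1 - cmod (z $ i)"
    using norm_triangle_ineq2[of 1 "w $ i * cnj (z $ i)"] by simp
  show "1 - cmod (z $ i) > 0"
    using assms by (simp add: polydisk_def)
qed

lemma kernel_fun_analytic:
  fixes z w :: "complex ^ 'n"
  assumes "z \<in> polydisk" "w \<in> polydisk"
  shows "\<exists>f'. (kernel_fun z has_derivative f') (at w) \<and> (\<forall>c h. f' (c *s h) = c * f' h)"
proof -
  have ne: "1 - w $ i * cnj (z $ i) \<noteq> 0" for i
    using kernel_denom_ge[OF assms, of i] by force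
  have "\<exists>d. ((\<lambda>w. of_real (1 - (cmod (z $ i))\<^sup>2) / (1 - w $ i * cnj (z $ i))\<^sup>2)
          has_derivative (\<lambda>h. d * h $ i)) (at w)" for i
  proof -
    have "((\<lambda>x. of_real (1 - (cmod (z $ i))\<^sup>2) / (1 - x * cnj (z $ i))\<^sup>2) has_field_derivative
        deriv (\<lambda>x. of_real (1 - (cmod (z $ i))\<^sup>2) / (1 - x * cnj (z $ i))\<^sup>2) (w $ i)) (at (w $ i))"
      using ne[of i]
      by (intro DERIV_deriv_iff_field_differentiable[THEN iffD2] derivative_intros
          field_differentiable_divide field_differentiable_power field_differentiable_diff
          field_differentiable_mult field_differentiable_const field_differentiable_ident) auto
    then have D: "((\<lambda>x. of_real (1 - (cmod (z $ i))\<^sup>2) / (1 - x * cnj (z $ i))\<^sup>2) has_derivative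
        (\<lambda>x. deriv (\<lambda>x. of_real (1 - (cmod (z $ i))\<^sup>2) / (1 - x * cnj (z $ i))\<^sup>2) (w $ i) * x))
        (at (w $ i))"
      by (simp add: has_field_derivative_def)
    have "((\<lambda>w :: complex ^ 'n. w $ i) has_derivative (\<lambda>h. h $ i)) (at w)"
      by (rule bounded_linear_imp_has_derivative[OF bounded_linear_vec_nth])
    from has_derivative_compose[OF this D] show ?thesis by blast
  qed
  then obtain d where d: "((\<lambda>w. of_real (1 - (cmod (z $ i))\<^sup>2) / (1 - w $ i * cnj (z $ i))\<^sup>2)
          has_derivative (\<lambda>h. d i * h $ i)) (at w)" for i
    by metis
  show ?thesis
    unfolding kernel_fun_def
    by (rule exI, rule conjI, rule has_derivative_prod[OF d])
      (auto simp: sum_distrib_left intro!: sum.cong)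
qed

lemma kernel_fun_in_bergman:
  fixes z :: "complex ^ 'n"
  assumes z: "z \<in> polydisk"
  shows "(\<lambda>w. if w \<in> polydisk then kernel_fun z w else 0) \<in> bergman_set"
    (is "?k \<in> _")
proof -
  have an: "analytic_polydisk ?k"
    unfolding analytic_polydisk_def
  proof
    fix w :: "complex ^ 'n" assume w: "w \<in> polydisk"
    obtain f' where f': "(kernel_fun z has_derivative f') (at w)" "\<forall>c h. f' (c *s h) = c * f' h"
      using kernel_fun_analytic[OF z w] by blast
    have "(?k has_derivative f') (at w)"
      by (rule has_derivative_transform_within_open[OF f'(1) open_polydisk w]) simp
    then show "\<exists>f'. (?k has_derivative f') (at w) \<and> (\<forall>c h. f' (c *s h) = c * f' h)"
      using f'(2) by blast
  qed
  have "(\<lambda>w. indicator polydisk w *\<^sub>R ?k w) \<in> borel_measurable borel"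
    using analytic_polydisk_continuous_on[OF an]
    by (intro borel_measurable_continuous_on_indicator) auto
  moreover have "(\<lambda>w. indicator polydisk w *\<^sub>R ?k w) = ?k"
    by (auto simp: indicator_def)
  ultimately have meas: "?k \<in> borel_measurable dv"
    by (simp cong: measurable_cong_sets)
  define B where "B = (\<Prod>i\<in>UNIV. 1 / (1 - cmod (z $ i))\<^sup>2)"
  have bd: "cmod (?k w) \<le> B" for w
  proof (cases "w \<in> polydisk")
    case True
    have "cmod (of_real (1 - (cmod (z $ i))\<^sup>2) / (1 - w $ i * cnj (z $ i))\<^sup>2)
        \<le> 1 / (1 - cmod (z $ i))\<^sup>2" for i
    proof -
      have "(cmod (z $ i))\<^sup>2 \<le> 1"
        using kernel_denom_ge(2)[OF z True, of i] by (simp add: abs_square_le_1)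
      then have "cmod (of_real (1 - (cmod (z $ i))\<^sup>2)) \<le> 1"
        by (simp only: norm_of_real) simp
      moreover have "(1 - cmod (z $ i))\<^sup>2 \<le> (cmod (1 - w $ i * cnj (z $ i)))\<^sup>2"
        using kernel_denom_ge[OF z True, of i] by (intro power_mono) auto
      moreover have "(1 - cmod (z $ i))\<^sup>2 > 0"
        using kernel_denom_ge(2)[OF z True, of i] by (intro zero_less_power)
      ultimately show ?thesis
        unfolding norm_divide norm_power by (intro frac_le) auto
    qed
    then have "cmod (kernel_fun z w) \<le> B"
      unfolding kernel_fun_def B_def prod_norm[symmetric] by (intro prod_mono) auto
    then show ?thesis using True by simp
  qed (auto simp: B_def intro!: prod_nonneg)
  have "integrable dv (\<lambda>w. (cmod (?k w))\<^sup>2)"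
  proof (rule finite_measure.integrable_const_bound[OF finite_measure_dv, where B = "B\<^sup>2"])
    show "AE w in dv. norm ((cmod (?k w))\<^sup>2) \<le> B\<^sup>2"
    proof (rule AE_I2)
      fix w
      have "(cmod (?k w))\<^sup>2 \<le> B\<^sup>2" by (rule power_mono[OF bd norm_ge_zero])
      then show "norm ((cmod (?k w))\<^sup>2) \<le> B\<^sup>2" by (simp only: real_norm_def abs_of_nonneg zero_le_power2)
    qed
    show "(\<lambda>w. (cmod (?k w))\<^sup>2) \<in> borel_measurable dv"
      using meas by measurable
  qed
  then show ?thesis using an by (auto simp: bergman_set_def)
qed

text \<open>The normalized reproducing kernel at \<open>z\<close>; the value for \<open>z\<close> outside the polydisk is
  irrelevant.\<close>

lift_definition kernel :: "complex ^ 'n \<Rightarrow> 'n::finite bergman"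
  is "\<lambda>z w. if z \<in> polydisk \<and> w \<in> polydisk then kernel_fun z w else 0"
  subgoal for z
    using kernel_fun_in_bergman[of z] bergman_set_zero by (cases "z \<in> polydisk") auto
  done

text \<open>The possibly infinite sums are unconditional sums in the strong operator topology.\<close>

definition D0 :: "('n::finite bergman \<Rightarrow>\<^sub>L 'n bergman) set" where
  "D0 = {T. \<exists>\<Gamma> c \<gamma>. separated_set \<Gamma> \<and> bounded (c ` \<Gamma>) \<and> \<gamma> ` \<Gamma> \<subseteq> polydisk \<and>
     (\<exists>C\<ge>0. \<forall>z\<in>\<Gamma>. polydist z (\<gamma> z) \<le> C) \<and>
     (\<forall>h. ((\<lambda>z. blinfun_apply (op_cscale (c z) (kernel z \<otimes>\<^sub>b kernel (\<gamma> z))) h)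
       has_sum blinfun_apply T h) \<Gamma>)}"

definition loc_ops :: "('n::finite bergman \<Rightarrow>\<^sub>L 'n bergman) set" where
  "loc_ops = closure (cop.span D0)"

end

theory Submission
  imports Defs "HOL-Complex_Analysis.Conformal_Mappings" "HOL-Probability.Probability_Measure"
begin

text \<open>The two generating families have the same closed complex linear span, so the same C*-subalgebras
  contain them.

  Since \<open>T\<^sub>f\<close> is the integral of \<open>f(w) K\<^sub>w \<otimes> K\<^sub>w\<close>, it is compared with Riemann sums over fine partitions
  into hyperbolically small cells. The mean value property bounds the oscillation of a function on a
  cell by its mass on a larger cell, and a Carleson type count of overlaps turns this into an operator
  norm estimate. The Riemann sums lie in the span of \<open>D0\<close>, hence so does \<open>T\<^sub>f\<close> in the limit.
  Conversely, symbols concentrated near the points \<open>w\<^sub>z\<close> approximate the diagonal sums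
  \<open>\<Sum> c\<^sub>z k\<^bsub>w\<^sub>z\<^esub> \<otimes> k\<^bsub>w\<^sub>z\<^esub>\<close> by Toeplitz operators. An off-diagonal sum \<open>\<Sum> c\<^sub>z k\<^sub>z \<otimes> k\<^bsub>\<gamma>(z)\<^esub>\<close> is the value at
  \<open>\<i>\<close> of a holomorphic family of operators whose values at real arguments are diagonal sums; a
  quantitative identity theorem then places it in the closed span of the Toeplitz operators.\<close>

subsection \<open>The reproducing formula in the unit disc\<close>

text \<open>All operator estimates are made on the forms \<open>cinner (T h) g\<close>. A bound by a
  multiple of the sum of the squared norms of \<open>h\<close> and \<open>g\<close> is an operator
  norm bound, and since the functions enter through their masses on cells, summing over cells costs
  an overlap count. In the Riemann sums of mesh \<epsilon> the number of enlarged cells over one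
  point, whose relative radius stays fixed, grows like \<epsilon> to the power -2n. Each sample
  carries the relative volume of its small cell, of order \<epsilon> to the power 2n, so the
  weighted overlap stays bounded and the oscillation inside a cell leaves a factor \<epsilon>. Off
  the diagonal, normalizing factors such as 1 - |w|^2 are not holomorphic in the moving point;
  Jacobians of Moebius maps, of comparable modulus, replace them. The identity theorem has to be
  quantitative because one choice of real nodes and weights must serve all \<open>h\<close>,
  \<open>g\<close> and all finite partial sums. Since \<i> lies on the unit circle, the family must
  extend to a disc of radius above 1; the bound on d(z, \<gamma>(z)) leaves that room.\<close>

lemma nn_integral_lborel_shift:
  fixes f :: "'a::euclidean_space \<Rightarrow> ennreal"
  assumes [measurable]: "f \<in> borel_measurable borel"
  shows "(\<integral>\<^sup>+x. f (t + x) \<partial>lborel) = (\<integral>\<^sup>+x. f x \<partial>lborel)"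
proof -
  have "(\<integral>\<^sup>+x. f x \<partial>lborel) = (\<integral>\<^sup>+x. f x \<partial>distr lborel borel ((+) t))"
    by (simp add: lborel_distr_plus)
  also have "\<dots> = (\<integral>\<^sup>+x. f (t + x) \<partial>lborel)"
    by (subst nn_integral_distr) auto
  finally show ?thesis by simp
qed

lemma nn_integral_lborel_reflect:
  fixes f :: "'a::euclidean_space \<Rightarrow> ennreal"
  assumes [measurable]: "f \<in> borel_measurable borel"
  shows "(\<integral>\<^sup>+x. f (t - x) \<partial>lborel) = (\<integral>\<^sup>+x. f x \<partial>lborel)"
proof -
  have eq: "lborel = distr lborel borel (\<lambda>x::'a. t - x)"
    using lborel_affine[of "-1" t] by (simp add: density_1)
  show ?thesis
    by (subst (2) eq, subst nn_integral_distr) auto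
qed

text \<open>The image measure is again translation invariant, hence proportional to Lebesgue
  measure; the unit ball, which \<open>T\<close> preserves, fixes the factor at 1. The chain of
  integrals is this uniqueness argument: the integral of 1_A(T x) 1_B(T x + y) is computed in both
  orders.\<close>

lemma lborel_distr_isometry:
  fixes T :: "'a::euclidean_space \<Rightarrow> 'a"
  assumes lin: "linear T" and iso: "\<And>x. norm (T x) = norm x"
  shows "distr lborel borel T = lborel"
proof (rule measure_eqI)
  have [measurable]: "T \<in> borel_measurable borel"
    using linear_continuous_on[of T UNIV] lin
      by (intro borel_measurable_continuous_onI) (simp add: linear_conv_bounded_linear)
  have inj: "inj T"
    using lin iso by (metis linear_injective_0 norm_eq_zero)
  then have surj: "surj T" using lin linear_inj_imp_surj by blast
  fix A assume "A \<in> sets (distr lborel borel T)"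
  then have A[measurable]: "A \<in> sets borel" by simp
  let ?B = "ball 0 1 :: 'a set"
  have [measurable]: "?B \<in> sets borel" by simp
  have shiftB: "(\<integral>\<^sup>+y. indicator ?B (t + y) \<partial>lborel) = (\<integral>\<^sup>+y. indicator ?B y \<partial>lborel)" for t
    by (rule nn_integral_lborel_shift, rule borel_measurable_indicator) simp
  have reflA: "(\<integral>\<^sup>+y. indicator A (t - y) \<partial>lborel) = (\<integral>\<^sup>+y. indicator A y \<partial>lborel)" for t
    by (rule nn_integral_lborel_reflect, rule borel_measurable_indicator) simp
  have TB: "indicator ?B (T x) = (indicator ?B x :: ennreal)" for x
    using iso[of x] by (auto simp: indicator_def)
  have "emeasure (distr lborel borel T) A * emeasure lborel ?B
    = (\<integral>\<^sup>+x. indicator A (T x) * (\<integral>\<^sup>+y. indicator ?B y \<partial>lborel) \<partial>lborel)"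
  proof -
    have "emeasure (distr lborel borel T) A = (\<integral>\<^sup>+x. indicator A x \<partial>distr lborel borel T)" by simp
    also have "\<dots> = (\<integral>\<^sup>+x. indicator A (T x) \<partial>lborel)" by (subst nn_integral_distr) auto
    finally show ?thesis by (simp add: nn_integral_multc)
  qed
  also have "\<dots> = (\<integral>\<^sup>+x. indicator A (T x) * (\<integral>\<^sup>+y. indicator ?B (T x + y) \<partial>lborel) \<partial>lborel)"
    by (simp only: shiftB)
  also have "\<dots> = (\<integral>\<^sup>+x. \<integral>\<^sup>+y. indicator A (T x) * indicator ?B (T x + y) \<partial>lborel \<partial>lborel)"
    by (subst nn_integral_cmult) auto
  also have "\<dots> = (\<integral>\<^sup>+y. \<integral>\<^sup>+x. indicator A (T x) * indicator ?B (T x + y) \<partial>lborel \<partial>lborel)"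
    by (rule lborel_pair.Fubini') measurable
  also have "\<dots> = (\<integral>\<^sup>+y. \<integral>\<^sup>+x. indicator A (T x - y) * indicator ?B (T x) \<partial>lborel \<partial>lborel)"
  proof (rule nn_integral_cong)
    fix y :: 'a
    \<comment> \<open>A translation by \<open>y\<close> after \<open>T\<close> is a translation by
      \<open>y'\<close> before it.\<close>
    obtain y' where y: "y = T y'" using surj by blast
    have "(\<integral>\<^sup>+x. indicator A (T x) * indicator ?B (T x + y) \<partial>lborel)
       = (\<integral>\<^sup>+x. indicator A (T (- y' + x)) * indicator ?B (T (- y' + x) + y)
         \<partial>(lborel :: 'a measure))"
      by (rule nn_integral_lborel_shift[symmetric, where f = "\<lambda>x. indicator A (T x)
          * indicator ?B (T x + y)"]) measurable
    also have "\<dots> = (\<integral>\<^sup>+x. indicator A (T x - y) * indicator ?B (T x) \<partial>lborel)"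
      using linear_diff[OF lin] by (simp add: y)
    finally show "(\<integral>\<^sup>+x. indicator A (T x) * indicator ?B (T x + y) \<partial>lborel)
        = (\<integral>\<^sup>+x. indicator A (T x - y) * indicator ?B (T x) \<partial>lborel)" .
  qed
  also have "\<dots> = (\<integral>\<^sup>+x. \<integral>\<^sup>+y. indicator A (T x - y) * indicator ?B (T x) \<partial>lborel \<partial>lborel)"
    by (rule lborel_pair.Fubini') measurable
  also have "\<dots> = (\<integral>\<^sup>+x. (\<integral>\<^sup>+y. indicator A (T x - y) \<partial>lborel) * indicator ?B x \<partial>lborel)"
    by (subst nn_integral_multc) (auto simp: TB)
  also have "\<dots> = (\<integral>\<^sup>+x. emeasure lborel A * indicator ?B x \<partial>lborel)"
    by (simp add: reflA)
  also have "\<dots> = emeasure lborel A * emeasure lborel ?B"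
    by (subst nn_integral_cmult) auto
  finally have *: "emeasure (distr lborel borel T) A * emeasure lborel ?B
      = emeasure lborel A * emeasure lborel ?B" .
  have "emeasure lborel ?B \<noteq> 0"
  proof
    assume "emeasure lborel ?B = 0"
    then have "?B \<in> null_sets lborel" by (intro null_setsI) auto
    then have "negligible ?B" by (metis negligible_iff_null_sets null_sets_completionI)
    then show False using open_not_negligible[of ?B] by auto
  qed
  moreover have "emeasure lborel ?B < \<infinity>" by (rule emeasure_bounded_finite) auto
  ultimately show "emeasure (distr lborel borel T) A = emeasure lborel A"
    using * ennreal_mult_cancel_left[of "emeasure lborel ?B" "emeasure (distr lborel borel T) A"
      "emeasure lborel A"]
    unfolding mult.commute[of _ "emeasure lborel ?B"] by auto
qed simp

section \<open>Normalized area measure on the unit disc\<close>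

definition disc_measure :: "complex measure" where
  "disc_measure = uniform_measure lborel (ball 0 1)"

lemma emeasure_unit_disc: "emeasure lborel (ball 0 1 :: complex set) = ennreal pi"
  by (simp add: emeasure_ball unit_ball_vol_2)

lemma sets_disc_measure [simp, measurable_cong]: "sets disc_measure = sets borel"
  by (simp add: disc_measure_def)

lemma space_disc_measure [simp]: "space disc_measure = UNIV"
  by (simp add: disc_measure_def)

lemma prob_space_disc_measure: "prob_space disc_measure"
  unfolding disc_measure_def
  by (rule prob_space_uniform_measure) (simp_all add: emeasure_unit_disc)

lemma emeasure_disc_measure:
  "A \<in> sets borel \<Longrightarrow> emeasure disc_measure A = emeasure lborel (ball 0 1 \<inter> A) / ennreal pi"
  by (simp add: disc_measure_def emeasure_unit_disc)

lemma AE_disc_measure: "AE y in disc_measure. y \<in> ball 0 1"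
  unfolding disc_measure_def by (rule AE_uniform_measureI) auto

lemma distr_disc_measure_rotate:
  assumes c: "cmod c = 1"
  shows "distr disc_measure borel ((*) c) = disc_measure"
proof (rule measure_eqI)
  fix A assume "A \<in> sets (distr disc_measure borel ((*) c))"
  then have [measurable]: "A \<in> sets borel" by simp
  have [measurable]: "(*) c \<in> borel_measurable borel"
    by (intro borel_measurable_continuous_onI continuous_intros)
  have iso: "distr lborel borel ((*) c) = lborel"
    by (rule lborel_distr_isometry) (auto simp: norm_mult c intro: bounded_linear.linear
      bounded_linear_mult_right)
  have "ball 0 1 \<inter> (*) c -` A = (*) c -` (ball 0 1 \<inter> A)"
    using c by (auto simp: norm_mult)
  moreover have "emeasure lborel ((*) c -` (ball 0 1 \<inter> A))
      = emeasure (distr lborel borel ((*) c)) (ball 0 1 \<inter> A)"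
    by (subst emeasure_distr) auto
  ultimately have "emeasure lborel (ball 0 1 \<inter> (*) c -` A) = emeasure lborel (ball 0 1 \<inter> A)"
    by (simp add: iso)
  moreover have "(*) c -` A \<in> sets borel"
    using measurable_sets_borel[of "(*) c" borel A] by simp
  ultimately show "emeasure (distr disc_measure borel ((*) c)) A = emeasure disc_measure A"
    by (subst emeasure_distr) (auto simp: emeasure_disc_measure)
qed simp

text \<open>For x in [0,1) the part of the disc with squared modulus above x has area pi (1 - x).
  Tails determine a finite Borel measure on the line.\<close>

lemma distr_disc_measure_norm_square:
  "distr disc_measure borel (\<lambda>y. (cmod y)\<^sup>2) = uniform_measure lborel {0..1::real}"
proof (rule measure_eqI_lessThan)
  interpret prob_space disc_measure by (rule prob_space_disc_measure)
  have m[measurable]: "(\<lambda>y. (cmod y)\<^sup>2) \<in> borel_measurable borel" by measurable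
  have d: "emeasure (distr disc_measure borel (\<lambda>y. (cmod y)\<^sup>2)) {x<..}
      = emeasure disc_measure {y. x < (cmod y)\<^sup>2}" for x
    by (subst emeasure_distr) (auto intro!: arg_cong[where f = "emeasure disc_measure"])
  show "emeasure (distr disc_measure borel (\<lambda>y. (cmod y)\<^sup>2)) {x<..} < \<infinity>" for x
    unfolding d by (simp add: less_top[symmetric])
  show "emeasure (distr disc_measure borel (\<lambda>y. (cmod y)\<^sup>2)) {x<..}
      = emeasure (uniform_measure lborel {0..1}) {x<..}" for x :: real
  proof -
    have r: "emeasure (uniform_measure lborel {0..1::real}) {x<..}
        = emeasure lborel ({0..1} \<inter> {x<..})"
      by (simp add: divide_ennreal_def)
    have meas: "{y::complex. x < (cmod y)\<^sup>2} \<in> sets borel" by measurable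
    consider "x < 0" | "0 \<le> x" "x < 1" | "1 \<le> x" by linarith
    then show ?thesis
    proof cases
      case 1
      then have "{y::complex. x < (cmod y)\<^sup>2} = UNIV" "{0..1} \<inter> {x<..} = {0..1}"
        using zero_le_power2 by (auto intro: less_le_trans)
      then show ?thesis unfolding d r using emeasure_space_1 by simp
    next
      case 2
      have "ball 0 1 \<inter> {y::complex. x < (cmod y)\<^sup>2} = ball 0 1 - cball 0 (sqrt x)"
        using real_less_lsqrt[of _ x] 2 by (auto simp: not_le real_sqrt_less_iff intro:
          real_less_lsqrt)
          (smt (verit) norm_ge_zero real_le_lsqrt real_sqrt_le_iff real_sqrt_abs sqrt_le_D
            real_sqrt_pow2 power_mono real_le_rsqrt)+
      moreover have "emeasure lborel (ball 0 1 - cball 0 (sqrt x) :: complex set)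
          = ennreal (pi * (1 - x))"
      proof -
        have "emeasure lborel (ball 0 1 - cball 0 (sqrt x) :: complex set)
            = emeasure lborel (ball 0 1 :: complex set)
            - emeasure lborel (cball 0 (sqrt x) :: complex set)"
        proof (rule emeasure_Diff)
          show "cball 0 (sqrt x) \<subseteq> (ball 0 1 :: complex set)" using 2
            by auto (smt (verit) real_sqrt_lt_1_iff)
          show "emeasure lborel (cball 0 (sqrt x) :: complex set) \<noteq> \<infinity>"
            using emeasure_compact_finite[of "cball 0 (sqrt x) :: complex set"]
              by (auto simp: less_top)
        qed auto
        also have "emeasure lborel (cball 0 (sqrt x) :: complex set) = ennreal (pi * x)"
          using 2 by (simp add: emeasure_cball unit_ball_vol_2)
        also have "emeasure lborel (ball 0 1 :: complex set) - ennreal (pi * x)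
            = ennreal (pi * (1 - x))"
          using 2 by (simp add: emeasure_unit_disc ennreal_minus algebra_simps)
        finally show ?thesis .
      qed
      moreover have "{0..1} \<inter> {x<..} = {x<..1}" using 2 by auto
      ultimately show ?thesis
        unfolding d r using 2 by (simp add: emeasure_disc_measure[OF meas] divide_ennreal)
    next
      case 3
      have "ball 0 1 \<inter> {y::complex. x < (cmod y)\<^sup>2} = {}"
        using 3 power_mono[of "cmod _" 1 2] by (auto simp: not_less)
          (smt (verit) norm_ge_zero power_le_one)
      moreover have "{0..1} \<inter> {x<..} = {}" using 3 by auto
      ultimately show ?thesis unfolding d r by (simp add: emeasure_disc_measure[OF meas])
    qed
  qed
qed auto

text \<open>The rotation mean of the integrand is \<open>d/ds (s f(s z))\<close> at \<open>s = |y|\<^sup>2\<close>; since \<open>|y|\<^sup>2\<close> is uniformly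
  distributed on \<open>[0,1]\<close>, the fundamental theorem of calculus then gives the reproducing formula.\<close>

lemma disc_rotation_mean:
  fixes f :: "complex \<Rightarrow> complex"
  assumes hol: "f holomorphic_on ball 0 1" and z: "cmod z < 1" and y: "cmod y < 1"
  shows "((\<lambda>t. f (exp (2 * of_real pi * \<i> * of_real t) * y)
      / (1 - cnj (exp (2 * of_real pi * \<i> * of_real t) * y) * z)\<^sup>2)
     has_integral (f (of_real ((cmod y)\<^sup>2) * z) + of_real ((cmod y)\<^sup>2) * z * deriv f
       (of_real ((cmod y)\<^sup>2) * z))) {0..1}"
proof -
  let ?e = "\<lambda>t::real. exp (2 * of_real pi * \<i> * of_real t)"
  \<comment> \<open>On the unit circle cnj \<zeta> = 1 / \<zeta>, so 1 - cnj (\<zeta> y) z =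
    (\<zeta> - w) / \<zeta> and the mean becomes Cauchy's integral for the derivative of
    \<open>g\<close> at \<open>w\<close>. Of the two factors \<zeta> from the squared denominator,
    one goes into \<open>g\<close> and the other is the Jacobian of the parametrization.\<close>
  define g where "g = (\<lambda>\<zeta>. \<zeta> * f (\<zeta> * y))"
  define w where "w = cnj y * z"
  have w1: "cmod w < 1"
    using mult_strict_mono'[of "cmod y" 1 "cmod z" 1] y z by (simp add: w_def norm_mult)
  have yw: "w * y = of_real ((cmod y)\<^sup>2) * z"
    unfolding complex_norm_square by (simp add: w_def mult_ac)
  have in_ball: "\<zeta> * y \<in> ball 0 1" if "cmod \<zeta> \<le> 1" for \<zeta>
    using mult_left_le_one_le[of "cmod y" "cmod \<zeta>"] that y by (simp add: norm_mult)
  have df: "(f has_field_derivative deriv f x) (at x)" if "x \<in> ball 0 1" for x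
    using hol that by (simp add: holomorphic_derivI)
  have dg: "(g has_field_derivative f (\<zeta> * y) + \<zeta> * (deriv f (\<zeta> * y) * y)) (at \<zeta>)"
    if "cmod \<zeta> \<le> 1" for \<zeta>
  proof -
    have "((\<lambda>\<zeta>. \<zeta> * y) has_field_derivative y) (at \<zeta>)"
      using DERIV_cmult_right[OF DERIV_ident, of y \<zeta>] by simp
    from DERIV_mult[OF DERIV_ident DERIV_chain2[OF df[OF in_ball[OF that]] this]]
    show ?thesis unfolding g_def by (simp add: algebra_simps)
  qed
  have contg: "continuous_on (cball 0 1) g"
  proof (intro continuous_at_imp_continuous_on ballI)
    fix x :: complex assume "x \<in> cball 0 1"
    then show "isCont g x" using DERIV_isCont[OF dg[of x]] by simp
  qed
  have holg: "g holomorphic_on ball 0 1"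
  proof (rule holomorphic_onI)
    fix x :: complex assume "x \<in> ball 0 1"
    then show "g field_differentiable at x within ball 0 1"
      using has_field_derivative_at_within[OF dg[of x]] by (auto simp: field_differentiable_def)
  qed
  note C = Cauchy_derivative_integral_circlepath[OF contg holg, of w]
  have D: "1 / (2 * of_real pi * \<i>) * contour_integral (circlepath 0 1) (\<lambda>u. g u / (u - w)\<^sup>2)
     = f (w * y) + w * (deriv f (w * y) * y)"
    using C(2) dg[of w] w1 by (auto intro: DERIV_unique)
  have "((\<lambda>u. g u / (u - w)\<^sup>2) has_contour_integral (2 * of_real pi * \<i>)
      * (f (w * y) + w * (deriv f (w * y) * y))) (circlepath 0 1)"
    using has_contour_integral_integral[OF C(1)] D w1 by (simp add: field_simps)
  then have "((\<lambda>t. g (?e t) / (?e t - w)\<^sup>2 * (2 * of_real pi * \<i> * ?e t)) has_integral (2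
      * of_real pi * \<i>) * (f (w * y) + w * (deriv f (w * y) * y))) {0..1}"
    unfolding has_contour_integral_def
  proof (rule has_integral_eq[rotated])
    fix t :: real assume "t \<in> {0..1}"
    then have "vector_derivative (circlepath 0 1) (at t within {0..1}) = 2 * of_real pi * \<i> * ?e t"
      by (simp add: vector_derivative_circlepath01)
    then show "g (circlepath 0 1 t) / (circlepath 0 1 t - w)\<^sup>2
        * vector_derivative (circlepath 0 1) (at t within {0..1})
        = g (?e t) / (?e t - w)\<^sup>2 * (2 * of_real pi * \<i> * ?e t)"
      by (simp add: circlepath)
  qed
  then have "((\<lambda>t. 1 / (2 * of_real pi * \<i>) * (g (?e t) / (?e t - w)\<^sup>2
      * (2 * of_real pi * \<i> * ?e t))) has_integral 1 / (2 * of_real pi * \<i>)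
      * ((2 * of_real pi * \<i>) * (f (w * y) + w * (deriv f (w * y) * y)))) {0..1}"
    by (rule has_integral_mult_right)
  moreover have cancel: "1 / c * (a * (c * b)) = a * b" "1 / c * (c * b) = b"
    if "c \<noteq> 0" for a b c :: complex
    using that by simp_all
  have "2 * of_real pi * \<i> \<noteq> 0" by simp
  note cancel[OF this]
  ultimately have "((\<lambda>t. g (?e t) / (?e t - w)\<^sup>2 * ?e t) has_integral (f (w * y)
      + w * (deriv f (w * y) * y))) {0..1}"
    by (simp only:)
  moreover have "g (?e t) / (?e t - w)\<^sup>2 * ?e t = f (?e t * y) / (1 - cnj (?e t * y) * z)\<^sup>2" for t
  proof -
    have n: "cmod (?e t) = 1" by simp
    then have "?e t * cnj (?e t) = 1" by (simp flip: complex_norm_square)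
    then have "?e t - w = ?e t * (1 - cnj (?e t * y) * z)"
      by (simp add: w_def algebra_simps)
    then show ?thesis
      by (simp add: g_def power_mult_distrib power2_eq_square)
  qed
  ultimately have "((\<lambda>t. f (?e t * y) / (1 - cnj (?e t * y) * z)\<^sup>2) has_integral (f (w * y)
      + w * (deriv f (w * y) * y))) {0..1}"
    by simp
  moreover have "w * (deriv f (w * y) * y) = w * y * deriv f (w * y)"
    by simp
  ultimately show ?thesis
    unfolding yw[symmetric] by (simp only:)
qed

lemma disc_kernel_denom_ge:
  assumes "cmod y < 1" "cmod z < 1"
  shows "1 - cmod z \<le> cmod (1 - cnj y * z)"
proof -
  have "cmod (cnj y * z) \<le> cmod z"
    using assms by (simp add: norm_mult mult_left_le_one_le)
  then show ?thesis using norm_triangle_ineq2[of 1 "cnj y * z"] by simp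
qed

lemma disc_reproducing:
  fixes f :: "complex \<Rightarrow> complex"
  assumes hol: "f holomorphic_on ball 0 1" and int: "integrable disc_measure f" and z: "cmod z < 1"
  shows "integrable disc_measure (\<lambda>y. f y / (1 - cnj y * z)\<^sup>2)"
    and "(LINT y|disc_measure. f y / (1 - cnj y * z)\<^sup>2) = f z"
proof -
  interpret prob_space disc_measure by (rule prob_space_disc_measure)
  define F where "F = (\<lambda>y. f y / (1 - cnj y * z)\<^sup>2)"
  have [measurable]: "f \<in> borel_measurable borel"
    using int by (auto dest: borel_measurable_integrable cong: measurable_cong_sets)
  have [measurable]: "(\<lambda>y. (1 - cnj y * z)\<^sup>2) \<in> borel_measurable borel"
    by (intro borel_measurable_continuous_onI continuous_intros)
  have Fm[measurable]: "F \<in> borel_measurable borel"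
    unfolding F_def by measurable
  \<comment> \<open>For fixed \<open>z\<close> the kernel is bounded on the disc, so integrability
    passes from \<open>f\<close> to \<open>F\<close>.\<close>
  have bd: "cmod (F y) \<le> cmod (f y / of_real ((1 - cmod z)\<^sup>2))" if "y \<in> ball 0 1" for y
  proof -
    have "(1 - cmod z)\<^sup>2 \<le> (cmod (1 - cnj y * z))\<^sup>2"
      using disc_kernel_denom_ge[of y z] that z by (intro power_mono) auto
    then have "cmod (f y) / (cmod (1 - cnj y * z))\<^sup>2 \<le> cmod (f y) / (1 - cmod z)\<^sup>2"
      using z by (intro divide_left_mono) (auto intro!: mult_pos_pos zero_less_power intro:
        less_le_trans[of 0 "(1 - cmod z)\<^sup>2"])
    then show ?thesis
      by (simp add: F_def norm_divide norm_power del: of_real_power)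
  qed
  have Fint: "integrable disc_measure F"
  proof (rule Bochner_Integration.integrable_bound)
    show "integrable disc_measure (\<lambda>y. f y / of_real ((1 - cmod z)\<^sup>2))"
      using int by (intro integrable_divide) auto
    show "AE y in disc_measure. cmod (F y) \<le> cmod (f y / of_real ((1 - cmod z)\<^sup>2))"
      using AE_disc_measure bd by (auto elim: eventually_mono)
  qed auto
  then show "integrable disc_measure (\<lambda>y. f y / (1 - cnj y * z)\<^sup>2)" by (simp add: F_def)
  let ?e = "\<lambda>t::real. exp (2 * of_real pi * \<i> * of_real t) :: complex"
  let ?U = "uniform_measure lborel {0..1::real}"
  interpret U: prob_space ?U by (rule prob_space_uniform_measure) auto
  interpret UD: pair_prob_space ?U disc_measure ..
  have rot: "distr disc_measure borel ((*) (?e t)) = disc_measure" for t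
    by (rule distr_disc_measure_rotate) simp
  have rotF: "(LINT y|disc_measure. G (?e t * y)) = (LINT y|disc_measure. G y)"
    if [measurable]: "G \<in> borel_measurable borel"
      for G :: "complex \<Rightarrow> 'a::{banach, second_countable_topology}" and t
    by (subst (2) rot[of t, symmetric], subst integral_distr) auto
  have rotI: "integrable disc_measure (\<lambda>y. F (?e t * y))" for t
    using Fint by (subst (asm) rot[of t, symmetric], subst (asm) integrable_distr_eq) auto
  have em: "(\<lambda>(t, y). F (?e t * y)) \<in> borel_measurable (?U \<Otimes>\<^sub>M disc_measure)"
  proof -
    have "(\<lambda>p :: real \<times> complex. ?e (fst p) * snd p) \<in> borel_measurable borel"
      by (intro borel_measurable_continuous_onI continuous_intros)
    then have "(\<lambda>p. F (?e (fst p) * snd p)) \<in> borel_measurable (borel \<Otimes>\<^sub>M borel)"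
      by (intro measurable_compose[OF _ Fm]) (simp add: borel_prod)
    then show ?thesis
      by (simp add: case_prod_beta' cong: measurable_cong_sets)
  qed
  \<comment> \<open>Every rotated copy of \<open>F\<close> has the same L^1 norm, so Fubini's
    theorem applies to the product.\<close>
  have I: "integrable (?U \<Otimes>\<^sub>M disc_measure) (\<lambda>(t, y). F (?e t * y))"
    by (rule UD.Fubini_integrable[OF em]) (auto simp: rotF[of "\<lambda>x. norm (F x)"] rotI)
  have UI: "(LINT t|?U. G t) = i" if "(G has_integral i) {0..1}" "continuous_on {0..1} G"
    and [measurable]: "G \<in> borel_measurable borel" for G :: "real \<Rightarrow> complex" and i
  proof -
    have "set_integrable lborel {0..1} G"
      using that(2) borel_integrable_compact[of "{0..1}" G] by (simp add: set_integrable_def)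
    then have "(LINT t:{0..1}|lborel. G t) = i"
      using that(1) has_integral_unique set_borel_integral_eq_integral(2) integral_unique by metis
    moreover have "(LINT t|?U. G t) = (LINT t:{0..1}|lborel. G t)"
    proof -
      have "?U = density lborel (\<lambda>x. ennreal (indicator {0..1} x))"
        unfolding uniform_measure_def by (rule density_cong)
          (auto simp: divide_ennreal_def indicator_def)
      then show ?thesis
        unfolding set_lebesgue_integral_def by (simp add: integral_density)
    qed
    ultimately show ?thesis by simp
  qed
  define \<Psi> where "\<Psi> s = f (of_real s * z) + of_real s * z * deriv f (of_real s * z)" for s :: real
  have inb: "of_real s * z \<in> ball 0 1" if "s \<in> {0..1}" for s :: real
    using mult_left_le_one_le[of "cmod z" s] that z by (simp add: norm_mult)
  have df: "(f has_field_derivative deriv f x) (at x)" if "x \<in> ball 0 1" for x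
    using hol that by (simp add: holomorphic_derivI)
  have cf: "continuous_on (ball 0 1) f" "continuous_on (ball 0 1) (deriv f)"
    using hol by (auto intro!: holomorphic_on_imp_continuous_on holomorphic_deriv)
  have cPsi: "continuous_on {0..1} \<Psi>"
    unfolding \<Psi>_def
    by (intro continuous_intros continuous_on_compose2[OF cf(1)] continuous_on_compose2[OF cf(2)])
      (use inb in auto)
  \<comment> \<open>\<Psi> is controlled only on [0,1]. The cutoff is Borel on the whole line, as
    the change of variables by |y|^2 requires.\<close>
  define \<Phi> where "\<Phi> s = indicator {0..1} s *\<^sub>R \<Psi> s" for s :: real
  have \<Phi>m[measurable]: "\<Phi> \<in> borel_measurable borel"
    unfolding \<Phi>_def by (rule borel_measurable_continuous_on_indicator) (use cPsi in auto)
  have cPhi: "continuous_on {0..1} \<Phi>"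
    using cPsi by (rule continuous_on_eq) (simp add: \<Phi>_def)
  \<comment> \<open>\<Psi> is the derivative of s f(s z), whose boundary term at 0 vanishes.\<close>
  have "(\<Psi> has_integral (of_real 1 * f (of_real 1 * z) - of_real 0 * f (of_real 0 * z))) {0..1}"
  proof (rule fundamental_theorem_of_calculus)
    fix s :: real assume s: "s \<in> {0..1}"
    have "((\<lambda>x. x * f (x * z)) has_field_derivative \<Psi> s) (at (of_real s))"
    proof -
      have "((\<lambda>x. x * z) has_field_derivative z) (at (of_real s))"
        using DERIV_cmult_right[OF DERIV_ident, of z] by simp
      from DERIV_mult[OF DERIV_ident DERIV_chain2[OF df[OF inb[OF s]] this]]
      show ?thesis unfolding \<Psi>_def by (simp add: algebra_simps)
    qed
    then show "((\<lambda>s. of_real s * f (of_real s * z)) has_vector_derivative \<Psi> s) (at s within {0..1})"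
      by (rule has_vector_derivative_real_field)
  qed simp
  then have iPhi: "(\<Phi> has_integral f z) {0..1}"
    using has_integral_eq[of "{0..1}" \<Psi> \<Phi>] by (simp add: \<Phi>_def)
  have inner: "(LINT t|?U. F (?e t * y)) = \<Phi> ((cmod y)\<^sup>2)" if y: "y \<in> ball 0 1" for y
  proof (rule UI)
    have y1: "(cmod y)\<^sup>2 \<in> {0..1}" using y by (simp add: abs_square_le_1)
    show "((\<lambda>t. F (?e t * y)) has_integral \<Phi> ((cmod y)\<^sup>2)) {0..1}"
      using disc_rotation_mean[OF hol z, of y] y y1 by (simp add: F_def \<Phi>_def \<Psi>_def)
    have eb: "?e t * y \<in> ball 0 1" for t using y by (simp add: norm_mult)
    have nz: "1 - cnj w * z \<noteq> 0" if "w \<in> ball 0 1" for w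
      using disc_kernel_denom_ge[of w z] that z by auto
    have "continuous_on (ball 0 1) F"
      unfolding F_def using nz by (intro continuous_intros cf) auto
    then have "continuous_on UNIV (\<lambda>t. F (?e t * y))"
      by (rule continuous_on_compose2) (use eb in \<open>auto intro!: continuous_intros\<close>)
    then show "continuous_on {0..1} (\<lambda>t. F (?e t * y))" "(\<lambda>t. F (?e t * y))
        \<in> borel_measurable borel"
      by (auto intro: continuous_on_subset borel_measurable_continuous_onI)
  qed
  have m2: "(\<lambda>y. (cmod y)\<^sup>2) \<in> borel_measurable disc_measure" by measurable
  have "(LINT y|disc_measure. F y) = (LINT t|?U. LINT y|disc_measure. F (?e t * y))"
    by (simp add: rotF U.prob_space)
  also have "\<dots> = (LINT y|disc_measure. LINT t|?U. F (?e t * y))"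
    using UD.Fubini_integral[of "\<lambda>t y. F (?e t * y)"] I by simp
  also have "\<dots> = (LINT y|disc_measure. \<Phi> ((cmod y)\<^sup>2))"
  proof (rule integral_cong_AE)
    have "(\<lambda>(y, t). F (?e t * y)) \<in> borel_measurable (disc_measure \<Otimes>\<^sub>M ?U)"
      using measurable_pair_swap[OF em] by (simp add: case_prod_beta')
    then show "(\<lambda>y. LINT t|?U. F (?e t * y)) \<in> borel_measurable disc_measure"
      by (rule U.borel_measurable_lebesgue_integral)
    show "(\<lambda>y. \<Phi> ((cmod y)\<^sup>2)) \<in> borel_measurable disc_measure"
      by (rule measurable_compose[OF m2 \<Phi>m])
    show "AE y in disc_measure. (LINT t|?U. F (?e t * y)) = \<Phi> ((cmod y)\<^sup>2)"
      using AE_disc_measure by (rule eventually_mono) (rule inner)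
  qed
  also have "\<dots> = (LINT s|?U. \<Phi> s)"
    unfolding distr_disc_measure_norm_square[symmetric]
    by (rule integral_distr[symmetric]) auto
  also have "\<dots> = f z"
    by (rule UI[OF iPhi cPhi \<Phi>m])
  finally show "(LINT y|disc_measure. f y / (1 - cnj y * z)\<^sup>2) = f z" by (simp add: F_def)
qed

subsection \<open>The reproducing formula in the polydisk\<close>

lemma mem_box_vec:
  fixes a b w :: "'a::euclidean_space ^ 'n"
  shows "w \<in> box a b \<longleftrightarrow> (\<forall>i. w $ i \<in> box (a $ i) (b $ i))"
  by (auto simp: mem_box Basis_vec_def inner_axis)

lemma prod_Basis_vec:
  fixes f :: "'a::euclidean_space ^ 'n \<Rightarrow> 'b::comm_monoid_mult"
  shows "(\<Prod>b\<in>Basis. f b) = (\<Prod>i\<in>UNIV. \<Prod>b\<in>Basis. f (axis i b))"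
proof -
  have inj: "inj_on (\<lambda>(i, b). axis i b :: 'a ^ 'n) (UNIV \<times> Basis)"
    by (auto simp: inj_on_def axis_eq_axis)
  have "(Basis :: ('a ^ 'n) set) = (\<lambda>(i, b). axis i b) ` (UNIV \<times> Basis)"
    by (auto simp: Basis_vec_def)
  then have "(\<Prod>b\<in>Basis. f b) = (\<Prod>(i, b)\<in>UNIV \<times> Basis. f (axis i b))"
    using prod.reindex[OF inj, of f] by (simp add: case_prod_beta' o_def)
  then show ?thesis
    by (simp add: prod.cartesian_product)
qed

lemma measurable_vec_lambda_PiM:
  "(\<lambda>x. \<chi> i. x i) \<in> (\<Pi>\<^sub>M i\<in>(UNIV :: 'n::finite set). (borel :: 'a::euclidean_space measure)) \<rightarrow>\<^sub>M
      borel"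
  by (subst borel_measurable_euclidean_space) (auto simp: Basis_vec_def inner_axis)

lemma borel_measurable_vec_nth [measurable]:
  "(\<lambda>w :: 'a::euclidean_space ^ 'n. w $ i) \<in> borel_measurable borel"
  by (intro borel_measurable_continuous_onI continuous_intros)

text \<open>Lebesgue measure on the vector type is the image of a product measure: the two agree on
  boxes, which characterizes \<open>lborel\<close>. The measure of a rectangle is then read off the
  product.\<close>

lemma emeasure_lborel_rect:
  fixes A :: "'n::finite \<Rightarrow> complex set"
  assumes A[measurable]: "\<And>i. A i \<in> sets borel"
  shows "emeasure lborel {w :: complex ^ 'n. \<forall>i. w $ i \<in> A i} = (\<Prod>i\<in>UNIV. emeasure lborel (A i))"
proof -
  interpret product_sigma_finite "\<lambda>_::'n. lborel :: complex measure" ..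
  let ?L = "\<Pi>\<^sub>M i\<in>(UNIV :: 'n set). (lborel :: complex measure)"
  let ?V = "\<lambda>x. (\<chi> i. x i) :: complex ^ 'n"
  have [measurable]: "?V \<in> ?L \<rightarrow>\<^sub>M borel"
    using measurable_vec_lambda_PiM by (simp cong: measurable_cong_sets sets_PiM_cong)
  have rect: "emeasure (distr ?L borel ?V) {w. \<forall>i. w $ i \<in> B i} = (\<Prod>i\<in>UNIV. emeasure lborel (B i))"
    if [measurable]: "\<And>i. B i \<in> sets borel" for B :: "'n \<Rightarrow> complex set"
  proof -
    have "?V -` {w. \<forall>i. w $ i \<in> B i} \<inter> space ?L = Pi\<^sub>E UNIV B"
      by (auto simp: space_PiM PiE_def)
    moreover have "{w :: complex ^ 'n. \<forall>i. w $ i \<in> B i} \<in> sets borel" by measurable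
    ultimately show ?thesis
      by (subst emeasure_distr) (auto simp: emeasure_PiM)
  qed
  have "lborel = distr ?L borel ?V"
  proof (rule lborel_eqI)
    fix l u :: "complex ^ 'n" assume le: "\<And>b. b \<in> Basis \<Longrightarrow> l \<bullet> b \<le> u \<bullet> b"
    have le': "l $ i \<bullet> b \<le> u $ i \<bullet> b" if "b \<in> Basis" for i b
      using le[of "axis i b"] that by (simp add: inner_axis)
    have "box l u = {w. \<forall>i. w $ i \<in> box (l $ i) (u $ i)}"
      by (auto simp: mem_box_vec)
    then have "emeasure (distr ?L borel ?V) (box l u)
        = (\<Prod>i\<in>UNIV. emeasure lborel (box (l $ i) (u $ i)))"
      using rect[of "\<lambda>i. box (l $ i) (u $ i)"] by simp
    also have "\<dots> = (\<Prod>i\<in>UNIV. ennreal (\<Prod>b\<in>Basis. (u $ i - l $ i) \<bullet> b))"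
      using le' by (intro prod.cong refl emeasure_lborel_box)
    also have "\<dots> = ennreal (\<Prod>i\<in>UNIV. \<Prod>b\<in>Basis. (u $ i - l $ i) \<bullet> b)"
      using le' by (intro prod_ennreal prod_nonneg) (auto simp: inner_diff_left)
    also have "\<dots> = ennreal (\<Prod>b\<in>Basis. (u - l) \<bullet> b)"
      by (simp add: prod_Basis_vec inner_axis)
    finally show "emeasure (distr ?L borel ?V) (box l u) = (\<Prod>b\<in>Basis. (u - l) \<bullet> b)" .
  qed simp
  then show ?thesis using rect[of A] by simp
qed

lemma polydisk_rect: "polydisk = {w. \<forall>i. w $ i \<in> ball 0 1}"
  by (auto simp: polydisk_def)

lemma prob_space_dv: "prob_space (dv :: (complex ^ 'n) measure)"
  unfolding dv_def using emeasure_polydisk_nonzero emeasure_polydisk_finite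
  by (intro prob_space_uniform_measure) (auto simp: less_top)

lemma AE_dv_polydisk: "AE w in dv. w \<in> polydisk"
  by (simp add: AE_dv_iff)

lemma emeasure_dv_rect:
  fixes A :: "'n::finite \<Rightarrow> complex set"
  assumes A[measurable]: "\<And>i. A i \<in> sets borel"
  shows "emeasure dv {w :: complex ^ 'n. \<forall>i. w $ i \<in> A i} = (\<Prod>i\<in>UNIV. emeasure disc_measure (A i))"
proof -
  have rm: "{w :: complex ^ 'n. \<forall>i. w $ i \<in> A i} \<in> sets borel" by measurable
  have eq: "polydisk \<inter> {w :: complex ^ 'n. \<forall>i. w $ i \<in> A i} = {w. \<forall>i. w $ i \<in> ball 0 1 \<inter> A i}"
    by (auto simp: polydisk_def)
  have d: "emeasure lborel (ball 0 1 \<inter> A i) = ennreal pi * emeasure disc_measure (A i)" for i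
    using ennreal_mult_divide_eq[of "ennreal pi" "emeasure lborel (ball 0 1 \<inter> A i)"]
    by (simp add: emeasure_disc_measure ennreal_times_divide mult.commute)
  have "emeasure dv {w :: complex ^ 'n. \<forall>i. w $ i \<in> A i}
      = emeasure lborel {w :: complex ^ 'n. \<forall>i. w $ i \<in> ball 0 1 \<inter> A i} / emeasure lborel {w ::
        complex ^ 'n. \<forall>i. w $ i \<in> ball 0 1}"
    unfolding dv_def by (subst emeasure_uniform_measure) (use rm eq in \<open>auto simp: polydisk_rect\<close>)
  also have "\<dots> = (ennreal pi ^ CARD('n) * (\<Prod>i\<in>UNIV. emeasure disc_measure (A i)))
      / ennreal pi ^ CARD('n)"
    by (subst (1 2) emeasure_lborel_rect) (auto simp: d emeasure_unit_disc prod.distrib)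
  also have "\<dots> = (\<Prod>i\<in>UNIV. emeasure disc_measure (A i))"
    using ennreal_mult_divide_eq[of "ennreal pi ^ CARD('n)" "\<Prod>i\<in>UNIV. emeasure disc_measure (A i)"]
    by (simp add: mult.commute ennreal_power)
  finally show ?thesis .
qed

section \<open>Integrating one coordinate at a time\<close>

definition upd_coord :: "'n \<Rightarrow> complex ^ 'n \<Rightarrow> complex \<Rightarrow> complex ^ 'n" where
  "upd_coord i w y = (\<chi> j. if j = i then y else w $ j)"

lemma upd_coord_nth [simp]: "upd_coord i w y $ j = (if j = i then y else w $ j)"
  by (simp add: upd_coord_def)

lemma continuous_on_upd_coord: "continuous_on UNIV (\<lambda>p. upd_coord i (fst p) (snd p))"
  unfolding upd_coord_def
proof (rule continuous_on_vec_lambda)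
  show "continuous_on UNIV (\<lambda>p. if j = i then snd p else fst p $ j)" for j
    by (cases "j = i") (auto intro!: continuous_intros)
qed

lemma measurable_upd_coord: "(\<lambda>(w, y). upd_coord i w y) \<in> dv \<Otimes>\<^sub>M disc_measure \<rightarrow>\<^sub>M borel"
proof -
  have "(\<lambda>p. upd_coord i (fst p) (snd p)) \<in> borel_measurable (borel \<Otimes>\<^sub>M borel)"
    using continuous_on_upd_coord[of i] by (simp add: borel_prod borel_measurable_continuous_onI)
  then show ?thesis
    by (simp add: case_prod_beta' cong: measurable_cong_sets)
qed

text \<open>Resampling coordinate \<open>i\<close> by an independent point of the disc does not
  change the distribution. In this form Fubini's theorem applies to a single coordinate without
  splitting the index type.\<close>

lemma distr_upd_coord:
  fixes i :: "'n::finite"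
  shows "distr (dv \<Otimes>\<^sub>M disc_measure) borel (\<lambda>(w, y). upd_coord i w y) = dv"
proof (rule measure_eqI_generator_eq)
  interpret D: prob_space disc_measure by (rule prob_space_disc_measure)
  interpret dv: prob_space "dv :: (complex ^ 'n) measure" by (rule prob_space_dv)
  let ?E = "range (\<lambda>(a, b). box a b :: (complex ^ 'n) set)"
  let ?A = "\<lambda>n::nat. box (- (real n *\<^sub>R One)) (real n *\<^sub>R One) :: (complex ^ 'n) set"
  let ?M = "distr (dv \<Otimes>\<^sub>M disc_measure) borel (\<lambda>(w, y). upd_coord i w y)"
  note m = measurable_upd_coord[of i]
  show "Int_stable ?E" by (auto simp: Int_stable_def box_Int_box)
  show "?E \<subseteq> Pow UNIV" "sets ?M = sigma_sets UNIV ?E" "sets dv = sigma_sets UNIV ?E"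
    by (simp_all add: borel_eq_box)
  show "range ?A \<subseteq> ?E" "(\<Union>n. ?A n) = UNIV" unfolding UN_box_eq_UNIV by auto
  have prect: "emeasure ?M {w. \<forall>j. w $ j \<in> A j} = (\<Prod>j\<in>UNIV. emeasure disc_measure (A j))"
    if [measurable]: "\<And>j. A j \<in> sets borel" for A
  proof -
    have s: "{w :: complex ^ 'n. \<forall>j. w $ j \<in> A j} \<in> sets borel" by measurable
    have s': "{w :: complex ^ 'n. \<forall>j. w $ j \<in> (A(i := UNIV)) j} \<in> sets borel"
    proof -
      have [measurable]: "(A(i := UNIV)) j \<in> sets borel" for j by simp
      show ?thesis by measurable
    qed
    have pre: "(\<lambda>(w, y). upd_coord i w y) -` {w. \<forall>j. w $ j \<in> A j} \<inter> space (dv \<Otimes>\<^sub>M disc_measure)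
        = {w. \<forall>j. w $ j \<in> (A(i := UNIV)) j} \<times> A i"
    proof (intro set_eqI iffI)
      fix p assume p: "p \<in> (\<lambda>(w, y). upd_coord i w y) -` {w. \<forall>j. w $ j
          \<in> A j} \<inter> space (dv \<Otimes>\<^sub>M disc_measure)"
      then have "\<forall>j. upd_coord i (fst p) (snd p) $ j \<in> A j"
        by (simp add: case_prod_beta')
      then have q: "(if j = i then snd p else fst p $ j) \<in> A j" for j
        by (metis upd_coord_nth)
      have "fst p $ j \<in> (A(i := UNIV)) j" for j
        using q[of j] by (cases "j = i") auto
      then show "p \<in> {w. \<forall>j. w $ j \<in> (A(i := UNIV)) j} \<times> A i"
        using q[of i] by (simp add: mem_Times_iff)
    next
      fix p assume p: "p \<in> {w. \<forall>j. w $ j \<in> (A(i := UNIV)) j} \<times> A i"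
      then have q: "fst p $ j \<in> (A(i := UNIV)) j" and pi: "snd p \<in> A i" for j
        unfolding mem_Times_iff mem_Collect_eq by blast+
      have "upd_coord i (fst p) (snd p) $ j \<in> A j" for j
        using q[of j] pi by (cases "j = i") simp_all
      then show "p \<in> (\<lambda>(w, y). upd_coord i w y) -` {w. \<forall>j. w $ j
          \<in> A j} \<inter> space (dv \<Otimes>\<^sub>M disc_measure)"
        by (simp add: case_prod_beta' space_pair_measure)
    qed
    have "emeasure ?M {w. \<forall>j. w $ j \<in> A j}
        = emeasure (dv \<Otimes>\<^sub>M disc_measure) ({w. \<forall>j. w $ j \<in> (A(i := UNIV)) j} \<times> A i)"
      unfolding pre[symmetric] by (rule emeasure_distr[OF m s])
    also have "\<dots> = emeasure dv {w. \<forall>j. w $ j \<in> (A(i := UNIV)) j} * emeasure disc_measure (A i)"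
      by (rule D.emeasure_pair_measure_Times) (use s' in simp_all)
    also have "emeasure dv {w. \<forall>j. w $ j \<in> (A(i := UNIV)) j}
        = (\<Prod>j\<in>UNIV. emeasure disc_measure ((A(i := UNIV)) j))"
      by (rule emeasure_dv_rect) auto
    also have "\<dots> = (\<Prod>j\<in>UNIV-{i}. emeasure disc_measure (A j))"
      using D.emeasure_space_1 by (subst prod.remove[of _ i]) (auto intro: prod.cong)
    finally show ?thesis
      by (subst prod.remove[of _ i]) (auto simp: mult.commute)
  qed
  show "emeasure ?M X = emeasure dv X" if X_in: "X \<in> ?E" for X
  proof -
    obtain p where "X = (\<lambda>(a, b). box a b) p" using X_in by blast
    then obtain a b where X: "X = box a b" by (cases p) simp
    have "X = {w. \<forall>j. w $ j \<in> box (a $ j) (b $ j)}"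
      by (auto simp: X mem_box_vec)
    then show ?thesis
      using prect[of "\<lambda>j. box (a $ j) (b $ j)"] emeasure_dv_rect[of "\<lambda>j. box (a $ j) (b $ j)"]
        by simp
  qed
  show "emeasure ?M (?A n) \<noteq> \<infinity>" for n
  proof -
    interpret P: pair_prob_space "dv :: (complex ^ 'n) measure" disc_measure ..
    interpret M: prob_space ?M by (rule P.P.prob_space_distr[OF m])
    show ?thesis by simp
  qed
qed

lemma integral_upd_coord:
  fixes F :: "complex ^ 'n::finite \<Rightarrow> complex"
  assumes F: "integrable dv F"
  shows "AE w in dv. integrable disc_measure (\<lambda>y. F (upd_coord i w y))"
    and "integrable dv (\<lambda>w. LINT y|disc_measure. F (upd_coord i w y))"
    and "(LINT w|dv. LINT y|disc_measure. F (upd_coord i w y)) = (LINT w|dv. F w)"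
proof -
  interpret D: prob_space disc_measure by (rule prob_space_disc_measure)
  interpret dv: prob_space "dv :: (complex ^ 'n) measure" by (rule prob_space_dv)
  interpret P: pair_prob_space "dv :: (complex ^ 'n) measure" disc_measure ..
  have [measurable]: "F \<in> borel_measurable borel"
    using F by (auto dest: borel_measurable_integrable cong: measurable_cong_sets)
  have I: "integrable (dv \<Otimes>\<^sub>M disc_measure) (\<lambda>p. F ((\<lambda>(w, y). upd_coord i w y) p))"
    using F by (subst (asm) distr_upd_coord[of i, symmetric])
      (simp add: integrable_distr_eq[OF measurable_upd_coord])
  show "AE w in dv. integrable disc_measure (\<lambda>y. F (upd_coord i w y))"
    using P.AE_integrable_fst'[OF I] by simp
  show "integrable dv (\<lambda>w. LINT y|disc_measure. F (upd_coord i w y))"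
    using P.integrable_fst'[OF I] by simp
  have "(LINT w|dv. F w) = (LINT w|distr (dv \<Otimes>\<^sub>M disc_measure) borel (\<lambda>(w, y). upd_coord i w y). F
      w)"
    by (simp add: distr_upd_coord)
  also have "\<dots> = (LINT p|(dv \<Otimes>\<^sub>M disc_measure). F ((\<lambda>(w, y). upd_coord i w y) p))"
    by (rule integral_distr[OF measurable_upd_coord]) auto
  also have "\<dots> = (LINT w|dv. LINT y|disc_measure. F (upd_coord i w y))"
    using P.integral_fst'[OF I] by simp
  finally show "(LINT w|dv. LINT y|disc_measure. F (upd_coord i w y)) = (LINT w|dv. F w)" by simp
qed

text \<open>Chain rule: the derivative of \<sigma> is multiplication of a fixed vector by a scalar,
  and complex linearity of the derivative of \<open>h\<close> turns the composite into
  multiplication by a number. This is the bridge by which one-variable theorems are applied along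
  curves in the polydisk.\<close>

lemma holomorphic_on_compose_polydisk:
  fixes \<sigma> :: "complex \<Rightarrow> complex ^ 'n::finite"
  assumes h: "analytic_polydisk h" and S: "open S"
    and hol: "\<And>i. (\<lambda>s. \<sigma> s $ i) holomorphic_on S" and in_pd: "\<And>s. s \<in> S \<Longrightarrow> \<sigma> s \<in> polydisk"
  shows "(\<lambda>s. h (\<sigma> s)) holomorphic_on S"
proof (rule holomorphic_onI)
  fix s assume s: "s \<in> S"
  obtain h' where h': "(h has_derivative h') (at (\<sigma> s))" and lin: "\<And>c x. h' (c *s x) = c * h' x"
    using h in_pd[OF s] unfolding analytic_polydisk_def by blast
  define d where "d = (\<chi> i. deriv (\<lambda>s. \<sigma> s $ i) s)"
  have "((\<lambda>s. \<sigma> s $ i) has_field_derivative d $ i) (at s)" for i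
    using holomorphic_derivI[OF hol S s] by (simp add: d_def)
  then have di: "((\<lambda>s. \<sigma> s $ i) has_derivative (\<lambda>x. d $ i * x)) (at s)" for i
    by (simp add: has_field_derivative_def)
  have "(\<sigma> has_derivative (\<lambda>x. x *s d)) (at s)"
  proof (subst has_derivative_componentwise_within, rule ballI)
    fix b :: "complex ^ 'n" assume "b \<in> Basis"
    then obtain i u where b: "b = axis i u" "u \<in> Basis" by (auto simp: Basis_vec_def)
    have "((\<lambda>s. \<sigma> s $ i \<bullet> u) has_derivative (\<lambda>x. (d $ i * x) \<bullet> u)) (at s)"
      by (rule has_derivative_inner_left[OF di])
    then show "((\<lambda>x. \<sigma> x \<bullet> b) has_derivative (\<lambda>x. (x *s d) \<bullet> b)) (at s)"
      by (simp add: b inner_axis mult.commute)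
  qed
  from has_derivative_compose[OF this h'] have
    "((\<lambda>s. h (\<sigma> s)) has_derivative (\<lambda>x. h' d * x)) (at s)"
    by (simp add: lin mult.commute)
  then show "(\<lambda>s. h (\<sigma> s)) field_differentiable at s within S"
    by (auto simp: field_differentiable_def has_field_derivative_def intro:
      has_derivative_at_withinI)
qed

lemma bergman_integrable:
  assumes "h \<in> bergman_set"
  shows "integrable dv h"
proof (rule Bochner_Integration.integrable_bound)
  interpret dv: prob_space "dv :: (complex ^ 'n) measure" by (rule prob_space_dv)
  show "integrable dv (\<lambda>z. 1 + (cmod (h z))\<^sup>2)"
    using assms by (auto simp: bergman_set_def)
  show "h \<in> borel_measurable dv" using assms by (rule bergman_measurable_dv)
  have "x \<le> 1 + x\<^sup>2" for x :: real
    using zero_le_power2[of "x - 1"] sum_squares_bound[of x 1]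
      by (simp add: power2_diff) (smt (verit) zero_le_power2)
  then show "AE z in dv. norm (h z) \<le> norm (1 + (cmod (h z))\<^sup>2)"
    by (auto simp: abs_of_nonneg)
qed

text \<open>The disc formula is applied to one coordinate after the other. The integral of
  \<open>F S\<close> does not depend on the set \<open>S\<close> of coordinates already treated; for
  the empty set it is the integral in question and for \<open>UNIV\<close> it is that of a
  constant.\<close>

lemma reproducing:
  fixes z :: "complex ^ 'n::finite"
  assumes h: "h \<in> bergman_set" and z: "z \<in> polydisk"
  shows "(LINT w|dv. h w * (\<Prod>j\<in>UNIV. 1 / (1 - cnj (w $ j) * z $ j)\<^sup>2)) = h z"
proof -
  interpret dv: prob_space "dv :: (complex ^ 'n) measure" by (rule prob_space_dv)
  define \<kappa> where "\<kappa> j w = 1 / (1 - cnj w * z $ j)\<^sup>2" for j w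
  \<comment> \<open>Coordinates in \<open>S\<close> are frozen at \<open>z\<close>, and the kernel
    factors of the others are still present in \<open>F S\<close>.\<close>
  define mix where "mix S w = (\<chi> j. if j \<in> S then z $ j else w $ j)" for S :: "'n set"
    and w :: "complex ^ 'n"
  define F where "F S w = h (mix S w) * (\<Prod>j\<in>-S. \<kappa> j (w $ j))" for S w
  have an: "analytic_polydisk h" using h by (simp add: bergman_set_def)
  have [measurable]: "h \<in> borel_measurable borel" using h by (rule bergman_measurable)
  have zj: "cmod (z $ j) < 1" for j using z by (simp add: polydisk_def)
  have [measurable]: "mix S \<in> borel_measurable borel" for S
  proof (rule borel_measurable_continuous_onI)
    show "continuous_on UNIV (mix S)"
      unfolding mix_def
    proof (rule continuous_on_vec_lambda)
      show "continuous_on UNIV (\<lambda>w. if j \<in> S then z $ j else w $ j)" for j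
        by (cases "j \<in> S") (auto intro!: continuous_intros)
    qed
  qed
  have \<kappa>m[measurable]: "(\<lambda>w. \<kappa> j w) \<in> borel_measurable borel" for j
  proof -
    have [measurable]: "(\<lambda>y. (1 - cnj y * z $ j)\<^sup>2) \<in> borel_measurable borel"
      by (intro borel_measurable_continuous_onI continuous_intros)
    show ?thesis unfolding \<kappa>_def by measurable
  qed
  have Fm[measurable]: "F S \<in> borel_measurable borel" for S
    unfolding F_def by measurable
  have main: "integrable dv (F S) \<and> (LINT w|dv. F S w) = (LINT w|dv. F {} w)" for S
    using finite[of S]
  proof (induction S rule: finite_induct)
    case empty
    have bd: "cmod (F {} w) \<le> cmod (h w * of_real (\<Prod>j\<in>UNIV. 1 / (1 - cmod (z $ j))\<^sup>2))"
      if "w \<in> polydisk" for w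
    proof -
      have "cmod (\<kappa> j (w $ j)) \<le> 1 / (1 - cmod (z $ j))\<^sup>2" for j
        unfolding \<kappa>_def norm_divide norm_power
        using disc_kernel_denom_ge[of "w $ j" "z $ j"] that zj[of j]
        by (intro frac_le power_mono zero_less_power) (auto simp: polydisk_def)
      then have "cmod (\<Prod>j\<in>UNIV. \<kappa> j (w $ j)) \<le> (\<Prod>j\<in>UNIV. 1 / (1 - cmod (z $ j))\<^sup>2)"
        unfolding prod_norm[symmetric] by (intro prod_mono) auto
      then have "cmod (F {} w) \<le> cmod (h w) * (\<Prod>j\<in>UNIV. 1 / (1 - cmod (z $ j))\<^sup>2)"
        by (simp add: F_def mix_def norm_mult mult_left_mono)
      also have "\<dots> = cmod (h w * of_real (\<Prod>j\<in>UNIV. 1 / (1 - cmod (z $ j))\<^sup>2))"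
        unfolding norm_mult norm_of_real by (subst abs_of_nonneg) (auto intro!: prod_nonneg)
      finally show ?thesis .
    qed
    have "integrable dv (F {})"
    proof (rule Bochner_Integration.integrable_bound)
      show "integrable dv (\<lambda>w. h w * of_real (\<Prod>j\<in>UNIV. 1 / (1 - cmod (z $ j))\<^sup>2))"
        by (intro integrable_mult_left bergman_integrable h)
      show "AE w in dv. cmod (F {} w) \<le> cmod (h w * of_real (\<Prod>j\<in>UNIV. 1 / (1 - cmod (z $ j))\<^sup>2))"
        using AE_dv_polydisk by (rule eventually_mono) (rule bd)
    qed simp
    then show ?case by simp
  next
    case (insert i S)
    note U = integral_upd_coord[OF conjunct1[OF insert.IH], of i]
    have "AE w in dv. (LINT y|disc_measure. F S (upd_coord i w y)) = F (insert i S) w"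
      using AE_dv_polydisk U(1)
    proof eventually_elim
      case (elim w)
      define C where "C = (\<Prod>j\<in>-insert i S. \<kappa> j (w $ j))"
      define f where "f y = h (mix S (upd_coord i w y)) * C" for y
      have FS: "F S (upd_coord i w y) = f y / (1 - cnj y * z $ i)\<^sup>2" for y
      proof -
        have "(\<Prod>j\<in>-S. \<kappa> j (upd_coord i w y $ j)) = \<kappa> i y * (\<Prod>j\<in>-S-{i}. \<kappa> j (upd_coord i w y $ j))"
          using insert.hyps by (subst prod.remove[of _ i]) auto
        also have "(\<Prod>j\<in>-S-{i}. \<kappa> j (upd_coord i w y $ j)) = C"
          unfolding C_def by (rule prod.cong) auto
        finally show ?thesis by (simp add: F_def f_def \<kappa>_def)
      qed
      have pd: "mix S (upd_coord i w y) \<in> polydisk" if "y \<in> ball 0 1" for y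
        using elim(1) that zj by (auto simp: polydisk_def mix_def)
      have hol: "f holomorphic_on ball 0 1"
        unfolding f_def
      proof (intro holomorphic_on_mult holomorphic_on_const holomorphic_on_compose_polydisk[OF an]
        pd)
        show "(\<lambda>s. mix S (upd_coord i w s) $ j) holomorphic_on ball 0 1" for j
          by (cases "j \<in> S"; cases "j = i") (auto simp: mix_def)
      qed auto
      \<comment> \<open>The disc formula asks for integrability of the slice itself, whereas almost
        every slice is known to be integrable after multiplication by the kernel. The kernel factor
        has modulus at least 1/4, hence the constant 4.\<close>
      have fint: "integrable disc_measure f"
      proof (rule Bochner_Integration.integrable_bound)
        show "integrable disc_measure (\<lambda>y. 4 * F S (upd_coord i w y))"
          using elim(2) by simp
        have "(\<lambda>y. upd_coord i w y) \<in> borel_measurable borel"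
          using continuous_on_compose2[OF continuous_on_upd_coord[of i], of UNIV "\<lambda>y. (w, y)"]
            continuous_on_Pair[OF continuous_on_const continuous_on_id, of UNIV w]
          by (intro borel_measurable_continuous_onI) simp
        then show "f \<in> borel_measurable disc_measure"
          unfolding f_def by measurable
        have "cmod (f y) \<le> cmod (4 * F S (upd_coord i w y))" if y: "y \<in> ball 0 1" for y
        proof -
          have c0: "1 - cnj y * z $ i \<noteq> 0"
            using disc_kernel_denom_ge[of y "z $ i"] y zj[of i] by auto
          have "cmod (1 - cnj y * z $ i) \<le> 1 + cmod y * cmod (z $ i)"
            using norm_triangle_ineq4[of 1 "cnj y * z $ i"] by (simp add: norm_mult)
          also have "\<dots> \<le> 1 + 1 * 1"
            using y zj[of i] by (intro add_left_mono mult_mono) auto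
          finally have "(cmod (1 - cnj y * z $ i))\<^sup>2 \<le> 2\<^sup>2" by (intro power_mono) auto
          then have "cmod (f y) * (cmod (1 - cnj y * z $ i))\<^sup>2 \<le> cmod (f y) * 4"
            by (intro mult_left_mono) auto
          then show ?thesis
            using c0 by (simp add: FS norm_mult norm_divide norm_power field_simps)
        qed
        then show "AE y in disc_measure. cmod (f y) \<le> cmod (4 * F S (upd_coord i w y))"
          using AE_disc_measure by (auto elim: eventually_mono)
      qed
      have "(LINT y|disc_measure. F S (upd_coord i w y)) = f (z $ i)"
        unfolding FS by (rule disc_reproducing(2)[OF hol fint zj])
      also have "f (z $ i) = F (insert i S) w"
      proof -
        have "mix S (upd_coord i w (z $ i)) = mix (insert i S) w"
          by (simp add: mix_def vec_eq_iff)
        then show ?thesis by (simp add: f_def F_def C_def)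
      qed
      finally show ?case .
    qed
    note AE = this
    have m: "(\<lambda>w. LINT y|disc_measure. F S (upd_coord i w y)) \<in> borel_measurable dv"
      using U(2) by (rule borel_measurable_integrable)
    have m': "F (insert i S) \<in> borel_measurable dv" by simp
    have "integrable dv (F (insert i S))"
      using U(2) integrable_cong_AE[OF m m' AE] by simp
    moreover have "(LINT w|dv. F (insert i S) w)
        = (LINT w|dv. LINT y|disc_measure. F S (upd_coord i w y))"
      using integral_cong_AE[OF m m' AE] by simp
    ultimately show ?case using U(3) insert.IH by simp
  qed
  have "F UNIV = (\<lambda>w. h z)" by (simp add: F_def mix_def fun_eq_iff)
  then have "h z = (LINT w|dv. F {} w)"
    using main[of UNIV] dv.prob_space by simp
  also have "F {} = (\<lambda>w. h w * (\<Prod>j\<in>UNIV. 1 / (1 - cnj (w $ j) * z $ j)\<^sup>2))"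
    by (simp add: F_def mix_def \<kappa>_def fun_eq_iff)
  finally show ?thesis by simp
qed

text \<open>The reproducing kernel at \<open>z\<close> is the product of the functions 1 / (1 - w
  cnj z)^2, and \<open>kernel z\<close> is its normalization, which accounts for the factor.
  Pairings with kernels thereby become point evaluations.\<close>

lemma cinner_kernel:
  assumes z: "z \<in> polydisk"
  shows "cinner h (kernel z) = of_real (\<Prod>i\<in>UNIV. 1 - (cmod (z $ i))\<^sup>2) * bergman_fun h z"
proof -
  let ?c = "of_real (\<Prod>i\<in>UNIV. 1 - (cmod (z $ i))\<^sup>2) :: complex"
  have "bergman_fun h w * cnj (bergman_fun (kernel z) w)
      = ?c * (bergman_fun h w * (\<Prod>j\<in>UNIV. 1 / (1 - cnj (w $ j) * z $ j)\<^sup>2))" for w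
  proof (cases "w \<in> polydisk")
    case True
    then show ?thesis using z
      by (simp add: kernel.rep_eq kernel_fun_def prod_dividef)
  next
    case False
    then show ?thesis using bergman_fun[of h] by (simp add: bergman_set_def)
  qed
  then have "cinner h (kernel z) = (LINT w|dv. ?c
      * (bergman_fun h w * (\<Prod>j\<in>UNIV. 1 / (1 - cnj (w $ j) * z $ j)\<^sup>2)))"
    unfolding cinner_def by presburger
  also have "\<dots> = ?c * (LINT w|dv. (bergman_fun h w * (\<Prod>j\<in>UNIV. 1 / (1 - cnj (w $ j) * z $ j)\<^sup>2)))"
    by simp
  finally show ?thesis by (simp only: reproducing[OF bergman_fun z])
qed

subsection \<open>Local estimates on cells\<close>

text \<open>Schwarz's lemma for (g(\<rho> \<xi>) - g(0)) / (2 C) on the unit disc. It needs modulus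
  strictly below 1, so C exceeds B and is then decreased to B.\<close>

lemma holomorphic_bounded_diff_le:
  assumes g: "g holomorphic_on ball 0 \<rho>" and bd: "\<And>x. x \<in> ball 0 \<rho> \<Longrightarrow> cmod (g x) \<le> B"
    and x: "cmod x < \<rho>"
  shows "cmod (g x - g 0) \<le> 2 * B * cmod x / \<rho>"
proof -
  have \<rho>: "\<rho> > 0" using x norm_ge_zero[of x] by linarith
  have B0: "B \<ge> 0" using bd[of 0] \<rho> order_trans[OF norm_ge_zero] by simp
  have main: "cmod (g x - g 0) \<le> 2 * C * cmod x / \<rho>" if C: "C > B" for C
  proof -
    define G where "G \<xi> = (g (of_real \<rho> * \<xi>) - g 0) / of_real (2 * C)" for \<xi>
    have C0: "C > 0" using C B0 by simp
    have inb: "of_real \<rho> * \<xi> \<in> ball 0 \<rho>" if "cmod \<xi> < 1" for \<xi>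
      using that \<rho> by (simp add: norm_mult)
    have "(\<lambda>\<xi>::complex. of_real \<rho> * \<xi>) ` ball 0 1 \<subseteq> ball 0 \<rho>"
      using inb by (simp add: image_subset_iff)
    moreover have "(\<lambda>\<xi>::complex. of_real \<rho> * \<xi>) holomorphic_on ball 0 1"
      by (intro holomorphic_intros)
    ultimately have "(\<lambda>\<xi>. g (of_real \<rho> * \<xi>)) holomorphic_on ball 0 1"
      using holomorphic_on_compose_gen[OF _ g, of "\<lambda>\<xi>. of_real \<rho> * \<xi>" "ball 0 1"]
      by (simp add: o_def)
    then have hol: "G holomorphic_on ball 0 1"
      unfolding G_def using C0 by (intro holomorphic_intros) auto
    have lt: "cmod (G \<xi>) < 1" if "cmod \<xi> < 1" for \<xi>
    proof -
      have "cmod (g (of_real \<rho> * \<xi>) - g 0) \<le> B + B"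
        using norm_triangle_ineq4[of "g (of_real \<rho> * \<xi>)" "g 0"] bd[OF inb[OF that]] bd[of 0] \<rho>
          by simp
      also have "\<dots> < 2 * C" using C by simp
      finally show ?thesis using C0 by (simp add: G_def norm_divide)
    qed
    have "cmod (G (x / of_real \<rho>)) \<le> cmod (x / of_real \<rho>)"
      by (rule Schwarz_Lemma(1)[OF hol _ lt]) (use x \<rho> in \<open>auto simp: G_def norm_divide\<close>)
    then show ?thesis
      using \<rho> C0 by (simp add: G_def norm_divide field_simps)
  qed
  show ?thesis
  proof (rule field_le_epsilon)
    fix e :: real assume e: "e > 0"
    \<comment> \<open>A positive majorant of |x|, so that x = 0 needs no separate treatment.\<close>
    define X where "X = cmod x + 1"
    have X: "X > 0" "cmod x \<le> X" by (auto simp: X_def add_nonneg_pos)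
    have "B + e * \<rho> / (2 * X) > B" using e \<rho> X by simp
    from main[OF this] have "cmod (g x - g 0) \<le> 2 * (B + e * \<rho> / (2 * X)) * cmod x / \<rho>" .
    also have "\<dots> = 2 * B * cmod x / \<rho> + 2 * (e * \<rho> / (2 * X)) * cmod x / \<rho>"
      by (simp only: distrib_left distrib_right add_divide_distrib)
    also have "2 * (e * \<rho> / (2 * X)) * cmod x / \<rho> = e * (cmod x / X)"
      using \<rho> X by (simp add: field_simps)
    also have "2 * B * cmod x / \<rho> + e * (cmod x / X) \<le> 2 * B * cmod x / \<rho> + e * 1"
      using e X by (intro add_left_mono mult_left_mono) (auto simp: divide_le_eq_1)
    also have "e * 1 = e" by simp
    finally show "cmod (g x - g 0) \<le> 2 * B * cmod x / \<rho> + e" .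
  qed
qed

text \<open>Euclidean polydiscs with radii proportional to the distances to the boundary replace hyperbolic
  balls, so that the triangle inequality of the hyperbolic metric is never needed.\<close>

definition cell :: "complex ^ 'n \<Rightarrow> real \<Rightarrow> (complex ^ 'n) set" where
  "cell w r = {u. \<forall>i. cmod (u $ i - w $ i) < r * (1 - cmod (w $ i))}"

text \<open>The \<open>dv\<close>-measure of \<open>cell w 1\<close>; for 0 < r \<le> 1 that of
  \<open>cell w r\<close> has the additional factor r^(2n). It is comparable with the square of the
  normalizing factor of \<open>kernel w\<close>, hence the natural weight of |h(w)|^2.\<close>

definition cell_vol :: "complex ^ 'n::finite \<Rightarrow> real" where
  "cell_vol w = (\<Prod>i\<in>UNIV. (1 - cmod (w $ i))\<^sup>2)"

lemma cell_vol_pos: "w \<in> polydisk \<Longrightarrow> 0 < cell_vol w"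
  by (auto simp: cell_vol_def polydisk_def intro!: prod_pos zero_less_power)

lemma open_cell [simp]: "open (cell w r)"
proof -
  have "cell w r = (\<Inter>i\<in>UNIV. {u. cmod (u $ i - w $ i) < r * (1 - cmod (w $ i))})"
    by (auto simp: cell_def)
  also have "open \<dots>"
    by (intro open_INT ballI open_Collect_less continuous_intros) simp
  finally show ?thesis .
qed

lemma cell_borel [measurable]: "cell w r \<in> sets borel"
  by simp

lemma cell_gap_le:
  assumes "u \<in> cell w r"
  shows "1 - cmod (u $ i) \<le> (1 + r) * (1 - cmod (w $ i))"
    and "(1 - r) * (1 - cmod (w $ i)) \<le> 1 - cmod (u $ i)"
proof -
  have c: "cmod (u $ i - w $ i) < r * (1 - cmod (w $ i))" using assms by (simp add: cell_def)
  show "1 - cmod (u $ i) \<le> (1 + r) * (1 - cmod (w $ i))"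
    using c norm_triangle_ineq3[of "u $ i" "w $ i"] by (simp add: algebra_simps)
  show "(1 - r) * (1 - cmod (w $ i)) \<le> 1 - cmod (u $ i)"
    using c norm_triangle_ineq3[of "u $ i" "w $ i"] by (simp add: algebra_simps)
qed

lemma polydisk_gap_pos: "w \<in> polydisk \<Longrightarrow> 0 < 1 - cmod (w $ i)"
  by (simp add: polydisk_def)

lemma cell_subset_polydisk:
  assumes w: "w \<in> polydisk" and r: "r \<le> 1"
  shows "cell w r \<subseteq> polydisk"
proof
  fix u assume u: "u \<in> cell w r"
  have "cmod (u $ i) < 1" for i
  proof -
    have "cmod (u $ i) \<le> cmod (w $ i) + cmod (u $ i - w $ i)"
      using norm_triangle_ineq[of "w $ i" "u $ i - w $ i"] by simp
    also have "\<dots> < cmod (w $ i) + r * (1 - cmod (w $ i))"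
      using u by (simp add: cell_def)
    also have "\<dots> \<le> cmod (w $ i) + 1 * (1 - cmod (w $ i))"
      using r polydisk_gap_pos[OF w, of i] by (intro add_left_mono mult_right_mono) auto
    finally show ?thesis by simp
  qed
  then show "u \<in> polydisk" by (simp add: polydisk_def)
qed

lemma centre_in_cell: "w \<in> polydisk \<Longrightarrow> 0 < r \<Longrightarrow> w \<in> cell w r"
  by (auto simp: cell_def polydisk_def)

lemma cell_mono: "w \<in> polydisk \<Longrightarrow> r \<le> s \<Longrightarrow> cell w r \<subseteq> cell w s"
  by (auto simp: cell_def polydisk_def intro: less_le_trans mult_right_mono)

definition cell_map :: "complex ^ 'n \<Rightarrow> real \<Rightarrow> complex ^ 'n \<Rightarrow> complex ^ 'n" where
  "cell_map w r \<zeta> = (\<chi> i. w $ i + of_real (r * (1 - cmod (w $ i))) * \<zeta> $ i)"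

lemma cell_map_nth [simp]: "cell_map w r \<zeta> $ i = w $ i + of_real (r * (1 - cmod (w $ i))) * \<zeta> $ i"
  by (simp add: cell_map_def)

lemma cell_map_in_cell_iff:
  assumes w: "w \<in> polydisk" and r: "0 < r"
  shows "cell_map w r \<zeta> \<in> cell w r \<longleftrightarrow> \<zeta> \<in> polydisk"
proof -
  have "cmod (of_real (r * (1 - cmod (w $ i))) * \<zeta> $ i) < r * (1 - cmod (w $ i))
      \<longleftrightarrow> cmod (\<zeta> $ i) < 1" for i
  proof -
    have p: "0 < r * (1 - cmod (w $ i))" using r polydisk_gap_pos[OF w, of i] by simp
    then have "cmod (of_real (r * (1 - cmod (w $ i))) * \<zeta> $ i)
        = r * (1 - cmod (w $ i)) * cmod (\<zeta> $ i)"
      by (simp only: norm_mult norm_of_real abs_of_pos)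
    then show ?thesis
      using mult_less_cancel_left_pos[OF p, of "cmod (\<zeta> $ i)" 1] by simp
  qed
  then show ?thesis by (simp add: cell_def polydisk_def)
qed

lemma continuous_on_cell_map: "continuous_on A (cell_map w r)"
  unfolding cell_map_def by (intro continuous_on_vec_lambda continuous_intros)

lemma nn_integral_cell_map:
  fixes w :: "complex ^ 'n::finite"
  assumes f[measurable]: "f \<in> borel_measurable borel" and w: "w \<in> polydisk" and r: "0 < r" "r \<le> 1"
  shows "(\<integral>\<^sup>+\<zeta>. f (cell_map w r \<zeta>) \<partial>dv) * ennreal (r ^ (2 * CARD('n)) * cell_vol w)
    = (\<integral>\<^sup>+u. f u * indicator (cell w r) u \<partial>dv)"
proof -
  \<comment> \<open>The affine change of variables takes one scale factor per basis vector. On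
    \<open>axis i b\<close> exactly one coordinate is nonzero, so the sum selects the factor of
    coordinate \<open>i\<close>.\<close>
  define c where "c j = (\<Sum>i\<in>UNIV. if j $ i \<noteq> 0 then r * (1 - cmod (w $ i)) else 0)"
    for j :: "complex ^ 'n"
  have c_axis: "c (axis i b) = r * (1 - cmod (w $ i))" if "b \<noteq> 0" for i b
  proof -
    have "c (axis i b) = (\<Sum>k\<in>UNIV. if k = i then r * (1 - cmod (w $ k)) else 0)"
      unfolding c_def using that by (intro sum.cong) (auto simp: axis_def)
    then show ?thesis by simp
  qed
  have gp: "0 < r * (1 - cmod (w $ i))" for i using r polydisk_gap_pos[OF w, of i] by simp
  have [measurable]: "cell_map w r \<in> borel_measurable borel"
    by (rule borel_measurable_continuous_onI[OF continuous_on_cell_map])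
  have T: "w + (\<Sum>j\<in>Basis. (c j * (\<zeta> \<bullet> j)) *\<^sub>R j) = cell_map w r \<zeta>" for \<zeta>
  proof (rule euclidean_eqI)
    fix b :: "complex ^ 'n" assume b: "b \<in> Basis"
    then obtain i e where ie: "b = axis i e" "e \<in> Basis" by (auto simp: Basis_vec_def)
    have "(w + (\<Sum>j\<in>Basis. (c j * (\<zeta> \<bullet> j)) *\<^sub>R j)) \<bullet> b = w \<bullet> b + c b * (\<zeta> \<bullet> b)"
      using b by (simp add: inner_add_left)
    also have "\<dots> = cell_map w r \<zeta> \<bullet> b"
    proof -
      have "(of_real s * x) \<bullet> e = s * (x \<bullet> e)" for s and x :: complex
        by (simp flip: scaleR_conv_of_real)
      then show ?thesis
        using ie c_axis[OF nonzero_Basis[OF ie(2)], of i]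
          by (auto simp: inner_axis inner_add_left simp del: of_real_mult)
    qed
    finally show "(w + (\<Sum>j\<in>Basis. (c j * (\<zeta> \<bullet> j)) *\<^sub>R j)) \<bullet> b = cell_map w r \<zeta> \<bullet> b" .
  qed
  have cB: "(\<Prod>j\<in>Basis. \<bar>c j\<bar>) = r ^ (2 * CARD('n)) * cell_vol w"
  proof -
    have "(\<Prod>j\<in>Basis. \<bar>c j\<bar>) = (\<Prod>i\<in>UNIV. \<Prod>b\<in>(Basis :: complex set). \<bar>c (axis i b)\<bar>)"
      by (rule prod_Basis_vec)
    also have "\<dots> = (\<Prod>i\<in>UNIV. \<Prod>b\<in>(Basis :: complex set). r * (1 - cmod (w $ i)))"
      using gp by (intro prod.cong refl) (auto simp: c_axis abs_of_pos nonzero_Basis)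
    also have "\<dots> = (\<Prod>i\<in>UNIV. r\<^sup>2 * (1 - cmod (w $ i))\<^sup>2)"
      by (simp add: power_mult_distrib)
    also have "\<dots> = r ^ (2 * CARD('n)) * cell_vol w"
      by (simp add: prod.distrib cell_vol_def power_mult)
    finally show ?thesis .
  qed
  have "lborel = density (distr lborel borel (\<lambda>\<zeta>. w
      + (\<Sum>j\<in>Basis. (c j * (\<zeta> \<bullet> j)) *\<^sub>R j))) (\<lambda>_. (\<Prod>j\<in>Basis. \<bar>c j\<bar>))"
  proof (rule lborel_affine_euclidean)
    fix j :: "complex ^ 'n" assume "j \<in> Basis"
    then obtain i e where ie: "j = axis i e" "e \<in> Basis" by (auto simp: Basis_vec_def)
    have "c j = r * (1 - cmod (w $ i))"
      unfolding ie(1) by (rule c_axis[OF nonzero_Basis[OF ie(2)]])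
    then show "c j \<noteq> 0" using gp[of i] by (metis less_irrefl)
  qed
  then have lb: "lborel = density (distr lborel borel (cell_map w r))
      (\<lambda>_. ennreal (r ^ (2 * CARD('n)) * cell_vol w))"
    by (simp add: T cB)
  have ind: "indicator polydisk u * indicator (cell w r) u = (indicator (cell w r) u :: ennreal)"
    for u
    using cell_subset_polydisk[OF w r(2)] by (auto simp: indicator_def)
  have "(\<integral>\<^sup>+u. f u * indicator (cell w r) u \<partial>dv)
      = (\<integral>\<^sup>+u. f u * indicator (cell w r) u * indicator polydisk u \<partial>lborel) / emeasure lborel
        (polydisk :: (complex ^ 'n) set)"
    unfolding dv_def by (rule nn_integral_uniform_measure) auto
  also have "(\<integral>\<^sup>+u. f u * indicator (cell w r) u * indicator polydisk u \<partial>lborel)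
      = (\<integral>\<^sup>+u. f u * indicator (cell w r) u \<partial>lborel)"
    using ind by (simp add: mult_ac)
  also have "\<dots> = ennreal (r ^ (2 * CARD('n)) * cell_vol w)
      * (\<integral>\<^sup>+\<zeta>. f (cell_map w r \<zeta>) * indicator (cell w r) (cell_map w r \<zeta>) \<partial>lborel)"
    by (subst lb) (simp add: nn_integral_density nn_integral_distr nn_integral_cmult)
  also have "(\<integral>\<^sup>+\<zeta>. f (cell_map w r \<zeta>) * indicator (cell w r) (cell_map w r \<zeta>) \<partial>lborel)
      = (\<integral>\<^sup>+\<zeta>. f (cell_map w r \<zeta>) * indicator polydisk \<zeta> \<partial>lborel)"
    using cell_map_in_cell_iff[OF w r(1)] by (simp add: indicator_def)
  finally have "(\<integral>\<^sup>+u. f u * indicator (cell w r) u \<partial>dv)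
     = ennreal (r ^ (2 * CARD('n)) * cell_vol w) *
       ((\<integral>\<^sup>+\<zeta>. f (cell_map w r \<zeta>) * indicator polydisk \<zeta> \<partial>lborel) / emeasure lborel (polydisk ::
       (complex ^ 'n) set))"
    by (simp add: ennreal_times_divide)
  also have "(\<integral>\<^sup>+\<zeta>. f (cell_map w r \<zeta>) * indicator polydisk \<zeta> \<partial>lborel)
      / emeasure lborel (polydisk :: (complex ^ 'n) set)
     = (\<integral>\<^sup>+\<zeta>. f (cell_map w r \<zeta>) \<partial>dv)"
    unfolding dv_def by (rule nn_integral_uniform_measure[symmetric]) auto
  finally show ?thesis by (simp add: mult.commute)
qed

lemma emeasure_dv_cell:
  fixes w :: "complex ^ 'n::finite"
  assumes w: "w \<in> polydisk" and r: "0 < r" "r \<le> 1"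
  shows "emeasure dv (cell w r) = ennreal (r ^ (2 * CARD('n)) * cell_vol w)"
proof -
  interpret dv: prob_space "dv :: (complex ^ 'n) measure" by (rule prob_space_dv)
  have "emeasure dv (UNIV :: (complex ^ 'n) set) = 1" using dv.emeasure_space_1 by simp
  then show ?thesis
    using nn_integral_cell_map[OF _ w r, of "\<lambda>_. 1"] by simp
qed

lemma measure_dv_cell:
  fixes w :: "complex ^ 'n::finite"
  assumes w: "w \<in> polydisk" and r: "0 < r" "r \<le> 1"
  shows "measure dv (cell w r) = r ^ (2 * CARD('n)) * cell_vol w"
  using emeasure_dv_cell[OF assms] cell_vol_pos[OF w] r
  by (simp add: measure_def)

section \<open>Mean value estimates on cells\<close>

definition local_mass :: "'n::finite bergman \<Rightarrow> (complex ^ 'n) set \<Rightarrow> real" where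
  "local_mass h A = (LINT u|dv. indicator A u * (cmod (bergman_fun h u))\<^sup>2)"

lemma integrable_bergman_square: "integrable dv (\<lambda>u. (cmod (bergman_fun h u))\<^sup>2)"
  using bergman_fun[of h] by (simp add: bergman_set_def)

lemma bergman_fun_measurable [measurable]: "bergman_fun h \<in> borel_measurable borel"
  by (rule bergman_measurable[OF bergman_fun])

lemma integrable_local_mass:
  assumes [measurable]: "A \<in> sets borel"
  shows "integrable dv (\<lambda>u. indicator A u * (cmod (bergman_fun h u))\<^sup>2)"
  by (rule Bochner_Integration.integrable_bound[OF integrable_bergman_square[of h]])
    (auto simp: indicator_def)

lemma local_mass_nonneg: "0 \<le> local_mass h A"
  unfolding local_mass_def by (rule Bochner_Integration.integral_nonneg) simp

lemma norm_square_bergman: "(norm h)\<^sup>2 = (LINT u|dv. (cmod (bergman_fun h u))\<^sup>2)"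
  unfolding norm_bergman_def by (rule real_sqrt_pow2)
    (rule Bochner_Integration.integral_nonneg, simp)

lemma local_mass_mono:
  assumes "A \<subseteq> B" "A \<in> sets borel" "B \<in> sets borel"
  shows "local_mass h A \<le> local_mass h B"
  unfolding local_mass_def
  by (intro integral_mono integrable_local_mass assms) (use assms(1) in \<open>auto simp: indicator_def\<close>)

text \<open>The pointwise overlap bound is integrated against |h|^2. The weights \<open>a\<close>
  are 1 for Carleson type bounds; in the quadrature estimate they are the relative sample
  masses.\<close>

lemma sum_local_mass_le:
  assumes A: "\<And>j. j \<in> F \<Longrightarrow> A j \<in> sets borel"
    and ov: "\<And>x. (\<Sum>j\<in>F. a j * indicator (A j) x) \<le> N"
  shows "(\<Sum>j\<in>F. a j * local_mass h (A j)) \<le> N * (norm h)\<^sup>2"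
proof -
  have "(\<Sum>j\<in>F. a j * local_mass h (A j)) = (LINT u|dv. (\<Sum>j\<in>F. a j
      * (indicator (A j) u * (cmod (bergman_fun h u))\<^sup>2)))"
    unfolding local_mass_def
    by (subst Bochner_Integration.integral_sum) (use A in \<open>simp_all add: integrable_local_mass\<close>)
  also have "\<dots> \<le> (LINT u|dv. N * (cmod (bergman_fun h u))\<^sup>2)"
  proof (rule integral_mono)
    show "integrable dv (\<lambda>u. \<Sum>j\<in>F. a j * (indicator (A j) u * (cmod (bergman_fun h u))\<^sup>2))"
      by (intro Bochner_Integration.integrable_sum integrable_mult_right integrable_local_mass A)
    show "integrable dv (\<lambda>u. N * (cmod (bergman_fun h u))\<^sup>2)"
      by (intro integrable_mult_right integrable_bergman_square)
    fix u
    have "(\<Sum>j\<in>F. a j * (indicator (A j) u * (cmod (bergman_fun h u))\<^sup>2))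
        = (\<Sum>j\<in>F. a j * indicator (A j) u) * (cmod (bergman_fun h u))\<^sup>2"
      by (simp add: sum_distrib_right mult.assoc)
    also have "\<dots> \<le> N * (cmod (bergman_fun h u))\<^sup>2"
      by (intro mult_right_mono ov) simp
    finally show "(\<Sum>j\<in>F. a j * (indicator (A j) u * (cmod (bergman_fun h u))\<^sup>2))
        \<le> N * (cmod (bergman_fun h u))\<^sup>2" .
  qed
  also have "\<dots> = N * (norm h)\<^sup>2" by (simp add: norm_square_bergman)
  finally show ?thesis .
qed

lemma local_mass_le_norm: "A \<in> sets borel \<Longrightarrow> local_mass h A \<le> (norm h)\<^sup>2"
  using sum_local_mass_le[of "{()}" "\<lambda>_. A" "\<lambda>_. 1" 1 h] by (simp add: indicator_def)

lemma norm_kernel_zero_le: "norm (kernel 0 :: 'n::finite bergman) \<le> 1"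
proof -
  have "cinner (kernel 0 :: 'n bergman) (kernel 0) = 1"
    by (subst cinner_kernel) (auto simp: kernel.rep_eq kernel_fun_def)
  moreover have "inner (kernel 0 :: 'n bergman) (kernel 0)
      = Re (cinner (kernel 0 :: 'n bergman) (kernel 0))"
    by (rule inner_bergman_def)
  ultimately show ?thesis by (simp add: norm_eq_sqrt_inner)
qed

text \<open>Pulled back to the polydisk by the affine chart of the cell, \<open>h\<close> is again
  an element \<open>Hb\<close> of the Bergman space. Its value at 0 is the pairing with
  \<open>kernel 0\<close>, a vector of norm at most 1, so Cauchy-Schwarz gives the estimate. The
  Jacobian (1/2)^(2n) \<open>cell_vol w\<close> produces the factor 4^n.\<close>

lemma cell_mean_value:
  fixes w :: "complex ^ 'n::finite"
  assumes w: "w \<in> polydisk"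
  shows "cell_vol w * (cmod (bergman_fun h w))\<^sup>2 \<le> 4 ^ CARD('n) * local_mass h (cell w (1/2))"
proof -
  define H where "H \<zeta> = (if \<zeta> \<in> polydisk then bergman_fun h (cell_map w (1/2) \<zeta>) else 0)" for \<zeta>
  have an: "analytic_polydisk (bergman_fun h)" using bergman_fun[of h]
    by (simp add: bergman_set_def)
  have [measurable]: "cell_map w (1/2) \<in> borel_measurable borel"
    by (rule borel_measurable_continuous_onI[OF continuous_on_cell_map])
  have Hm: "H \<in> borel_measurable borel" unfolding H_def by measurable
  have inpd: "cell_map w (1/2) \<zeta> \<in> polydisk" if "\<zeta> \<in> polydisk" for \<zeta>
    using cell_map_in_cell_iff[OF w, of "1/2" \<zeta>] cell_subset_polydisk[OF w, of "1/2"] that by auto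
  have "ennreal (LINT u|dv. indicator (cell w (1/2)) u * (cmod (bergman_fun h u))\<^sup>2)
      = (\<integral>\<^sup>+u. ennreal ((cmod (bergman_fun h u))\<^sup>2) * indicator (cell w (1/2)) u \<partial>dv)"
  proof (subst nn_integral_eq_integral[symmetric])
    show "integrable dv (\<lambda>u. indicator (cell w (1/2)) u * (cmod (bergman_fun h u))\<^sup>2)"
      by (rule integrable_local_mass) simp
  qed (auto intro!: nn_integral_cong simp: indicator_def)
  then have LM: "ennreal (local_mass h (cell w (1/2)))
      = (\<integral>\<^sup>+\<zeta>. ennreal ((cmod (bergman_fun h (cell_map w (1/2) \<zeta>)))\<^sup>2) \<partial>dv)
      * ennreal ((1/2) ^ (2 * CARD('n)) * cell_vol w)"
    unfolding local_mass_def by (subst nn_integral_cell_map[OF _ w]) auto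
  have nnH: "(\<integral>\<^sup>+\<zeta>. ennreal ((cmod (bergman_fun h (cell_map w (1/2) \<zeta>)))\<^sup>2) \<partial>dv)
      = (\<integral>\<^sup>+\<zeta>. ennreal ((cmod (H \<zeta>))\<^sup>2) \<partial>dv)"
    by (rule nn_integral_cong_AE) (use AE_dv_polydisk in \<open>auto simp: H_def elim: eventually_mono\<close>)
  have vp: "0 < (1/2) ^ (2 * CARD('n)) * cell_vol w" using cell_vol_pos[OF w] by simp
  \<comment> \<open>The Jacobian is positive, so an infinite integral would make the finite local
    mass infinite.\<close>
  have fin: "(\<integral>\<^sup>+\<zeta>. ennreal ((cmod (H \<zeta>))\<^sup>2) \<partial>dv) < \<infinity>"
  proof (rule ccontr)
    assume "\<not> ?thesis"
    then have "(\<integral>\<^sup>+\<zeta>. ennreal ((cmod (H \<zeta>))\<^sup>2) \<partial>dv) = top"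
      by (metis infinity_ennreal_def less_top)
    moreover have "ennreal ((1/2) ^ (2 * CARD('n)) * cell_vol w) \<noteq> 0"
      using vp by (metis ennreal_eq_0_iff not_less)
    ultimately have "ennreal (local_mass h (cell w (1/2))) = top"
      unfolding LM nnH by (simp only: ennreal_top_mult if_False)
    then show False by simp
  qed
  have Hint: "integrable dv (\<lambda>\<zeta>. (cmod (H \<zeta>))\<^sup>2)"
    using fin Hm by (intro integrableI_bounded) auto
  have "analytic_polydisk H"
    unfolding analytic_polydisk_def
  proof
    fix \<zeta> :: "complex ^ 'n" assume \<zeta>: "\<zeta> \<in> polydisk"
    obtain h' where h': "(bergman_fun h has_derivative h') (at (cell_map w (1/2) \<zeta>))"
      and lin: "\<And>c x. h' (c *s x) = c * h' x"
      using an inpd[OF \<zeta>] unfolding analytic_polydisk_def by blast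
    define L where "L x = (\<chi> i. of_real (1/2 * (1 - cmod (w $ i))) * x $ i)" for x :: "complex ^ 'n"
    have "linear L"
      by (rule linearI) (auto simp: L_def vec_eq_iff algebra_simps scaleR_conv_of_real)
    then have "(L has_derivative L) (at \<zeta>)"
      by (intro bounded_linear_imp_has_derivative) (simp add: linear_conv_bounded_linear)
    then have "((\<lambda>x. w + L x) has_derivative L) (at \<zeta>)"
      by (auto intro!: derivative_eq_intros)
    moreover have "(\<lambda>x. w + L x) = cell_map w (1/2)"
      by (auto simp: L_def vec_eq_iff)
    ultimately have "(cell_map w (1/2) has_derivative L) (at \<zeta>)" by simp
    from has_derivative_compose[OF this h']
    have "((\<lambda>x. bergman_fun h (cell_map w (1/2) x)) has_derivative (\<lambda>x. h' (L x))) (at \<zeta>)" .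
    then have "(H has_derivative (\<lambda>x. h' (L x))) (at \<zeta>)"
      by (rule has_derivative_transform_within_open[OF _ open_polydisk \<zeta>]) (simp add: H_def)
    moreover have "h' (L (c *s x)) = c * h' (L x)" for c x
    proof -
      have "L (c *s x) = c *s L x" by (simp add: L_def vec_eq_iff)
      then show ?thesis by (simp add: lin)
    qed
    ultimately show "\<exists>f'. (H has_derivative f') (at \<zeta>) \<and> (\<forall>c h. f' (c *s h) = c * f' h)" by blast
  qed
  then have HB: "H \<in> bergman_set" using Hint by (auto simp: bergman_set_def H_def)
  define Hb where "Hb = Abs_bergman H"
  have bHb: "bergman_fun Hb = H" unfolding Hb_def using HB by (rule Abs_bergman_inverse)
  have "cell_map w (1/2) 0 = w" by (simp add: vec_eq_iff)
  then have "bergman_fun h w = cinner Hb (kernel 0)"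
    by (subst cinner_kernel) (simp_all add: bHb H_def)
  then have "cmod (bergman_fun h w) \<le> norm Hb * norm (kernel 0 :: 'n bergman)"
    using norm_cinner_le[of Hb "kernel 0"] by simp
  also have "\<dots> \<le> norm Hb * 1" by (intro mult_left_mono norm_kernel_zero_le) simp
  finally have "(cmod (bergman_fun h w))\<^sup>2 \<le> (norm Hb)\<^sup>2" by (intro power_mono) auto
  also have "(norm Hb)\<^sup>2 = (LINT \<zeta>|dv. (cmod (H \<zeta>))\<^sup>2)" by (simp add: norm_square_bergman bHb)
  finally have le: "(cmod (bergman_fun h w))\<^sup>2 \<le> (LINT \<zeta>|dv. (cmod (H \<zeta>))\<^sup>2)" .
  have "ennreal (local_mass h (cell w (1/2)))
      = ennreal ((LINT \<zeta>|dv. (cmod (H \<zeta>))\<^sup>2) * ((1/2) ^ (2 * CARD('n)) * cell_vol w))"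
    using LM nnH Hint vp by (simp add: nn_integral_eq_integral ennreal_mult)
  then have "local_mass h (cell w (1/2)) = (LINT \<zeta>|dv. (cmod (H \<zeta>))\<^sup>2)
      * ((1/2) ^ (2 * CARD('n)) * cell_vol w)"
    using vp by (subst (asm) ennreal_inj) (auto intro!: local_mass_nonneg mult_nonneg_nonneg
      Bochner_Integration.integral_nonneg)
  moreover have "(4::real) ^ CARD('n) * (1/2) ^ (2 * CARD('n)) = 1"
    by (simp add: power_mult power_divide flip: power_mult_distrib)
  ultimately have "4 ^ CARD('n) * local_mass h (cell w (1/2))
      = (LINT \<zeta>|dv. (cmod (H \<zeta>))\<^sup>2) * cell_vol w"
    by (simp add: algebra_simps)
  then show ?thesis
    using mult_left_mono[OF le less_imp_le[OF cell_vol_pos[OF w]]] by (simp add: mult.commute)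
qed

text \<open>A majorant of |h|^2 on all of \<open>cell w (1/8)\<close>. One factor 4^n comes from the
  mean value inequality at a point u of that cell, the other from comparing
  \<open>cell_vol u\<close> with \<open>cell_vol w\<close>. The radius 3/4 suffices because 1/8 +
  (1/2)(1 + 1/8) = 11/16.\<close>

definition local_mean :: "'n::finite bergman \<Rightarrow> complex ^ 'n \<Rightarrow> real" where
  "local_mean h w = 16 ^ CARD('n) * (local_mass h (cell w (3/4)) / cell_vol w)"

lemma local_mean_nonneg: "w \<in> polydisk \<Longrightarrow> 0 \<le> local_mean h w"
  unfolding local_mean_def using cell_vol_pos[of w] local_mass_nonneg[of h]
  by (intro mult_nonneg_nonneg divide_nonneg_pos) auto

text \<open>The triangle inequality for relative radii: the radius \<open>s\<close> is measured at
  \<open>u\<close>, whose distance to the boundary is at most 1 + r times that of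
  \<open>w\<close>.\<close>

lemma cell_subset_cell:
  assumes u: "u \<in> cell w r" and s: "0 \<le> s" and w: "w \<in> polydisk" and t: "r + s * (1 + r) \<le> t"
  shows "cell u s \<subseteq> cell w t"
proof
  fix x assume x: "x \<in> cell u s"
  have "cmod (x $ i - w $ i) < t * (1 - cmod (w $ i))" for i
  proof -
    have "cmod (x $ i - w $ i) \<le> cmod (x $ i - u $ i) + cmod (u $ i - w $ i)"
      using norm_triangle_ineq[of "x $ i - u $ i" "u $ i - w $ i"] by simp
    also have "\<dots> < s * (1 - cmod (u $ i)) + r * (1 - cmod (w $ i))"
      using x u by (intro add_strict_mono) (auto simp: cell_def)
    also have "\<dots> \<le> s * ((1 + r) * (1 - cmod (w $ i))) + r * (1 - cmod (w $ i))"
      using s cell_gap_le(1)[OF u] by (intro add_right_mono mult_left_mono) auto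
    also have "\<dots> = (r + s * (1 + r)) * (1 - cmod (w $ i))" by (simp add: algebra_simps)
    also have "\<dots> \<le> t * (1 - cmod (w $ i))"
      using t polydisk_gap_pos[OF w, of i] by (intro mult_right_mono) auto
    finally show ?thesis .
  qed
  then show "x \<in> cell w t" by (simp add: cell_def)
qed

lemma cell_vol_mono_factor:
  fixes z w :: "complex ^ 'n::finite"
  assumes "\<And>i. 1 - cmod (z $ i) \<le> c * (1 - cmod (w $ i))" and z: "z \<in> polydisk"
  shows "cell_vol z \<le> (c\<^sup>2) ^ CARD('n) * cell_vol w"
proof -
  have "cell_vol z \<le> (\<Prod>i\<in>UNIV. c\<^sup>2 * (1 - cmod (w $ i))\<^sup>2)"
    unfolding cell_vol_def
  proof (intro prod_mono conjI)
    fix i :: 'n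
    have "(1 - cmod (z $ i))\<^sup>2 \<le> (c * (1 - cmod (w $ i)))\<^sup>2"
      using polydisk_gap_pos[OF z, of i] by (intro power_mono assms) auto
    then show "(1 - cmod (z $ i))\<^sup>2 \<le> c\<^sup>2 * (1 - cmod (w $ i))\<^sup>2"
      unfolding power_mult_distrib .
  qed simp
  then show ?thesis by (simp add: prod.distrib cell_vol_def)
qed

lemma cell_vol_cell_ge:
  fixes w :: "complex ^ 'n::finite"
  assumes u: "u \<in> cell w r" and r: "r \<le> 1/2" and w: "w \<in> polydisk"
  shows "cell_vol w \<le> 4 ^ CARD('n) * cell_vol u"
proof -
  have "1 - cmod (w $ i) \<le> 2 * (1 - cmod (u $ i))" for i
  proof -
    have "1/2 * (1 - cmod (w $ i)) \<le> (1 - r) * (1 - cmod (w $ i))"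
      using r polydisk_gap_pos[OF w, of i] by (intro mult_right_mono) auto
    then show ?thesis using cell_gap_le(2)[OF u, of i] by simp
  qed
  from cell_vol_mono_factor[OF this w] show ?thesis by simp
qed

lemma bergman_cell_bound:
  fixes w :: "complex ^ 'n::finite"
  assumes w: "w \<in> polydisk" and u: "u \<in> cell w (1/8)"
  shows "(cmod (bergman_fun h u))\<^sup>2 \<le> local_mean h w"
proof -
  have upd: "u \<in> polydisk" using cell_subset_polydisk[OF w, of "1/8"] u by auto
  note vp = cell_vol_pos[OF upd] cell_vol_pos[OF w]
  have "cell_vol u * (cmod (bergman_fun h u))\<^sup>2 \<le> 4 ^ CARD('n) * local_mass h (cell u (1/2))"
    by (rule cell_mean_value[OF upd])
  also have "\<dots> \<le> 4 ^ CARD('n) * local_mass h (cell w (3/4))"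
    by (intro mult_left_mono local_mass_mono cell_subset_cell[OF u _ w]) auto
  finally have 1: "cell_vol u * (cmod (bergman_fun h u))\<^sup>2
      \<le> 4 ^ CARD('n) * local_mass h (cell w (3/4))" .
  have "cell_vol w * (cmod (bergman_fun h u))\<^sup>2
      \<le> 4 ^ CARD('n) * cell_vol u * (cmod (bergman_fun h u))\<^sup>2"
    using cell_vol_cell_ge[OF u _ w] by (intro mult_right_mono) auto
  also have "\<dots> \<le> 4 ^ CARD('n) * (4 ^ CARD('n) * local_mass h (cell w (3/4)))"
    using 1 by (simp add: mult.assoc)
  also have "\<dots> = 16 ^ CARD('n) * local_mass h (cell w (3/4))"
    by (simp flip: mult.assoc power_mult_distrib)
  finally show ?thesis
    using vp by (simp add: local_mean_def field_simps)
qed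

text \<open>The complex line from \<open>w\<close> through \<open>u\<close> stays in
  \<open>cell w (1/8)\<close> for parameters of modulus below 1 / (8 e), and there |h| is at most
  the square root of \<open>local_mean\<close>. The Schwarz bound on this disc, taken at parameter
  1, yields the constant 16 e.\<close>

lemma bergman_cell_diff:
  fixes w :: "complex ^ 'n::finite"
  assumes w: "w \<in> polydisk" and e: "0 < e" "e \<le> 1/16" and u: "u \<in> cell w e"
  shows "cmod (bergman_fun h u - bergman_fun h w) \<le> 16 * e * sqrt (local_mean h w)"
proof -
  define \<sigma> where "\<sigma> \<tau> = (\<chi> i. w $ i + \<tau> * (u $ i - w $ i))" for \<tau>
  define \<rho> where "\<rho> = 1 / (8 * e)"
  have \<rho>: "\<rho> > 1" using e by (simp add: \<rho>_def field_simps)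
  have inc: "\<sigma> \<tau> \<in> cell w (1/8)" if "\<tau> \<in> ball 0 \<rho>" for \<tau>
  proof -
    have "cmod (\<tau> * (u $ i - w $ i)) < 1/8 * (1 - cmod (w $ i))" for i
    proof -
      have "cmod (\<tau> * (u $ i - w $ i)) \<le> \<rho> * cmod (u $ i - w $ i)"
        unfolding norm_mult using that by (intro mult_right_mono) auto
      also have "\<dots> < \<rho> * (e * (1 - cmod (w $ i)))"
        using u \<rho> by (intro mult_strict_left_mono) (auto simp: cell_def)
      also have "\<dots> = 1/8 * (1 - cmod (w $ i))" using e by (simp add: \<rho>_def)
      finally show ?thesis .
    qed
    then show ?thesis by (simp add: cell_def \<sigma>_def)
  qed
  have inpd: "\<sigma> \<tau> \<in> polydisk" if "\<tau> \<in> ball 0 \<rho>" for \<tau>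
    using cell_subset_polydisk[OF w, of "1/8"] inc[OF that] by auto
  have "analytic_polydisk (bergman_fun h)" using bergman_fun[of h] by (simp add: bergman_set_def)
  then have hol: "(\<lambda>\<tau>. bergman_fun h (\<sigma> \<tau>)) holomorphic_on ball 0 \<rho>"
    by (rule holomorphic_on_compose_polydisk)
      (use inpd in \<open>auto simp: \<sigma>_def intro!: holomorphic_intros\<close>)
  have bd: "cmod (bergman_fun h (\<sigma> \<tau>)) \<le> sqrt (local_mean h w)" if "\<tau> \<in> ball 0 \<rho>" for \<tau>
    using bergman_cell_bound[OF w inc[OF that], of h] by (rule real_le_rsqrt)
  have "cmod (bergman_fun h (\<sigma> 1) - bergman_fun h (\<sigma> 0)) \<le> 2 * sqrt (local_mean h w) * cmod 1 / \<rho>"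
    by (rule holomorphic_bounded_diff_le[OF hol bd]) (use \<rho> in auto)
  moreover have "\<sigma> 1 = u" "\<sigma> 0 = w" by (auto simp: \<sigma>_def vec_eq_iff)
  moreover have "2 * sqrt (local_mean h w) * cmod 1 / \<rho> = 16 * e * sqrt (local_mean h w)"
    using e by (simp add: \<rho>_def)
  ultimately show ?thesis by simp
qed

subsection \<open>Completeness and operators from Bessel families\<close>

lemma analytic_bergman_fun: "analytic_polydisk (bergman_fun h)"
  using bergman_fun[of h] by (simp add: bergman_set_def)

lemma bergman_bound:
  fixes w :: "complex ^ 'n::finite"
  assumes w: "w \<in> polydisk" and u: "u \<in> cell w (1/8)"
  shows "cmod (bergman_fun h u) \<le> sqrt (16 ^ CARD('n) / cell_vol w) * norm h"
proof -
  have "local_mean h w \<le> 16 ^ CARD('n) / cell_vol w * (norm h)\<^sup>2"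
    unfolding local_mean_def using local_mass_le_norm[of "cell w (3/4)" h] cell_vol_pos[OF w]
    by (simp add: divide_right_mono)
  then have "(cmod (bergman_fun h u))\<^sup>2 \<le> 16 ^ CARD('n) / cell_vol w * (norm h)\<^sup>2"
    using bergman_cell_bound[OF w u, of h] by simp
  then have "cmod (bergman_fun h u) \<le> sqrt (16 ^ CARD('n) / cell_vol w * (norm h)\<^sup>2)"
    by (rule real_le_rsqrt)
  then show ?thesis by (simp only: real_sqrt_mult real_sqrt_abs abs_norm_cancel)
qed

lemma ball_subset_cell:
  fixes w :: "complex ^ 'n::finite"
  assumes w: "w \<in> polydisk" and r: "0 < r"
  obtains \<rho> where "0 < \<rho>" "ball w \<rho> \<subseteq> cell w r"
proof -
  have "w \<in> cell w r" by (rule centre_in_cell[OF w r])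
  then show ?thesis using open_cell[of w r] that unfolding open_contains_ball by blast
qed

text \<open>\<open>D v\<close> is the derivative at 0 of the slice \<tau> \<mapsto> g(x + \<tau> v),
  which is bounded by \<open>B\<close> for |\<tau>| < r / |v|. The Schwarz bound controls all its
  difference quotients, hence their limit.\<close>

lemma complex_linear_derivative_bound:
  fixes g :: "complex ^ 'n::finite \<Rightarrow> complex"
  assumes an: "analytic_polydisk g" and r: "0 < r" and sub: "ball x r \<subseteq> polydisk"
    and bd: "\<And>u. u \<in> ball x r \<Longrightarrow> cmod (g u) \<le> B"
    and D: "(g has_derivative D) (at x)" and lin: "\<And>c v. D (c *s v) = c * D v"
  shows "cmod (D v) \<le> 2 * B / r * norm v"
proof (cases "v = 0")
  case True
  then show ?thesis using linear_0[OF has_derivative_linear[OF D]] by simp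
next
  case False
  define \<rho> where "\<rho> = r / norm v"
  have \<rho>: "\<rho> > 0" using False r by (simp add: \<rho>_def)
  have nsc: "norm (\<tau> *s v) = cmod \<tau> * norm v" for \<tau>
    by (simp add: norm_vec_def norm_mult L2_set_def power_mult_distrib real_sqrt_mult flip:
      sum_distrib_left)
  have inb: "x + \<tau> *s v \<in> ball x r" if "\<tau> \<in> ball 0 \<rho>" for \<tau>
    using that False by (simp add: dist_norm nsc \<rho>_def field_simps)
  have hol: "(\<lambda>\<tau>. g (x + \<tau> *s v)) holomorphic_on ball 0 \<rho>"
    by (rule holomorphic_on_compose_polydisk[OF an])
      (use inb sub in \<open>auto intro!: holomorphic_intros\<close>)
  have diff: "cmod (g (x + \<tau> *s v) - g x) \<le> 2 * B * cmod \<tau> / \<rho>" if "cmod \<tau> < \<rho>" for \<tau>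
    using holomorphic_bounded_diff_le[OF hol, of B \<tau>] bd inb that by simp
  have "((\<lambda>\<tau>. x + \<tau> *s v) has_derivative (\<lambda>\<tau>. \<tau> *s v)) (at 0)"
  proof -
    have "bounded_linear (\<lambda>\<tau>. \<tau> *s v)"
      unfolding linear_conv_bounded_linear[symmetric]
        by (rule linearI) (auto simp: vec_eq_iff algebra_simps)
    then have "((\<lambda>\<tau>. \<tau> *s v) has_derivative (\<lambda>\<tau>. \<tau> *s v)) (at 0)"
      by (rule bounded_linear_imp_has_derivative)
    then show ?thesis by (auto intro!: derivative_eq_intros)
  qed
  from has_derivative_compose[OF this, of g D] D
  have "((\<lambda>\<tau>. g (x + \<tau> *s v)) has_derivative (\<lambda>\<tau>. D (\<tau> *s v))) (at 0)"
    by simp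
  then have "((\<lambda>\<tau>. g (x + \<tau> *s v)) has_field_derivative D v) (at 0)"
    by (simp add: has_field_derivative_def lin mult.commute[of _ "D v"])
  then have "((\<lambda>\<tau>. (g (x + \<tau> *s v) - g x) / \<tau>) \<longlongrightarrow> D v) (at 0)"
    by (simp add: has_field_derivative_iff)
  moreover have "eventually (\<lambda>\<tau>. cmod ((g (x + \<tau> *s v) - g x) / \<tau>) \<le> 2 * B / \<rho>) (at 0)"
    unfolding eventually_at
  proof (intro exI[of _ \<rho>] conjI \<rho> ballI impI)
    fix \<tau> :: complex assume "\<tau> \<noteq> 0 \<and> dist \<tau> 0 < \<rho>"
    then show "cmod ((g (x + \<tau> *s v) - g x) / \<tau>) \<le> 2 * B / \<rho>"
      using diff[of \<tau>] by (simp add: norm_divide field_simps)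
  qed
  ultimately have "cmod (D v) \<le> 2 * B / \<rho>"
    by (intro tendsto_upperbound[OF tendsto_norm]) auto
  then show ?thesis by (simp add: \<rho>_def)
qed

lemma analytic_polydisk_diff:
  assumes "analytic_polydisk f" "analytic_polydisk g"
  shows "analytic_polydisk (\<lambda>z. f z - g z)"
  unfolding analytic_polydisk_def
proof
  fix z :: "complex ^ 'a" assume z: "z \<in> polydisk"
  obtain f' where "(f has_derivative f') (at z)" "\<forall>c h. f' (c *s h) = c * f' h"
    using assms(1) z unfolding analytic_polydisk_def by blast
  moreover obtain g' where "(g has_derivative g') (at z)" "\<forall>c h. g' (c *s h) = c * g' h"
    using assms(2) z unfolding analytic_polydisk_def by blast
  ultimately show "\<exists>f'. ((\<lambda>z. f z - g z) has_derivative f') (at z) \<and> (\<forall>c h. f' (c *s h) = c * f' h)"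
    by (intro exI[of _ "\<lambda>h. f' h - g' h"]) (auto intro!: derivative_intros simp: right_diff_distrib)
qed

text \<open>Local boundedness of point evaluations makes a norm Cauchy sequence locally uniformly
  Cauchy. Applying the derivative bound to differences makes the derivatives uniformly Cauchy too,
  so the limit is differentiable; complex linearity of the derivative passes to the limit.\<close>

lemma bergman_Cauchy_limit_analytic:
  fixes X :: "nat \<Rightarrow> 'n::finite bergman"
  assumes X: "Cauchy X" and w: "w \<in> polydisk"
    and lim: "\<And>u. u \<in> polydisk \<Longrightarrow> (\<lambda>k. bergman_fun (X k) u) \<longlonglongrightarrow> f u"
  shows "\<exists>f'. (f has_derivative f') (at w) \<and> (\<forall>c h. f' (c *s h) = c * f' h)"
proof -
  obtain \<rho> where \<rho>: "0 < \<rho>" "ball w \<rho> \<subseteq> cell w (1/8)"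
    by (rule ball_subset_cell[OF w, of "1/8"]) auto
  have cpd: "cell w (1/8) \<subseteq> polydisk" by (rule cell_subset_polydisk[OF w]) auto
  let ?S = "ball w (\<rho>/2)"
  \<comment> \<open>Derivatives are compared on the half ball only: around each of its points a ball
    of radius \<rho>/2 remains where the functions are controlled.\<close>
  have Spd: "?S \<subseteq> polydisk"
    using \<rho> cpd subset_ball[of "\<rho>/2" \<rho> w] by simp
  define K where "K = sqrt (16 ^ CARD('n) / cell_vol w)"
  have K: "K \<ge> 0" using cell_vol_pos[OF w] by (simp add: K_def)
  have "\<forall>k x. \<exists>D. x \<in> polydisk \<longrightarrow> (bergman_fun (X k) has_derivative D) (at x)
      \<and> (\<forall>c h. D (c *s h) = c * D h)"
    using analytic_bergman_fun unfolding analytic_polydisk_def by blast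
  then obtain D where D: "\<And>k x. x \<in> polydisk \<Longrightarrow> (bergman_fun (X k) has_derivative D k x) (at x)"
    and Dlin: "\<And>k x c h. x \<in> polydisk \<Longrightarrow> D k x (c *s h) = c * D k x h"
    by metis
  have Ddiff: "cmod (D k x v - D m x v) \<le> (4 * K / \<rho>) * norm (X k - X m) * norm v"
    if x: "x \<in> ?S" for k m x v
  proof -
    have xpd: "x \<in> polydisk" using x Spd by auto
    have sub: "ball x (\<rho>/2) \<subseteq> ball w \<rho>"
      using x by (intro subsetI) (metis dist_commute dist_triangle_half_l mem_ball)
    have "cmod (D k x v - D m x v) \<le> 2 * (K * norm (X k - X m)) / (\<rho>/2) * norm v"
    proof (rule complex_linear_derivative_bound[where g = "\<lambda>u. bergman_fun (X k) u
        - bergman_fun (X m) u"])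
      show "ball x (\<rho>/2) \<subseteq> polydisk" using sub \<rho> cpd by blast
      show "cmod (bergman_fun (X k) u - bergman_fun (X m) u) \<le> K * norm (X k - X m)"
        if "u \<in> ball x (\<rho>/2)" for u
      proof -
        have "u \<in> cell w (1/8)" using that sub \<rho>(2) by blast
        from bergman_bound[OF w this, of "X k - X m"] show ?thesis
          by (simp add: K_def minus_bergman.rep_eq)
      qed
    qed (use \<rho> xpd in \<open>auto intro!: analytic_polydisk_diff analytic_bergman_fun has_derivative_diff
      D simp: Dlin right_diff_distrib\<close>)
    then show ?thesis by (simp add: mult_ac)
  qed
  have Cau: "Cauchy (\<lambda>k. D k x v)" if x: "x \<in> ?S" for x v
  proof (rule metric_CauchyI)
    fix e :: real assume e: "e > 0"
    let ?c = "(4 * K / \<rho>) * norm v + 1"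
    have c: "?c > 0" using K \<rho> by (intro add_nonneg_pos mult_nonneg_nonneg) auto
    then obtain N where N: "\<And>k m. k \<ge> N \<Longrightarrow> m \<ge> N \<Longrightarrow> dist (X k) (X m) < e / ?c"
      using X e unfolding Cauchy_def by (metis divide_pos_pos)
    show "\<exists>M. \<forall>m\<ge>M. \<forall>n\<ge>M. dist (D m x v) (D n x v) < e"
    proof (intro exI[of _ N] allI impI)
      fix m n assume "N \<le> m" "N \<le> n"
      have "dist (D m x v) (D n x v) \<le> (4 * K / \<rho>) * norm v * norm (X m - X n)"
        using Ddiff[OF x, of m v n] by (simp add: dist_norm mult_ac)
      also have "\<dots> \<le> ?c * norm (X m - X n)" by (intro mult_right_mono) auto
      also have "\<dots> < ?c * (e / ?c)"
        using N[OF \<open>N \<le> m\<close> \<open>N \<le> n\<close>] c by (intro mult_strict_left_mono) (auto simp: dist_norm)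
      finally show "dist (D m x v) (D n x v) < e" using c by simp
    qed
  qed
  define g' where "g' x v = lim (\<lambda>k. D k x v)" for x v
  have g': "(\<lambda>k. D k x v) \<longlonglongrightarrow> g' x v" if "x \<in> ?S" for x v
    unfolding g'_def using Cauchy_convergent[OF Cau[OF that]] by (simp add: convergent_LIMSEQ_iff)
  have "\<exists>g. \<forall>x\<in>?S. (\<lambda>n. bergman_fun (X n) x) \<longlonglongrightarrow> g x \<and> (g has_derivative g' x) (at x within ?S)"
  proof (rule has_derivative_sequence)
    show "w \<in> ?S" using \<rho> by simp
    show "(\<lambda>n. bergman_fun (X n) w) \<longlonglongrightarrow> f w" by (rule lim[OF w])
    show "(bergman_fun (X n) has_derivative D n x) (at x within ?S)" if "x \<in> ?S" for n x
      using has_derivative_at_withinI[OF D] that Spd by blast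
    fix e :: real assume e: "e > 0"
    let ?c = "4 * K / \<rho> + 1"
    have c: "?c > 0" using K \<rho> by (intro add_nonneg_pos) auto
    then obtain N where N: "\<And>k m. k \<ge> N \<Longrightarrow> m \<ge> N \<Longrightarrow> dist (X k) (X m) < e / ?c"
      using X e unfolding Cauchy_def by (metis divide_pos_pos)
    have "norm (D n x h - g' x h) \<le> e * norm h" if n: "n \<ge> N" and x: "x \<in> ?S" for n x h
    proof (rule tendsto_upperbound)
      show "(\<lambda>m. norm (D n x h - D m x h)) \<longlonglongrightarrow> norm (D n x h - g' x h)"
        by (intro tendsto_intros g' x)
      show "\<forall>\<^sub>F m in sequentially. norm (D n x h - D m x h) \<le> e * norm h"
        using eventually_ge_at_top[of N]
      proof (rule eventually_mono)
        fix m assume m: "N \<le> m"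
        have "norm (D n x h - D m x h) \<le> (4 * K / \<rho>) * norm (X n - X m) * norm h"
          by (rule Ddiff[OF x])
        also have "\<dots> \<le> ?c * (e / ?c) * norm h"
          using N[OF n m] c K \<rho> by (intro mult_right_mono mult_mono) (auto simp: dist_norm)
        finally show "norm (D n x h - D m x h) \<le> e * norm h" using c by simp
      qed
    qed simp
    then show "\<forall>\<^sub>F n in sequentially. \<forall>x\<in>?S. \<forall>h. norm (D n x h - g' x h) \<le> e * norm h"
      unfolding eventually_sequentially by blast
  qed simp
  then obtain g where g: "\<And>x. x \<in> ?S \<Longrightarrow> (\<lambda>n. bergman_fun (X n) x) \<longlonglongrightarrow> g x"
    and gd: "\<And>x. x \<in> ?S \<Longrightarrow> (g has_derivative g' x) (at x within ?S)" by blast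
  have wS: "w \<in> ?S" using \<rho> by simp
  have gf: "g x = f x" if "x \<in> ?S" for x
    using LIMSEQ_unique[OF g[OF that] lim] that Spd by auto
  have "(g has_derivative g' w) (at w)"
    using gd[OF wS] at_within_open[OF wS] by simp
  then have "(f has_derivative g' w) (at w)"
    by (rule has_derivative_transform_within_open[OF _ open_ball wS]) (rule gf)
  moreover have "g' w (c *s h) = c * g' w h" for c h
  proof (rule LIMSEQ_unique[OF g'[OF wS]])
    show "(\<lambda>k. D k w (c *s h)) \<longlonglongrightarrow> c * g' w h"
      unfolding Dlin[OF w] by (intro tendsto_intros g' wS)
  qed
  ultimately show ?thesis by blast
qed

text \<open>The pointwise limit is the candidate. Fatou's lemma, applied to |X k - X m|^2 as m
  grows, shows both that the limit is square integrable and that the convergence holds in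
  norm.\<close>

lemma bergman_complete:
  fixes X :: "nat \<Rightarrow> 'n::finite bergman"
  assumes X: "Cauchy X"
  shows "convergent X"
proof -
  define f where "f u = lim (\<lambda>k. bergman_fun (X k) u)" for u
  have outside: "bergman_fun h u = 0" if "u \<notin> polydisk" for u and h :: "'n bergman"
    using bergman_fun[of h] that by (simp add: bergman_set_def)
  have Cau: "Cauchy (\<lambda>k. bergman_fun (X k) u)" if u: "u \<in> polydisk" for u
  proof (rule metric_CauchyI)
    fix e :: real assume e: "e > 0"
    let ?K = "sqrt (16 ^ CARD('n) / cell_vol u) + 1"
    have c: "?K > 0" using cell_vol_pos[OF u] by (intro add_nonneg_pos) auto
    then obtain N where N: "\<And>k m. k \<ge> N \<Longrightarrow> m \<ge> N \<Longrightarrow> dist (X k) (X m) < e / ?K"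
      using X e unfolding Cauchy_def by (metis divide_pos_pos)
    show "\<exists>M. \<forall>m\<ge>M. \<forall>n\<ge>M. dist (bergman_fun (X m) u) (bergman_fun (X n) u) < e"
    proof (intro exI[of _ N] allI impI)
      fix m n assume "N \<le> m" "N \<le> n"
      have "dist (bergman_fun (X m) u) (bergman_fun (X n) u)
          \<le> sqrt (16 ^ CARD('n) / cell_vol u) * norm (X m - X n)"
        using bergman_bound[OF u centre_in_cell[OF u, of "1/8"], of "X m - X n"]
        by (simp add: dist_norm minus_bergman.rep_eq)
      also have "\<dots> \<le> ?K * norm (X m - X n)" by (intro mult_right_mono) auto
      also have "\<dots> < ?K * (e / ?K)"
        using N[OF \<open>N \<le> m\<close> \<open>N \<le> n\<close>] c by (intro mult_strict_left_mono) (auto simp: dist_norm)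
      finally show "dist (bergman_fun (X m) u) (bergman_fun (X n) u) < e" using c by simp
    qed
  qed
  have lim: "(\<lambda>k. bergman_fun (X k) u) \<longlonglongrightarrow> f u" for u
  proof (cases "u \<in> polydisk")
    case True
    then show ?thesis unfolding f_def using Cauchy_convergent[OF Cau]
      by (simp add: convergent_LIMSEQ_iff)
  qed (simp add: f_def outside)
  have f0: "f u = 0" if "u \<notin> polydisk" for u
    using that by (simp add: f_def outside)
  have an: "analytic_polydisk f"
    unfolding analytic_polydisk_def using bergman_Cauchy_limit_analytic[OF X _ lim] by blast
  have fm[measurable]: "f \<in> borel_measurable borel"
    by (rule borel_measurable_LIMSEQ_metric[OF _ lim]) simp
  have Fatou: "(\<integral>\<^sup>+u. ennreal ((cmod (bergman_fun (X k) u - f u))\<^sup>2) \<partial>dv) \<le> ennreal (e\<^sup>2)"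
    if N: "\<And>m. m \<ge> N \<Longrightarrow> norm (X k - X m) \<le> e" for k e N
  proof -
    have "(\<integral>\<^sup>+u. ennreal ((cmod (bergman_fun (X k) u - f u))\<^sup>2) \<partial>dv)
       = (\<integral>\<^sup>+u. liminf (\<lambda>m. ennreal ((cmod (bergman_fun (X k) u - bergman_fun (X m) u))\<^sup>2)) \<partial>dv)"
    proof (rule nn_integral_cong)
      fix u
      have "(\<lambda>m. ennreal ((cmod (bergman_fun (X k) u - bergman_fun (X m) u))\<^sup>2))
          \<longlonglongrightarrow> ennreal ((cmod (bergman_fun (X k) u - f u))\<^sup>2)"
        by (intro tendsto_intros lim)
      then show "ennreal ((cmod (bergman_fun (X k) u - f u))\<^sup>2)
          = liminf (\<lambda>m. ennreal ((cmod (bergman_fun (X k) u - bergman_fun (X m) u))\<^sup>2))"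
        using lim_imp_Liminf[of sequentially] by fastforce
    qed
    also have "\<dots> \<le> liminf (\<lambda>m. \<integral>\<^sup>+u. ennreal ((cmod (bergman_fun (X k) u - bergman_fun (X m) u))\<^sup>2)
        \<partial>dv)"
      by (rule nn_integral_liminf) simp
    also have "\<dots> \<le> ennreal (e\<^sup>2)"
    proof (rule Liminf_le)
      have "(\<integral>\<^sup>+u. ennreal ((cmod (bergman_fun (X k) u - bergman_fun (X m) u))\<^sup>2) \<partial>dv)
          = ennreal ((norm (X k - X m))\<^sup>2)" for m
        using nn_integral_eq_integral[OF integrable_bergman_square[of "X k - X m"]]
        by (simp add: norm_square_bergman minus_bergman.rep_eq)
      then show "\<forall>\<^sub>F m in sequentially. (\<integral>\<^sup>+u. ennreal ((cmod (bergman_fun (X k) u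
          - bergman_fun (X m) u))\<^sup>2) \<partial>dv) \<le> ennreal (e\<^sup>2)"
        using N unfolding eventually_sequentially by (metis ennreal_leI norm_ge_zero power_mono)
    qed simp
    finally show ?thesis .
  qed
  have fin: "integrable dv (\<lambda>u. (cmod (bergman_fun (X k) u - f u))\<^sup>2)
      \<and> (LINT u|dv. (cmod (bergman_fun (X k) u - f u))\<^sup>2) \<le> e\<^sup>2"
    if N: "\<And>m. m \<ge> N \<Longrightarrow> norm (X k - X m) \<le> e" for k e N
  proof -
    have "(\<integral>\<^sup>+u. ennreal ((cmod (bergman_fun (X k) u - f u))\<^sup>2) \<partial>dv) < \<infinity>"
      by (rule le_less_trans[OF Fatou[OF N]]) auto
    then have 1: "integrable dv (\<lambda>u. (cmod (bergman_fun (X k) u - f u))\<^sup>2)"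
      by (intro integrableI_bounded) auto
    then have "ennreal (LINT u|dv. (cmod (bergman_fun (X k) u - f u))\<^sup>2) \<le> ennreal (e\<^sup>2)"
      using Fatou[OF N] by (simp add: nn_integral_eq_integral)
    then show ?thesis using 1 by (simp add: ennreal_le_iff)
  qed
  obtain N where N: "\<And>k m. k \<ge> N \<Longrightarrow> m \<ge> N \<Longrightarrow> norm (X k - X m) < 1"
    using X unfolding Cauchy_def dist_norm by (metis zero_less_one)
  have "integrable dv (\<lambda>u. 2 * (cmod (bergman_fun (X N) u))\<^sup>2
      + 2 * (cmod (bergman_fun (X N) u - f u))\<^sup>2)"
    using fin[of N N 1] N integrable_bergman_square[of "X N"] by (simp add: less_imp_le)
  then have "integrable dv (\<lambda>u. (cmod (f u))\<^sup>2)"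
  proof (rule Bochner_Integration.integrable_bound)
    have "(cmod (f u))\<^sup>2 \<le> 2 * (cmod (bergman_fun (X N) u))\<^sup>2
        + 2 * (cmod (bergman_fun (X N) u - f u))\<^sup>2" for u
    proof -
      have "cmod (f u) \<le> cmod (bergman_fun (X N) u) + cmod (bergman_fun (X N) u - f u)"
        using norm_triangle_ineq4[of "bergman_fun (X N) u" "bergman_fun (X N) u - f u"] by simp
      then have "(cmod (f u))\<^sup>2 \<le> (cmod (bergman_fun (X N) u) + cmod (bergman_fun (X N) u - f u))\<^sup>2"
        by (intro power_mono) auto
      also have "\<dots> \<le> 2 * (cmod (bergman_fun (X N) u))\<^sup>2 + 2 * (cmod (bergman_fun (X N) u - f u))\<^sup>2"
        using sum_squares_bound[of "cmod (bergman_fun (X N) u)" "cmod (bergman_fun (X N) u - f u)"]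
        by (simp add: power2_sum)
      finally show ?thesis .
    qed
    then show "AE u in dv. norm ((cmod (f u))\<^sup>2)
        \<le> norm (2 * (cmod (bergman_fun (X N) u))\<^sup>2 + 2 * (cmod (bergman_fun (X N) u - f u))\<^sup>2)"
      by (intro AE_I2) (simp add: abs_of_nonneg)
  qed simp
  then have fB: "f \<in> bergman_set" using an f0 by (simp add: bergman_set_def)
  define Y where "Y = Abs_bergman f"
  have bY: "bergman_fun Y = f" unfolding Y_def using fB by (rule Abs_bergman_inverse)
  have "X \<longlonglongrightarrow> Y"
  proof (rule LIMSEQ_I)
    fix e :: real assume e: "e > 0"
    then obtain N where N: "\<And>k m. k \<ge> N \<Longrightarrow> m \<ge> N \<Longrightarrow> norm (X k - X m) < e/2"
      using X unfolding Cauchy_def dist_norm by (metis half_gt_zero)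
    have "norm (X k - Y) < e" if k: "k \<ge> N" for k
    proof -
      have "(norm (X k - Y))\<^sup>2 \<le> (e/2)\<^sup>2"
        using fin[of N k "e/2"] N[OF k] by (simp add: norm_square_bergman minus_bergman.rep_eq bY
          less_imp_le)
      then have "norm (X k - Y) \<le> e/2" using e by (simp add: power2_le_iff_abs_le)
      then show ?thesis using e by simp
    qed
    then show "\<exists>no. \<forall>n\<ge>no. norm (X n - Y) < e" by blast
  qed
  then show ?thesis by (auto simp: convergent_def)
qed

text \<open>Completeness enters twice: for strong sums over separated sets and, through the
  completeness of the operator space, for norm limits of sampling operators.\<close>

instance bergman :: (finite) banach
  by standard (rule bergman_complete)

section \<open>Sums of rank one operators along Bessel families\<close>

lemma cinner_cscale_right: "cinner f (c *\<^sub>c g) = cnj c * cinner f g"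
  unfolding cinner_commute[of f "c *\<^sub>c g"] cinner_commute[of f g]
  by (simp add: cinner_cscale_left)

lemma bounded_linear_cinner_left: "bounded_linear (\<lambda>f. cinner f g)"
  by (rule bounded_linear_intro[where K = "norm g"])
    (auto simp: cinner_add_left scaleR_eq_cscale cinner_cscale_left scaleR_conv_of_real
      norm_cinner_le)

lemmas cinner_diff_left = bounded_linear.linear[OF bounded_linear_cinner_left, THEN linear_diff]
  and cinner_sum_left = bounded_linear.linear[OF bounded_linear_cinner_left, THEN linear_sum]
  and cinner_zero_left = bounded_linear.linear[OF bounded_linear_cinner_left, THEN linear_0]

lemma cinner_self_norm: "cinner f f = of_real ((norm f)\<^sup>2)"
  by (simp add: cinner_self norm_square_bergman)

text \<open>The quadratic form of the bound lets later estimates avoid square roots.\<close>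

lemma norm_blinfun_le_form:
  fixes T :: "'n::finite bergman \<Rightarrow>\<^sub>L 'n bergman"
  assumes K: "0 \<le> K"
    and form: "\<And>h g. cmod (cinner (blinfun_apply T h) g) \<le> K * ((norm h)\<^sup>2 + (norm g)\<^sup>2)"
  shows "norm T \<le> 2 * K"
proof (rule norm_blinfun_bound)
  show "0 \<le> 2 * K" using K by simp
  fix h :: "'n bergman"
  define a b where "a = norm h" and "b = norm (blinfun_apply T h)"
  show "norm (blinfun_apply T h) \<le> 2 * K * norm h"
  proof (cases "a = 0 \<or> b = 0")
    case True
    then show ?thesis using K by (auto simp: a_def b_def blinfun.zero_right)
  next
    case False
    then have ab: "a > 0" "b > 0" by (auto simp: a_def b_def)
    \<comment> \<open>The image of \<open>h\<close>, rescaled to the norm of \<open>h\<close>, makes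
      the two squares on the right equal.\<close>
    define g where "g = of_real (a / b) *\<^sub>c blinfun_apply T h"
    have "norm g = a" using ab by (simp add: g_def norm_cscale b_def[symmetric] del: of_real_divide)
    moreover have "cmod (cinner (blinfun_apply T h) g) = a * b"
      using ab unfolding g_def cinner_cscale_right cinner_self_norm b_def[symmetric]
      by (simp add: norm_mult norm_power power2_eq_square norm_divide)
    ultimately have "a * b \<le> K * (a\<^sup>2 + a\<^sup>2)" using form[of h g] by (simp add: a_def)
    then have "a * b \<le> a * (2 * K * a)" by (simp add: power2_eq_square algebra_simps)
    then have "b \<le> 2 * K * a" using ab by simp
    then show ?thesis by (simp add: a_def b_def)
  qed
qed

text \<open>Duality: synthesis is the adjoint of the map sending \<open>h\<close> to its
  coefficients. Pairing the sum y with itself and using Cauchy-Schwarz gives |y|^4 \<le> s A |y|^2,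
  where s is the sum of the |a z|^2.\<close>

lemma bessel_sum_bound:
  fixes u :: "'i \<Rightarrow> 'n::finite bergman"
  assumes A: "0 \<le> A" and bes: "\<And>h. (\<Sum>z\<in>F. (cmod (cinner h (u z)))\<^sup>2) \<le> A * (norm h)\<^sup>2"
  shows "(norm (\<Sum>z\<in>F. a z *\<^sub>c u z))\<^sup>2 \<le> A * (\<Sum>z\<in>F. (cmod (a z))\<^sup>2)"
proof -
  define y where "y = (\<Sum>z\<in>F. a z *\<^sub>c u z)"
  define s where "s = (\<Sum>z\<in>F. (cmod (a z))\<^sup>2)"
  have s: "s \<ge> 0" unfolding s_def by (rule sum_nonneg) simp
  have "(norm y)\<^sup>2 = cmod (cinner y y)" by (simp add: cinner_self_norm norm_power)
  also have "cinner y y = (\<Sum>z\<in>F. a z * cinner (u z) y)"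
    by (subst (1) y_def) (simp add: cinner_sum_left cinner_cscale_left)
  also have "cmod \<dots> \<le> (\<Sum>z\<in>F. cmod (a z) * cmod (cinner y (u z)))"
  proof (rule sum_norm_le)
    fix z
    show "cmod (a z * cinner (u z) y) \<le> cmod (a z) * cmod (cinner y (u z))"
      using arg_cong[OF cinner_commute[of "u z" y], of cmod] by (simp add: norm_mult)
  qed
  finally have "((norm y)\<^sup>2)\<^sup>2 \<le> (\<Sum>z\<in>F. cmod (a z) * cmod (cinner y (u z)))\<^sup>2"
    by (intro power_mono) auto
  also have "\<dots> \<le> s * (\<Sum>z\<in>F. (cmod (cinner y (u z)))\<^sup>2)"
    unfolding s_def by (rule Cauchy_Schwarz_ineq_sum)
  also have "\<dots> \<le> s * (A * (norm y)\<^sup>2)" by (intro mult_left_mono bes s)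
  finally have le: "(norm y)\<^sup>2 * (norm y)\<^sup>2 \<le> (norm y)\<^sup>2 * (A * s)"
    by (simp add: power2_eq_square mult_ac)
  have "(norm y)\<^sup>2 \<le> A * s"
  proof (cases "norm y = 0")
    case True
    then show ?thesis using A s by simp
  next
    case False
    then have "0 < (norm y)\<^sup>2" by simp
    then show ?thesis using le by (simp only: mult_le_cancel_left_pos)
  qed
  then show ?thesis by (simp add: y_def s_def)
qed

text \<open>Cauchy criterion for the net of finite partial sums: outside a large finite set the
  coefficients have small square sum, and \<open>bessel_sum_bound\<close> converts this into small
  norm.\<close>

lemma bessel_summable:
  fixes u :: "'i \<Rightarrow> 'n::finite bergman"
  assumes A: "0 \<le> A" and bes: "\<And>h F. finite F \<Longrightarrow> F \<subseteq> I \<Longrightarrow> (\<Sum>z\<in>F. (cmod (cinner h (u z)))\<^sup>2)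
      \<le> A * (norm h)\<^sup>2"
    and a: "\<And>F. finite F \<Longrightarrow> F \<subseteq> I \<Longrightarrow> (\<Sum>z\<in>F. (cmod (a z))\<^sup>2) \<le> M"
  shows "(\<lambda>z. a z *\<^sub>c u z) summable_on I"
proof -
  let ?f = "\<lambda>z. a z *\<^sub>c u z"
  have "(\<lambda>z. (cmod (a z))\<^sup>2) summable_on I"
    by (rule nonneg_bdd_above_summable_on) (use a in \<open>auto intro!: bdd_aboveI[of _ M]\<close>)
  then obtain L where L: "((\<lambda>z. (cmod (a z))\<^sup>2) has_sum L) I" by (auto simp: summable_on_def)
  have "\<exists>P. eventually P (finite_subsets_at_top I) \<and>
              (\<forall>F F'. P F \<and> P F' \<longrightarrow> dist (sum ?f F) (sum ?f F') < e)" if e: "e > 0" for e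
  proof -
    \<comment> \<open>Chosen so that A d \<le> (e/4)^2; the summand 1 covers A = 0.\<close>
    define d where "d = (e/4)\<^sup>2 / (A + 1)"
    have d: "d > 0" using e A by (simp add: d_def)
    from has_sum_finite_approximation[OF L d] obtain F0 where F0: "finite F0" "F0 \<subseteq> I"
      and close: "dist (\<Sum>z\<in>F0. (cmod (a z))\<^sup>2) L \<le> d" by auto
    have small: "dist (sum ?f F) (sum ?f F0) < e/2" if F: "finite F" "F \<subseteq> I" "F0 \<subseteq> F" for F
    proof -
      have "(\<Sum>z\<in>F. (cmod (a z))\<^sup>2) \<le> L"
        using L F by (intro finite_sum_le_has_sum[OF L]) auto
      then have le: "(\<Sum>z\<in>F - F0. (cmod (a z))\<^sup>2) \<le> d"
        using close F F0 by (simp add: sum_diff dist_real_def)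
      have "dist (sum ?f F) (sum ?f F0) = norm (sum ?f (F - F0))"
        using F F0 by (simp add: sum_diff dist_norm)
      moreover have "(norm (sum ?f (F - F0)))\<^sup>2 \<le> A * (\<Sum>z\<in>F - F0. (cmod (a z))\<^sup>2)"
        by (rule bessel_sum_bound[OF A]) (use F bes in blast)
      moreover have "A * (\<Sum>z\<in>F - F0. (cmod (a z))\<^sup>2) \<le> A * d" by (intro mult_left_mono le A)
      moreover have "A * d \<le> (e/4)\<^sup>2" using A by (simp add: d_def field_simps)
      ultimately have "(dist (sum ?f F) (sum ?f F0))\<^sup>2 \<le> (e/4)\<^sup>2" by simp
      then have "dist (sum ?f F) (sum ?f F0) \<le> e/4" using e by (simp add: power2_le_iff_abs_le)
      then show ?thesis using e by simp
    qed
    define P where "P F \<longleftrightarrow> finite F \<and> F \<subseteq> I \<and> F0 \<subseteq> F" for F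
    have "eventually P (finite_subsets_at_top I)"
      unfolding P_def eventually_finite_subsets_at_top using F0 by blast
    moreover have "dist (sum ?f F) (sum ?f F') < e" if "P F" "P F'" for F F'
    proof (rule dist_triangle_half_l[of _ "sum ?f F0"])
      show "dist (sum ?f F) (sum ?f F0) < e / 2" "dist (sum ?f F') (sum ?f F0) < e / 2"
        using that small unfolding P_def by blast+
    qed
    ultimately show ?thesis by blast
  qed
  then have "cauchy_filter (filtermap (sum ?f) (finite_subsets_at_top I))"
    by (simp add: cauchy_filter_metric_filtermap)
  moreover have "complete (UNIV :: 'n bergman set)"
    by (meson Cauchy_convergent UNIV_I complete_def convergent_def)
  ultimately obtain L' where "(sum ?f \<longlongrightarrow> L') (finite_subsets_at_top I)"
    using complete_uniform[where S = UNIV] by (force simp add: filterlim_def)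
  then show ?thesis
    using summable_on_def has_sum_def by blast
qed

text \<open>The Bessel bound for \<open>v\<close> and boundedness of \<open>c\<close> give square
  summable coefficients, and the Bessel bound for \<open>u\<close> sums them. The operator norm is
  at most the coefficient bound times \<open>A\<close>.\<close>

lemma bessel_operator:
  fixes u v :: "'i \<Rightarrow> 'n::finite bergman"
  assumes A: "0 \<le> A"
    and u: "\<And>h F. finite F \<Longrightarrow> F \<subseteq> I \<Longrightarrow> (\<Sum>z\<in>F. (cmod (cinner h (u z)))\<^sup>2) \<le> A * (norm h)\<^sup>2"
    and v: "\<And>h F. finite F \<Longrightarrow> F \<subseteq> I \<Longrightarrow> (\<Sum>z\<in>F. (cmod (cinner h (v z)))\<^sup>2) \<le> A * (norm h)\<^sup>2"
    and c: "\<And>z. z \<in> I \<Longrightarrow> cmod (c z) \<le> B"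
  obtains T :: "'n bergman \<Rightarrow>\<^sub>L 'n bergman"
    where "\<And>h. ((\<lambda>z. c z *\<^sub>c (cinner h (v z) *\<^sub>c u z)) has_sum blinfun_apply T h) I"
proof -
  \<comment> \<open>If \<open>I\<close> is empty, \<open>B\<close> may be negative.\<close>
  define B' where "B' = max B 0"
  have B': "B' \<ge> 0" "\<And>z. z \<in> I \<Longrightarrow> cmod (c z) \<le> B'" using c
    by (auto simp: B'_def intro: max.coboundedI1)
  have cc: "a *\<^sub>c (b *\<^sub>c f) = (a * b) *\<^sub>c f" for a b and f :: "'n bergman"
    by (rule bergman_eqI) (simp add: cscale.rep_eq)
  have coef: "(\<Sum>z\<in>F. (cmod (c z * cinner h (v z)))\<^sup>2) \<le> B'\<^sup>2 * (A * (norm h)\<^sup>2)"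
    if F: "finite F" "F \<subseteq> I" for F h
  proof -
    have "(\<Sum>z\<in>F. (cmod (c z * cinner h (v z)))\<^sup>2) \<le> (\<Sum>z\<in>F. B'\<^sup>2 * (cmod (cinner h (v z)))\<^sup>2)"
      unfolding norm_mult power_mult_distrib using F B'
        by (intro sum_mono mult_right_mono power_mono) auto
    also have "\<dots> \<le> B'\<^sup>2 * (A * (norm h)\<^sup>2)"
      unfolding sum_distrib_left[symmetric] by (intro mult_left_mono v F) simp
    finally show ?thesis .
  qed
  define t where "t h = (\<Sum>\<^sub>\<infinity>z\<in>I. (c z * cinner h (v z)) *\<^sub>c u z)" for h
  have t: "((\<lambda>z. (c z * cinner h (v z)) *\<^sub>c u z) has_sum t h) I" for h
    unfolding t_def using bessel_summable[OF A u coef] by (simp add: has_sum_infsum)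
  have "bounded_linear t"
  proof (rule bounded_linear_intro[where K = "B' * A"])
    fix h k :: "'n bergman" and r :: real
    have "(c z * cinner (h + k) (v z)) *\<^sub>c u z
        = (c z * cinner h (v z)) *\<^sub>c u z + (c z * cinner k (v z)) *\<^sub>c u z" for z
      by (rule bergman_eqI) (simp add: cscale.rep_eq plus_bergman.rep_eq cinner_add_left
        distrib_left distrib_right)
    then have "((\<lambda>z. (c z * cinner (h + k) (v z)) *\<^sub>c u z) has_sum (t h + t k)) I"
      using has_sum_add[OF t[of h] t[of k]] by presburger
    then show "t (h + k) = t h + t k" using t[of "h + k"] has_sum_unique by blast
    have "(c z * cinner (r *\<^sub>R h) (v z)) *\<^sub>c u z = r *\<^sub>R ((c z * cinner h (v z)) *\<^sub>c u z)" for z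
      by (rule bergman_eqI) (simp add: cscale.rep_eq scaleR_eq_cscale cinner_cscale_left mult_ac)
    then have "((\<lambda>z. (c z * cinner (r *\<^sub>R h) (v z)) *\<^sub>c u z) has_sum (r *\<^sub>R t h)) I"
      using has_sum_scaleR[OF t[of h], of r] by presburger
    then show "t (r *\<^sub>R h) = r *\<^sub>R t h" using t[of "r *\<^sub>R h"] has_sum_unique by blast
    have "norm (t h) \<le> B' * A * norm h"
    proof (rule tendsto_upperbound)
      show "((\<lambda>F. norm (\<Sum>z\<in>F. (c z * cinner h (v z)) *\<^sub>c u z)) \<longlongrightarrow> norm (t h))
          (finite_subsets_at_top I)"
        using t[of h] unfolding has_sum_def by (rule tendsto_norm)
      show "\<forall>\<^sub>F F in finite_subsets_at_top I. norm (\<Sum>z\<in>F. (c z * cinner h (v z)) *\<^sub>c u z)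
          \<le> B' * A * norm h"
      proof (rule eventually_finite_subsets_at_top_weakI)
        fix F assume F: "finite F" "F \<subseteq> I"
        have "(norm (\<Sum>z\<in>F. (c z * cinner h (v z)) *\<^sub>c u z))\<^sup>2
            \<le> A * (\<Sum>z\<in>F. (cmod (c z * cinner h (v z)))\<^sup>2)"
          by (rule bessel_sum_bound[OF A u[OF F]])
        also have "\<dots> \<le> A * (B'\<^sup>2 * (A * (norm h)\<^sup>2))" by (intro mult_left_mono coef F A)
        also have "\<dots> = (B' * A * norm h)\<^sup>2" by (simp add: power2_eq_square mult_ac)
        finally show "norm (\<Sum>z\<in>F. (c z * cinner h (v z)) *\<^sub>c u z) \<le> B' * A * norm h"
          by (rule power2_le_imp_le) (use A B' in auto)
      qed
    qed simp
    then show "norm (t h) \<le> norm h * (B' * A)" by (simp add: mult_ac)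
  qed
  then have "((\<lambda>z. c z *\<^sub>c (cinner h (v z) *\<^sub>c u z)) has_sum blinfun_apply (Blinfun t) h) I" for h
    using t[of h] by (simp add: bounded_linear_Blinfun_apply cc)
  then show ?thesis using that by blast
qed

subsection \<open>Separated sets\<close>

lemma beta_eq_artanh: "beta u v = artanh (cmod (phi u v))"
  by (simp add: beta_def artanh_def)

lemma artanh_less_iff:
  fixes s t :: real
  assumes "0 \<le> s" "s < 1" "0 \<le> t" "t < 1"
  shows "artanh s < artanh t \<longleftrightarrow> s < t"
proof -
  have "artanh s < artanh t \<longleftrightarrow> (1 + s) / (1 - s) < (1 + t) / (1 - t)"
    unfolding artanh_def using assms by (simp add: ln_less_cancel_iff)
  also have "\<dots> \<longleftrightarrow> (1 + s) * (1 - t) < (1 + t) * (1 - s)"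
    using assms by (simp add: divide_simps)
  also have "\<dots> \<longleftrightarrow> s < t" by (simp add: algebra_simps)
  finally show ?thesis .
qed

lemma artanh_nonneg: "0 \<le> t \<Longrightarrow> t < 1 \<Longrightarrow> 0 \<le> artanh (t :: real)"
  using artanh_less_iff[of t 0] by simp

lemma phi_denom_nonzero:
  assumes "cmod u < 1" "cmod v < 1"
  shows "1 - v * cnj u \<noteq> 0"
  using disc_kernel_denom_ge[of u v] assms by (auto simp: mult.commute)

text \<open>With squared moduli written as products with conjugates, |1 - v cnj u|^2 - |u - v|^2 =
  (1 - |u|^2)(1 - |v|^2) is a plain expansion.\<close>

lemma one_minus_phi_square:
  assumes u: "cmod u < 1" and v: "cmod v < 1"
  shows "1 - (cmod (phi u v))\<^sup>2 = (1 - (cmod u)\<^sup>2) * (1 - (cmod v)\<^sup>2) / (cmod (1 - v * cnj u))\<^sup>2"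
proof -
  have nz: "1 - v * cnj u \<noteq> 0" by (rule phi_denom_nonzero[OF u v])
  have "complex_of_real ((cmod (1 - v * cnj u))\<^sup>2 - (cmod (u - v))\<^sup>2)
      = of_real ((1 - (cmod u)\<^sup>2) * (1 - (cmod v)\<^sup>2))"
    unfolding of_real_diff of_real_mult complex_norm_square of_real_1 by (simp add: algebra_simps)
  then have "(cmod (1 - v * cnj u))\<^sup>2 - (cmod (u - v))\<^sup>2 = (1 - (cmod u)\<^sup>2) * (1 - (cmod v)\<^sup>2)"
    by (simp only: of_real_eq_iff)
  then show ?thesis
    using nz by (simp add: phi_def norm_divide power_divide field_simps)
qed

lemma norm_phi_less_1:
  assumes u: "cmod u < 1" and v: "cmod v < 1"
  shows "cmod (phi u v) < 1"
proof -
  have "0 < (1 - (cmod u)\<^sup>2) * (1 - (cmod v)\<^sup>2) / (cmod (1 - v * cnj u))\<^sup>2"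
    using phi_denom_nonzero[OF u v] u v by (intro divide_pos_pos mult_pos_pos)
      (auto simp: abs_square_less_1)
  then have "(cmod (phi u v))\<^sup>2 < 1" using one_minus_phi_square[OF u v] by simp
  then show ?thesis by (simp add: abs_square_less_1)
qed

lemma beta_nonneg: "cmod u < 1 \<Longrightarrow> cmod v < 1 \<Longrightarrow> 0 \<le> beta u v"
  unfolding beta_eq_artanh by (intro artanh_nonneg norm_phi_less_1) auto

lemma phi_involution:
  assumes u: "cmod u < 1" and v: "cmod v < 1"
  shows "phi u (phi u v) = v"
proof -
  have nz: "1 - v * cnj u \<noteq> 0" by (rule phi_denom_nonzero[OF u v])
  have nz2: "1 - u * cnj u \<noteq> 0" by (rule phi_denom_nonzero[OF u u])
  have "u - phi u v = v * (1 - u * cnj u) / (1 - v * cnj u)"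
    using nz by (simp add: phi_def field_simps)
  moreover have "1 - phi u v * cnj u = (1 - u * cnj u) / (1 - v * cnj u)"
    using nz by (simp add: phi_def field_simps)
  ultimately show ?thesis
    using nz nz2 unfolding phi_def[of u "phi u v"] by simp
qed

lemma phi_zero [simp]: "phi u 0 = u"
  by (simp add: phi_def)

text \<open>Put d = |1 - v cnj u|. Both distances to the boundary are at most d, while the identity
  for 1 - |\<phi>|^2 bounds d^2 by \<kappa> times their product. The 4 in \<kappa> comes from using
  1 - |w|^2 \<le> 2 (1 - |w|) twice.\<close>

lemma phi_comparable:
  assumes u: "cmod u < 1" and v: "cmod v < 1" and t: "cmod (phi u v) \<le> t" "t < 1"
  defines "\<kappa> \<equiv> 4 / (1 - t\<^sup>2)"
  shows "1 - cmod v \<le> \<kappa> * (1 - cmod u)" "1 - cmod u \<le> \<kappa> * (1 - cmod v)"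
    "cmod (v - u) \<le> \<kappa> * t * (1 - cmod u)"
proof -
  define d where "d = cmod (1 - v * cnj u)"
  have t0: "0 \<le> t" using t(1) norm_ge_zero order_trans by blast
  have t2: "0 < 1 - t\<^sup>2" using t t0 by (simp add: abs_square_less_1)
  have du: "1 - cmod u \<le> d" using disc_kernel_denom_ge[of v u] u v complex_mod_cnj[of "1
      - v * cnj u"]
    by (simp add: d_def mult.commute)
  have dv: "1 - cmod v \<le> d" using disc_kernel_denom_ge[of u v] u v by (simp add: d_def mult.commute)
  have d: "d > 0" using du u by simp
  have sq: "1 - (cmod w)\<^sup>2 \<le> 2 * (1 - cmod w)" for w :: complex
    using zero_le_power2[of "cmod w - 1"] by (simp add: power2_diff)
  have "1 - t\<^sup>2 \<le> 1 - (cmod (phi u v))\<^sup>2"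
    using t t0 by (simp add: power_mono)
  also have "\<dots> = (1 - (cmod u)\<^sup>2) * (1 - (cmod v)\<^sup>2) / d\<^sup>2"
    unfolding d_def by (rule one_minus_phi_square[OF u v])
  also have "\<dots> \<le> (2 * (1 - cmod u)) * (2 * (1 - cmod v)) / d\<^sup>2"
    using u v by (intro divide_right_mono mult_mono sq) (auto simp: abs_square_le_1)
  finally have main: "(1 - t\<^sup>2) * d\<^sup>2 \<le> 4 * ((1 - cmod u) * (1 - cmod v))"
    using d by (simp add: field_simps)
  then have main': "d\<^sup>2 \<le> \<kappa> * ((1 - cmod u) * (1 - cmod v))"
    using t2 by (simp add: \<kappa>_def field_simps)
  have "(1 - cmod v) * (1 - cmod v) \<le> d\<^sup>2"
    unfolding power2_eq_square using dv v by (intro mult_mono) auto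
  also note main'
  finally show vu: "1 - cmod v \<le> \<kappa> * (1 - cmod u)"
    using v by (simp add: mult.assoc[symmetric])
  have "(1 - cmod u) * (1 - cmod u) \<le> d\<^sup>2"
    unfolding power2_eq_square using du u by (intro mult_mono) auto
  also note main'
  also have "\<kappa> * ((1 - cmod u) * (1 - cmod v)) = \<kappa> * (1 - cmod v) * (1 - cmod u)" by simp
  finally show "1 - cmod u \<le> \<kappa> * (1 - cmod v)"
    using u by simp
  have \<kappa>0: "\<kappa> > 0" using t2 by (simp add: \<kappa>_def)
  have "d\<^sup>2 \<le> \<kappa> * ((1 - cmod u) * (\<kappa> * (1 - cmod u)))"
    using main' vu u \<kappa>0 by (meson diff_ge_0_iff_ge less_imp_le mult_left_mono order_trans)
  also have "\<dots> = (\<kappa> * (1 - cmod u))\<^sup>2" by (simp add: power2_eq_square)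
  finally have "d \<le> \<kappa> * (1 - cmod u)"
    by (rule power2_le_imp_le) (use \<kappa>0 u in auto)
  moreover have "cmod (v - u) = cmod (phi u v) * d"
    using d by (simp add: phi_def norm_divide d_def norm_minus_commute)
  ultimately have "cmod (v - u) \<le> t * (\<kappa> * (1 - cmod u))"
    using t t0 d by (auto intro: mult_mono)
  then show "cmod (v - u) \<le> \<kappa> * t * (1 - cmod u)" by (simp add: mult_ac)
qed

lemma polydist_le_imp_phi:
  assumes z: "z \<in> polydisk" and w: "w \<in> polydisk" and d: "polydist z w \<le> artanh t"
    and t: "0 \<le> t" "t < 1"
  shows "cmod (phi (z $ i) (w $ i)) \<le> t"
proof -
  have lt: "cmod (z $ i) < 1" "cmod (w $ i) < 1" for i using z w by (auto simp: polydisk_def)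
  have "beta (z $ i) (w $ i) \<le> polydist z w"
    unfolding polydist_def by (rule member_le_sum) (auto intro: beta_nonneg lt)
  then have "artanh (cmod (phi (z $ i) (w $ i))) \<le> artanh t" using d by (simp add: beta_eq_artanh)
  then have "\<not> t < cmod (phi (z $ i) (w $ i))"
    using artanh_less_iff[OF t, of "cmod (phi (z $ i) (w $ i))"] norm_phi_less_1[OF lt] by auto
  then show ?thesis by simp
qed

text \<open>In each coordinate the denominator of \<phi> is at least 1 - |z_i|, so relative
  Euclidean distance below t forces |\<phi>| < t. The metric adds up n coordinates, each of which is
  allowed a / n.\<close>

lemma cell_subset_polyball:
  fixes z :: "complex ^ 'n::finite"
  assumes z: "z \<in> polydisk" and t: "0 \<le> t" "t < 1" and a: "artanh t \<le> a / CARD('n)"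
  shows "cell z t \<subseteq> polyball z a"
proof
  fix u assume u: "u \<in> cell z t"
  have upd: "u \<in> polydisk" using cell_subset_polydisk[OF z, of t] u t by auto
  have lt: "cmod (z $ i) < 1" "cmod (u $ i) < 1" for i using z upd by (auto simp: polydisk_def)
  have "beta (z $ i) (u $ i) < a / CARD('n)" for i
  proof -
    have "1 - cmod (z $ i) \<le> cmod (1 - u $ i * cnj (z $ i))"
      using kernel_denom_ge(1)[OF z upd] .
    moreover have "0 < 1 - cmod (z $ i)" using lt(1) by simp
    moreover have "cmod (z $ i - u $ i) < t * (1 - cmod (z $ i))"
      using u by (simp add: cell_def norm_minus_commute)
    ultimately have "cmod (z $ i - u $ i) < t * cmod (1 - u $ i * cnj (z $ i))" "0
        < cmod (1 - u $ i * cnj (z $ i))"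
      using t by (auto intro: less_le_trans mult_left_mono)
    then have "cmod (phi (z $ i) (u $ i)) < t"
      by (simp add: phi_def norm_divide divide_less_eq)
    then have "beta (z $ i) (u $ i) < artanh t"
      unfolding beta_eq_artanh using t norm_phi_less_1[OF lt] by (simp add: artanh_less_iff)
    then show ?thesis using a by simp
  qed
  then have "polydist z u < (\<Sum>i\<in>(UNIV :: 'n set). a / CARD('n))"
    unfolding polydist_def by (intro sum_strict_mono) auto
  then show "u \<in> polyball z a" using upd by (simp add: polyball_def)
qed

text \<open>Stated for \<open>lborel\<close> and arbitrary radii because volume comparisons involve
  cells of radius above 1, which may leave the polydisk.\<close>

lemma emeasure_lborel_cell:
  fixes w :: "complex ^ 'n::finite"
  assumes w: "w \<in> polydisk" and r: "0 \<le> r"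
  shows "emeasure lborel (cell w r) = ennreal ((pi * r\<^sup>2) ^ CARD('n) * cell_vol w)"
proof -
  have eq: "cell w r = {u. \<forall>i. u $ i \<in> ball (w $ i) (r * (1 - cmod (w $ i)))}"
    by (auto simp: cell_def dist_norm norm_minus_commute)
  have "emeasure lborel (cell w r) = (\<Prod>i\<in>UNIV. emeasure lborel (ball (w $ i) (r
      * (1 - cmod (w $ i)))))"
    unfolding eq by (rule emeasure_lborel_rect) simp
  also have "\<dots> = (\<Prod>i\<in>UNIV. ennreal (pi * r\<^sup>2 * (1 - cmod (w $ i))\<^sup>2))"
  proof (rule prod.cong)
    fix i :: 'n
    have "0 \<le> r * (1 - cmod (w $ i))" using r polydisk_gap_pos[OF w, of i] by simp
    then show "emeasure lborel (ball (w $ i) (r * (1 - cmod (w $ i))))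
        = ennreal (pi * r\<^sup>2 * (1 - cmod (w $ i))\<^sup>2)"
      by (simp add: emeasure_ball unit_ball_vol_2 power_mult_distrib mult.assoc)
  qed simp
  also have "\<dots> = ennreal (\<Prod>i\<in>UNIV. pi * r\<^sup>2 * (1 - cmod (w $ i))\<^sup>2)"
    by (rule prod_ennreal) simp
  also have "(\<Prod>i\<in>UNIV. pi * r\<^sup>2 * (1 - cmod (w $ i))\<^sup>2) = (pi * r\<^sup>2) ^ CARD('n) * cell_vol w"
    by (simp add: prod.distrib cell_vol_def)
  finally show ?thesis .
qed

text \<open>Points attached to those of \<Gamma> within pseudohyperbolic distance t in every
  coordinate. Bounds uniform over all such families allow the attached points to move with a
  parameter.\<close>

definition close_family ::
  "real \<Rightarrow> (complex ^ 'n) set \<Rightarrow> (complex ^ 'n \<Rightarrow> complex ^ 'n) \<Rightarrow> bool" where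
  "close_family t \<Gamma> w \<longleftrightarrow>
     (\<forall>z\<in>\<Gamma>. w z \<in> polydisk \<and> (\<forall>i. cmod (phi (z $ i) (w z $ i)) \<le> t))"

lemma close_familyD:
  "close_family t \<Gamma> w \<Longrightarrow> z \<in> \<Gamma> \<Longrightarrow>
     w z \<in> polydisk \<and> (\<forall>i. cmod (phi (z $ i) (w z $ i)) \<le> t)"
  by (simp add: close_family_def)

text \<open>Volume packing. If \<open>x\<close> lies in the cell of w(z), then the small cell around
  z lies in \<open>cell x R\<close> and its volume is not much smaller than
  \<open>cell_vol x\<close>. Separation makes these small cells disjoint, which limits their number.
  The bound depends on \<Gamma> and t but not on the family \<open>w\<close>.\<close>

lemma separated_overlap:
  fixes \<Gamma> :: "(complex ^ 'n::finite) set"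
  assumes sep: "separated_set \<Gamma>" and t: "0 \<le> t" "t < 1"
  obtains N :: real where "\<And>w x F. close_family t \<Gamma> w
     \<Longrightarrow> finite F \<Longrightarrow> F \<subseteq> \<Gamma> \<Longrightarrow> (\<Sum>z\<in>F. indicator (cell (w z) (3/4)) x) \<le> N"
proof -
  from sep obtain a where a: "a > 0" and \<Gamma>: "\<Gamma> \<subseteq> polydisk"
    and disj: "\<And>u v. u \<in> \<Gamma> \<Longrightarrow> v \<in> \<Gamma> \<Longrightarrow> u \<noteq> v \<Longrightarrow> polyball u a \<inter> polyball v a = {}"
    unfolding separated_set_def by blast
  have "0 \<le> a / CARD('n)" using a by simp
  \<comment> \<open>With this radius, cells around points of \<Gamma> lie in the hyperbolic balls of
    radius \<open>a\<close> and are therefore disjoint.\<close>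
  then obtain c where c: "0 \<le> c" "c < 1" "artanh c = a / CARD('n)"
    using that[of "tanh (a / CARD('n))"] by (simp add: tanh_real_lt_1 artanh_tanh_real)
  have "c \<noteq> 0" using c(3) a by auto
  then have c0: "0 < c" using c by simp
  define \<kappa> where "\<kappa> = 4 / (1 - t\<^sup>2)"
  have "0 < 1 - t\<^sup>2" using t by (simp add: abs_square_less_1)
  then have \<kappa>: "\<kappa> \<ge> 1" "\<kappa> > 0" using t by (auto simp: \<kappa>_def field_simps)
  \<comment> \<open>In units of 1 - |x_i|, the path from a point of \<open>cell z c\<close> to
    \<open>x\<close> costs 4 \<kappa> up to z, 4 \<kappa>^2 up to w(z) and 3 up to x.\<close>
  define R where "R = 3 + 4 * \<kappa>\<^sup>2 + 4 * \<kappa>"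
  have R: "R > 0" using \<kappa> by (simp add: R_def add_pos_nonneg)
  \<comment> \<open>(R / c)^2 is the ratio of squared radii and (2 \<kappa>)^2 compares
    \<open>cell_vol x\<close> with \<open>cell_vol z\<close>, both per coordinate.\<close>
  define N where "N = (R\<^sup>2 * (2 * \<kappa>)\<^sup>2 / c\<^sup>2) ^ CARD('n)"
  have "(\<Sum>z\<in>F. indicator (cell (w z) (3/4)) x) \<le> N"
    if cf: "close_family t \<Gamma> w" and F: "finite F" "F \<subseteq> \<Gamma>"
    for w x F
  proof (cases "{z \<in> F. x \<in> cell (w z) (3/4)} = {}")
    case True
    then have "(\<Sum>z\<in>F. indicator (cell (w z) (3/4)) x) = (0::real)"
      by (intro sum.neutral) (auto simp: indicator_def)
    then show ?thesis using \<kappa> R by (simp add: N_def)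
  next
    case False
    note w = close_familyD[OF cf]
    define G where "G = {z \<in> F. x \<in> cell (w z) (3/4)}"
    have G: "finite G" "G \<subseteq> F" "G \<noteq> {}" using F False by (auto simp: G_def)
    obtain z0 where z0: "z0 \<in> G" using G by blast
    have "x \<in> cell (w z0) (3/4)" "w z0 \<in> polydisk" using z0 w F by (auto simp: G_def)
    then have x: "x \<in> polydisk" using cell_subset_polydisk[of "w z0" "3/4"] by auto
    have rel: "1 - cmod (x $ i) \<le> 2 * \<kappa> * (1 - cmod (z $ i))"
      "cell z c \<subseteq> cell x R" if z: "z \<in> G" for z i
    proof -
      have zpd: "z \<in> polydisk" and wpd: "w z \<in> polydisk"
        and ph: "\<And>i. cmod (phi (z $ i) (w z $ i)) \<le> t"
        and xc: "x \<in> cell (w z) (3/4)"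
        using z G F \<Gamma> w by (auto simp: G_def)
      have zi: "cmod (z $ i) < 1" and wi: "cmod (w z $ i) < 1" for i using zpd wpd
        by (auto simp: polydisk_def)
      note cmp = phi_comparable[OF zi wi ph t(2), folded \<kappa>_def]
      have xw: "1 - cmod (x $ i) \<le> 2 * (1 - cmod (w z $ i))" "1 - cmod (w z $ i)
          \<le> 4 * (1 - cmod (x $ i))" for i
        using cell_gap_le[OF xc, of i] wi[of i] by auto
      have "1 - cmod (x $ i) \<le> 2 * (\<kappa> * (1 - cmod (z $ i)))" for i
        by (rule order_trans[OF xw(1)]) (use cmp(1)[of i] in simp)
      then show "1 - cmod (x $ i) \<le> 2 * \<kappa> * (1 - cmod (z $ i))" by (simp add: mult_ac)
      show "cell z c \<subseteq> cell x R"
      proof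
        fix u assume u: "u \<in> cell z c"
        have "cmod (u $ i - x $ i) < R * (1 - cmod (x $ i))" for i
        proof -
          let ?d = "1 - cmod (x $ i)"
          have d: "?d > 0" using polydisk_gap_pos[OF x] .
          have zx: "1 - cmod (z $ i) \<le> \<kappa> * (4 * ?d)"
            using cmp(2)[of i] xw(2)[of i] \<kappa> by (meson less_imp_le mult_left_mono order_trans)
          have 1: "cmod (u $ i - z $ i) < \<kappa> * (4 * ?d)"
          proof -
            have "cmod (u $ i - z $ i) < c * (1 - cmod (z $ i))" using u by (simp add: cell_def)
            also have "\<dots> \<le> 1 * (1 - cmod (z $ i))" using c zi[of i] by (intro mult_right_mono) auto
            also have "\<dots> \<le> \<kappa> * (4 * ?d)" using zx by simp
            finally show ?thesis .
          qed
          have 2: "cmod (w z $ i - z $ i) \<le> \<kappa> * (\<kappa> * (4 * ?d))"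
          proof -
            have "cmod (w z $ i - z $ i) \<le> \<kappa> * t * (1 - cmod (z $ i))" by (rule cmp(3))
            also have "\<dots> \<le> \<kappa> * 1 * (1 - cmod (z $ i))"
              using t \<kappa> zi[of i] by (intro mult_right_mono mult_left_mono) auto
            also have "\<dots> \<le> \<kappa> * (\<kappa> * (4 * ?d))" using zx \<kappa> by (simp add: mult_left_mono)
            finally show ?thesis .
          qed
          have 3: "cmod (x $ i - w z $ i) \<le> 3 * ?d"
          proof -
            have "cmod (x $ i - w z $ i) < 3/4 * (1 - cmod (w z $ i))" using xc
              by (simp add: cell_def)
            then show ?thesis using xw(2)[of i] by simp
          qed
          have split: "u $ i - x $ i = (u $ i - z $ i) - (w z $ i - z $ i) - (x $ i - w z $ i)"
            by simp
          have "cmod (u $ i - x $ i) \<le> cmod (u $ i - z $ i) + cmod (w z $ i - z $ i)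
              + cmod (x $ i - w z $ i)"
            unfolding split using norm_triangle_ineq4[of "(u $ i - z $ i)
                - (w z $ i - z $ i)" "x $ i - w z $ i"]
              norm_triangle_ineq4[of "u $ i - z $ i" "w z $ i - z $ i"] by linarith
          also have "\<dots> < \<kappa> * (4 * ?d) + \<kappa> * (\<kappa> * (4 * ?d)) + 3 * ?d" using 1 2 3 by linarith
          also have "\<dots> = R * ?d" by (simp add: R_def power2_eq_square algebra_simps)
          finally show ?thesis .
        qed
        then show "u \<in> cell x R" by (simp add: cell_def)
      qed
    qed
    have zpd: "z \<in> polydisk" if "z \<in> G" for z using that G F \<Gamma> by auto
    have dj: "disjoint_family_on (\<lambda>z. cell z c) G"
      unfolding disjoint_family_on_def
    proof (intro ballI impI)
      fix u v assume "u \<in> G" "v \<in> G" "u \<noteq> v"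
      then show "cell u c \<inter> cell v c = {}"
        using disj[of u v] cell_subset_polyball[OF zpd c(1,2), of u a]
          cell_subset_polyball[OF zpd c(1,2), of v a] c(3) G F
        by auto
    qed
    have "ennreal (\<Sum>z\<in>G. (pi * c\<^sup>2) ^ CARD('n) * cell_vol z) = (\<Sum>z\<in>G. emeasure lborel (cell z c))"
      using cell_vol_pos[OF zpd] by (subst sum_ennreal[symmetric])
        (auto simp: emeasure_lborel_cell[OF zpd c(1)] less_imp_le)
    also have "\<dots> = emeasure lborel (\<Union>z\<in>G. cell z c)"
      by (rule sum_emeasure) (use G dj in auto)
    also have "\<dots> \<le> emeasure lborel (cell x R)"
      by (rule emeasure_mono) (use rel(2) in auto)
    also have "\<dots> = ennreal ((pi * R\<^sup>2) ^ CARD('n) * cell_vol x)"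
      by (rule emeasure_lborel_cell[OF x]) (use R in simp)
    finally have le: "(\<Sum>z\<in>G. (pi * c\<^sup>2) ^ CARD('n) * cell_vol z)
        \<le> (pi * R\<^sup>2) ^ CARD('n) * cell_vol x"
      using cell_vol_pos[OF x] R by (simp add: ennreal_le_iff)
    have "card G * ((pi * c\<^sup>2) ^ CARD('n) * cell_vol x)
        = (\<Sum>z\<in>G. (pi * c\<^sup>2) ^ CARD('n) * cell_vol x)" by simp
    also have "\<dots> \<le> (\<Sum>z\<in>G. (pi * c\<^sup>2) ^ CARD('n) * (((2 * \<kappa>)\<^sup>2) ^ CARD('n) * cell_vol z))"
      using rel(1) by (intro sum_mono mult_left_mono cell_vol_mono_factor x) auto
    also have "\<dots> = ((2 * \<kappa>)\<^sup>2) ^ CARD('n) * (\<Sum>z\<in>G. (pi * c\<^sup>2) ^ CARD('n) * cell_vol z)"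
      by (simp add: sum_distrib_left mult_ac)
    also have "\<dots> \<le> ((2 * \<kappa>)\<^sup>2) ^ CARD('n) * ((pi * R\<^sup>2) ^ CARD('n) * cell_vol x)"
      by (intro mult_left_mono le) simp
    also have "\<dots> = N * ((pi * c\<^sup>2) ^ CARD('n) * cell_vol x)"
      using c0 by (simp add: N_def power_mult_distrib power_divide)
    finally have "real (card G) \<le> N"
      using c0 cell_vol_pos[OF x] by (simp only: mult_le_cancel_right) auto
    moreover have "(\<Sum>z\<in>F. indicator (cell (w z) (3/4)) x) = real (card G)"
      using F by (simp add: indicator_def G_def sum.If_cases Int_def of_bool_def)
    ultimately show ?thesis by simp
  qed
  then show ?thesis using that by blast
qed

lemma norm_cinner_kernel_square_le:
  fixes w :: "complex ^ 'n::finite"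
  assumes w: "w \<in> polydisk"
  shows "(cmod (cinner h (kernel w)))\<^sup>2 \<le> 4 ^ CARD('n) * (cell_vol w * (cmod (bergman_fun h w))\<^sup>2)"
proof -
  have "(\<Prod>i\<in>UNIV. 1 - (cmod (w $ i))\<^sup>2)\<^sup>2 \<le> 4 ^ CARD('n) * cell_vol w"
  proof -
    have "(\<Prod>i\<in>UNIV. 1 - (cmod (w $ i))\<^sup>2)\<^sup>2 = (\<Prod>i\<in>UNIV. (1 - (cmod (w $ i))\<^sup>2)\<^sup>2)"
      by (rule prod_power_distrib)
    also have "\<dots> \<le> (\<Prod>i\<in>UNIV. 4 * (1 - cmod (w $ i))\<^sup>2)"
    proof (intro prod_mono conjI)
      fix i :: 'n
      have w1: "cmod (w $ i) < 1" using w by (simp add: polydisk_def)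
      then have p: "0 \<le> 1 - (cmod (w $ i))\<^sup>2" by (simp add: abs_square_le_1)
      have "1 - (cmod (w $ i))\<^sup>2 \<le> 2 * (1 - cmod (w $ i))"
        using zero_le_power2[of "cmod (w $ i) - 1"] by (simp add: power2_diff)
      then have "(1 - (cmod (w $ i))\<^sup>2)\<^sup>2 \<le> (2 * (1 - cmod (w $ i)))\<^sup>2" by (rule power_mono[OF _ p])
      then show "(1 - (cmod (w $ i))\<^sup>2)\<^sup>2 \<le> 4 * (1 - cmod (w $ i))\<^sup>2" unfolding power_mult_distrib
        by simp
    qed simp
    also have "\<dots> = 4 ^ CARD('n) * cell_vol w" by (simp add: prod.distrib cell_vol_def)
    finally show ?thesis .
  qed
  then have "(\<Prod>i\<in>UNIV. 1 - (cmod (w $ i))\<^sup>2)\<^sup>2 * (cmod (bergman_fun h w))\<^sup>2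
      \<le> 4 ^ CARD('n) * cell_vol w * (cmod (bergman_fun h w))\<^sup>2"
    by (rule mult_right_mono) simp
  then show ?thesis
    unfolding cinner_kernel[OF w] norm_mult norm_of_real power_mult_distrib power2_abs
      by (simp add: mult.assoc)
qed

text \<open>The mean value inequality bounds each term by the mass of a cell, and the overlap count
  adds up the masses. \<open>K\<close> serves every close family, which later gives bounds uniform
  in the deformation parameter.\<close>

lemma separated_carleson:
  fixes \<Gamma> :: "(complex ^ 'n::finite) set"
  assumes sep: "separated_set \<Gamma>" and t: "0 \<le> t" "t < 1"
  obtains K :: real where "0 \<le> K" "\<And>w h F. close_family t \<Gamma> w
     \<Longrightarrow> finite F \<Longrightarrow> F \<subseteq> \<Gamma> \<Longrightarrow> (\<Sum>z\<in>F. cell_vol (w z) * (cmod (bergman_fun h (w z)))\<^sup>2) \<le> K * (norm h)\<^sup>2"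
proof -
  obtain N :: real where N: "\<And>w x F. close_family t \<Gamma> w
     \<Longrightarrow> finite F \<Longrightarrow> F \<subseteq> \<Gamma> \<Longrightarrow> (\<Sum>z\<in>F. indicator (cell (w z) (3/4)) x) \<le> N"
    using separated_overlap[OF sep t] by blast
  show ?thesis
  proof
    show "0 \<le> 4 ^ CARD('n) * \<bar>N\<bar>" by simp
    fix w h F
    assume cf: "close_family t \<Gamma> w"
      and F: "finite F" "F \<subseteq> \<Gamma>"
    note w = close_familyD[OF cf]
    have "(\<Sum>z\<in>F. cell_vol (w z) * (cmod (bergman_fun h (w z)))\<^sup>2)
        \<le> (\<Sum>z\<in>F. 4 ^ CARD('n) * (1 * local_mass h (cell (w z) (3/4))))"
    proof (rule sum_mono)
      fix z assume "z \<in> F"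
      then have wz: "w z \<in> polydisk" using w F by blast
      have "cell_vol (w z) * (cmod (bergman_fun h (w z)))\<^sup>2
          \<le> 4 ^ CARD('n) * local_mass h (cell (w z) (1/2))"
        by (rule cell_mean_value[OF wz])
      also have "\<dots> \<le> 4 ^ CARD('n) * local_mass h (cell (w z) (3/4))"
        by (intro mult_left_mono local_mass_mono cell_mono wz) auto
      finally show "cell_vol (w z) * (cmod (bergman_fun h (w z)))\<^sup>2
          \<le> 4 ^ CARD('n) * (1 * local_mass h (cell (w z) (3/4)))" by simp
    qed
    also have "\<dots> = 4 ^ CARD('n) * (\<Sum>z\<in>F. 1 * local_mass h (cell (w z) (3/4)))"
      by (simp add: sum_distrib_left)
    also have "\<dots> \<le> 4 ^ CARD('n) * (N * (norm h)\<^sup>2)"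
      by (intro mult_left_mono sum_local_mass_le) (use N[OF cf F] in auto)
    also have "\<dots> \<le> 4 ^ CARD('n) * (\<bar>N\<bar> * (norm h)\<^sup>2)"
      by (intro mult_left_mono mult_right_mono) auto
    finally show "(\<Sum>z\<in>F. cell_vol (w z) * (cmod (bergman_fun h (w z)))\<^sup>2)
        \<le> 4 ^ CARD('n) * \<bar>N\<bar> * (norm h)\<^sup>2"
      by (simp add: mult.assoc)
  qed
qed

subsection \<open>Quadrature of symbols\<close>

text \<open>Turns unordered sums into limits of sequences, for which limits of measurable functions
  and dominated convergence are available.\<close>

lemma countable_exhaustion:
  fixes J :: "'j set"
  assumes "countable J"
  obtains S :: "nat \<Rightarrow> 'j set" where "\<And>n. finite (S n)" "\<And>n. S n \<subseteq> J"
    "filterlim S (finite_subsets_at_top J) sequentially"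
proof
  define S where "S n = {j \<in> J. to_nat_on J j < n}" for n
  have inj: "inj_on (to_nat_on J) J" by (rule inj_on_to_nat_on[OF assms])
  show fin: "finite (S n)" for n
    by (rule inj_on_finite[of "to_nat_on J" _ "{..<n}"]) (use inj in \<open>auto simp: S_def inj_on_def\<close>)
  show "S n \<subseteq> J" for n by (auto simp: S_def)
  show "filterlim S (finite_subsets_at_top J) sequentially"
    unfolding filterlim_finite_subsets_at_top
  proof (intro allI impI)
    fix X assume X: "finite X \<and> X \<subseteq> J"
    then have "finite (to_nat_on J ` X)" by simp
    then obtain n where n: "to_nat_on J ` X \<subseteq> {..<n}" by (auto simp: finite_nat_set_iff_bounded)
    show "\<forall>\<^sub>F y in sequentially. finite (S y) \<and> X \<subseteq> S y \<and> S y \<subseteq> J"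
      using eventually_ge_at_top[of n]
      by (rule eventually_mono) (use X n fin in \<open>auto simp: S_def\<close>)
  qed
qed

lemma borel_measurable_has_sum:
  fixes F :: "'j \<Rightarrow> 'a \<Rightarrow> complex"
  assumes J: "countable J" and F: "\<And>j. j \<in> J \<Longrightarrow> F j \<in> borel_measurable M"
    and f: "\<And>x. ((\<lambda>j. F j x) has_sum f x) J"
  shows "f \<in> borel_measurable M"
proof -
  obtain S where S: "\<And>n. finite (S n)" "\<And>n. S n \<subseteq> J"
    "filterlim S (finite_subsets_at_top J) sequentially"
    using countable_exhaustion[OF J] by blast
  show ?thesis
  proof (rule borel_measurable_LIMSEQ_metric)
    show "(\<lambda>x. \<Sum>j\<in>S n. F j x) \<in> borel_measurable M" for n
      using S F by (intro borel_measurable_sum) blast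
    show "(\<lambda>n. \<Sum>j\<in>S n. F j x) \<longlonglongrightarrow> f x" for x
      using filterlim_compose[OF f[of x, unfolded has_sum_def] S(3)] .
  qed
qed

lemma has_sum_integral:
  fixes F :: "'j \<Rightarrow> 'a \<Rightarrow> complex"
  assumes J: "countable J" and F: "\<And>j. j \<in> J \<Longrightarrow> integrable M (F j)"
    and f: "\<And>x. ((\<lambda>j. F j x) has_sum f x) J"
    and G: "integrable M G" and bd: "\<And>S x. finite S \<Longrightarrow> S \<subseteq> J \<Longrightarrow> (\<Sum>j\<in>S. cmod (F j x)) \<le> G x"
  shows "((\<lambda>j. LINT x|M. F j x) has_sum (LINT x|M. f x)) J"
proof -
  obtain S where S: "\<And>n. finite (S n)" "\<And>n. S n \<subseteq> J"
    "filterlim S (finite_subsets_at_top J) sequentially"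
    using countable_exhaustion[OF J] by blast
  have fm: "f \<in> borel_measurable M"
    by (rule borel_measurable_has_sum[OF J _ f]) (use F in auto)
  have "(\<lambda>j. LINT x|M. F j x) summable_on J"
  proof (rule abs_summable_summable, rule nonneg_bdd_above_summable_on)
    show "bdd_above (sum (\<lambda>j. norm (LINT x|M. F j x)) ` {S. S \<subseteq> J \<and> finite S})"
    proof (rule bdd_aboveI2)
      fix S assume "S \<in> {S. S \<subseteq> J \<and> finite S}"
      then have S: "finite S" "S \<subseteq> J" by auto
      have "(\<Sum>j\<in>S. norm (LINT x|M. F j x)) \<le> (\<Sum>j\<in>S. LINT x|M. norm (F j x))"
        by (intro sum_mono integral_norm_bound)
      also have "\<dots> = (LINT x|M. (\<Sum>j\<in>S. norm (F j x)))"
        by (rule Bochner_Integration.integral_sum[symmetric]) (use S F in auto)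
      also have "\<dots> \<le> (LINT x|M. G x)"
        by (rule integral_mono) (use S F G bd in \<open>auto intro!: Bochner_Integration.integrable_sum\<close>)
      finally show "(\<Sum>j\<in>S. norm (LINT x|M. F j x)) \<le> (LINT x|M. G x)" .
    qed
  qed simp
  then obtain L where L: "((\<lambda>j. LINT x|M. F j x) has_sum L) J" by (auto simp: summable_on_def)
  have 1: "(\<lambda>n. \<Sum>j\<in>S n. LINT x|M. F j x) \<longlonglongrightarrow> L"
    using filterlim_compose[OF L[unfolded has_sum_def] S(3)] .
  have "(\<lambda>n. LINT x|M. (\<Sum>j\<in>S n. F j x)) \<longlonglongrightarrow> (LINT x|M. f x)"
  proof (rule integral_dominated_convergence[OF fm _ G])
    show "(\<lambda>x. \<Sum>j\<in>S n. F j x) \<in> borel_measurable M" for n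
      using S F by (intro borel_measurable_sum borel_measurable_integrable) blast
    show "AE x in M. (\<lambda>n. \<Sum>j\<in>S n. F j x) \<longlonglongrightarrow> f x"
      using filterlim_compose[OF f[unfolded has_sum_def] S(3)] by simp
    show "AE x in M. norm (\<Sum>j\<in>S n. F j x) \<le> G x" for n
      using order_trans[OF norm_sum bd[OF S(1,2)]] by simp
  qed
  moreover have "(LINT x|M. (\<Sum>j\<in>S n. F j x)) = (\<Sum>j\<in>S n. LINT x|M. F j x)" for n
    by (rule Bochner_Integration.integral_sum) (use S F in blast)
  ultimately have "L = (LINT x|M. f x)" using 1 LIMSEQ_unique by simp
  then show ?thesis using L by simp
qed

lemma has_sum_norm_le:
  fixes f :: "'j \<Rightarrow> 'b::real_normed_vector"
  assumes "(f has_sum s) J" and "\<And>S. finite S \<Longrightarrow> S \<subseteq> J \<Longrightarrow> norm (sum f S) \<le> K"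
  shows "norm s \<le> K"
proof (rule tendsto_upperbound)
  show "((\<lambda>S. norm (sum f S)) \<longlongrightarrow> norm s) (finite_subsets_at_top J)"
    using assms(1) unfolding has_sum_def by (rule tendsto_norm)
  show "\<forall>\<^sub>F S in finite_subsets_at_top J. norm (sum f S) \<le> K"
    by (rule eventually_finite_subsets_at_top_weakI) (rule assms(2))
qed simp

text \<open>The form of the Toeplitz operator with symbol \<open>f\<close>. It is meaningful before
  the operator is known to exist; the two are identified only after the operator has been built as a
  norm limit.\<close>

definition symbol_form :: "(complex ^ 'n \<Rightarrow> complex) \<Rightarrow> 'n::finite bergman \<Rightarrow> 'n bergman \<Rightarrow> complex"
  where
  "symbol_form f h g = (LINT u|dv. f u * (bergman_fun h u * cnj (bergman_fun g u)))"

lemma integrable_symbol_form: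
  assumes f: "f \<in> borel_measurable dv" and bd: "AE u in dv. cmod (f u) \<le> B"
  shows "integrable dv (\<lambda>u. f u * (bergman_fun h u * cnj (bergman_fun g u)))"
proof (rule Bochner_Integration.integrable_bound)
  have I: "integrable dv (\<lambda>u. bergman_fun h u * cnj (bergman_fun g u))"
    by (intro bergman_product_integrable bergman_fun)
  then show "integrable dv (\<lambda>u. of_real B * (bergman_fun h u * cnj (bergman_fun g u)))" by simp
  show "(\<lambda>u. f u * (bergman_fun h u * cnj (bergman_fun g u))) \<in> borel_measurable dv"
    using f borel_measurable_integrable[OF I] by (rule borel_measurable_times)
  show "AE u in dv. norm (f u * (bergman_fun h u * cnj (bergman_fun g u)))
      \<le> norm (of_real B * (bergman_fun h u * cnj (bergman_fun g u)))"
    using bd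
  proof (rule eventually_mono)
    fix u assume "cmod (f u) \<le> B"
    then show "norm (f u * (bergman_fun h u * cnj (bergman_fun g u)))
        \<le> norm (of_real B * (bergman_fun h u * cnj (bergman_fun g u)))"
      by (simp only: norm_mult norm_of_real) (intro mult_right_mono, auto)
  qed
qed

text \<open>In the applications, as \<open>\<epsilon>\<close> tends to \<open>0\<close>, either the overlap of the large cells or the sup norm of the
  \<open>F j\<close> blows up; only the combination in hypothesis \<open>N\<close> stays bounded.\<close>

lemma quadrature:
  fixes F :: "'j \<Rightarrow> complex ^ 'n::finite \<Rightarrow> complex"
  assumes J: "countable J" and p: "\<And>j. j \<in> J \<Longrightarrow> p j \<in> polydisk"
    and Fm: "\<And>j. j \<in> J \<Longrightarrow> F j \<in> borel_measurable borel"
    and supp: "\<And>j u. j \<in> J \<Longrightarrow> F j u \<noteq> 0 \<Longrightarrow> u \<in> cell (p j) \<epsilon>"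
    and \<epsilon>: "0 < \<epsilon>" "\<epsilon> \<le> 1/16"
    and B: "\<And>S u. finite S \<Longrightarrow> S \<subseteq> J \<Longrightarrow> (\<Sum>j\<in>S. cmod (F j u)) \<le> B"
    and N: "\<And>S x. finite S \<Longrightarrow> S \<subseteq> J \<Longrightarrow>
      (\<Sum>j\<in>S. (LINT u|dv. cmod (F j u)) / cell_vol (p j) * indicator (cell (p j) (3/4)) x) \<le> N"
    and f: "\<And>u. ((\<lambda>j. F j u) has_sum f u) J"
    and s: "((\<lambda>j. (LINT u|dv. F j u) * (bergman_fun h (p j) * cnj (bergman_fun g (p j))))
        has_sum s) J"
  shows "cmod (symbol_form f h g - s) \<le> 16 ^ Suc CARD('n) * \<epsilon> * N * ((norm h)\<^sup>2 + (norm g)\<^sup>2)"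
proof -
  interpret dv: prob_space "dv :: (complex ^ 'n) measure" by (rule prob_space_dv)
  define P where "P u = bergman_fun h u * cnj (bergman_fun g u)" for u
  have Pint: "integrable dv P"
    unfolding P_def by (intro bergman_product_integrable bergman_fun)
  have Fb: "cmod (F j u) \<le> B" if "j \<in> J" for j u using B[of "{j}" u] that by simp
  have Fm': "F j \<in> borel_measurable dv" if "j \<in> J" for j
    using Fm[OF that] by (simp cong: measurable_cong_sets)
  have Fint: "integrable dv (F j)" if "j \<in> J" for j
    by (rule dv.integrable_const_bound[of _ B]) (use Fb Fm' that in auto)
  have FPint: "integrable dv (\<lambda>u. F j u * P u)" if "j \<in> J" for j
    unfolding P_def by (rule integrable_symbol_form[OF Fm'[OF that], of B])
      (use Fb[OF that] in auto)
  have sum1: "((\<lambda>j. LINT u|dv. F j u * P u) has_sum symbol_form f h g) J"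
    unfolding symbol_form_def P_def[symmetric]
  proof (rule has_sum_integral[OF J])
    show "((\<lambda>j. F j u * P u) has_sum f u * P u) J" for u
      using has_sum_cmult_left[OF f[of u], of "P u"] .
    show "integrable dv (\<lambda>u. B * cmod (P u))" using Pint by simp
    show "(\<Sum>j\<in>S. cmod (F j u * P u)) \<le> B * cmod (P u)" if "finite S" "S \<subseteq> J" for S u
      unfolding norm_mult sum_distrib_right[symmetric] by (intro mult_right_mono B that) simp
  qed (rule FPint)
  have diff: "((\<lambda>j. (LINT u|dv. F j u * P u) - (LINT u|dv. F j u) * P (p j))
      has_sum (symbol_form f h g - s)) J"
    using has_sum_add[OF sum1 has_sum_cmult_right[OF s, of "-1"]] by (simp add: P_def)
  have each: "cmod ((LINT u|dv. F j u * P u) - (LINT u|dv. F j u) * P (p j))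
      \<le> (LINT u|dv. cmod (F j u)) * (16 * \<epsilon> * (local_mean h (p j) + local_mean g (p j)))" if j: "j \<in>
        J" for j
  proof -
    define H where "H = local_mean h (p j)"
    define G where "G = local_mean g (p j)"
    have HG: "0 \<le> H" "0 \<le> G" unfolding H_def G_def by (auto intro: local_mean_nonneg p j)
    \<comment> \<open>Product rule for differences: one factor contributes its oscillation, the
      other its size. The product of the square roots of H and G is then replaced by their sum, so
      that \<open>h\<close> and \<open>g\<close> can be summed separately.\<close>
    have pt: "cmod (P u - P (p j)) \<le> 16 * \<epsilon> * (H + G)" if u: "u \<in> cell (p j) \<epsilon>" for u
    proof -
      have u8: "u \<in> cell (p j) (1/8)" using cell_mono[OF p[OF j], of \<epsilon> "1/8"] u \<epsilon> by auto
      have p8: "p j \<in> cell (p j) (1/8)" by (rule centre_in_cell[OF p[OF j]]) simp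
      have g1: "cmod (bergman_fun g u) \<le> sqrt G"
        unfolding G_def by (rule real_le_rsqrt[OF bergman_cell_bound[OF p[OF j] u8]])
      have h1: "cmod (bergman_fun h (p j)) \<le> sqrt H"
        unfolding H_def by (rule real_le_rsqrt[OF bergman_cell_bound[OF p[OF j] p8]])
      have h2: "cmod (bergman_fun h u - bergman_fun h (p j)) \<le> 16 * \<epsilon> * sqrt H"
        unfolding H_def by (rule bergman_cell_diff[OF p[OF j] \<epsilon> u])
      have g2: "cmod (bergman_fun g u - bergman_fun g (p j)) \<le> 16 * \<epsilon> * sqrt G"
        unfolding G_def by (rule bergman_cell_diff[OF p[OF j] \<epsilon> u])
      have "P u - P (p j) = (bergman_fun h u - bergman_fun h (p j)) * cnj (bergman_fun g u)
          + bergman_fun h (p j) * cnj (bergman_fun g u - bergman_fun g (p j))"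
        by (simp add: P_def algebra_simps)
      then have "cmod (P u - P (p j)) \<le> cmod (bergman_fun h u - bergman_fun h (p j))
          * cmod (bergman_fun g u)
          + cmod (bergman_fun h (p j)) * cmod (bergman_fun g u - bergman_fun g (p j))"
        by (metis complex_mod_cnj norm_mult norm_triangle_ineq)
      also have "\<dots> \<le> (16 * \<epsilon> * sqrt H) * sqrt G + sqrt H * (16 * \<epsilon> * sqrt G)"
        using h1 h2 g1 g2 \<epsilon> HG by (intro add_mono mult_mono) auto
      also have "\<dots> = 16 * \<epsilon> * (2 * sqrt H * sqrt G)" by simp
      also have "\<dots> \<le> 16 * \<epsilon> * (H + G)"
        using sum_squares_bound[of "sqrt H" "sqrt G"] HG \<epsilon> by (intro mult_left_mono) auto
      finally show ?thesis .
    qed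
    have "(LINT u|dv. F j u * P u) - (LINT u|dv. F j u) * P (p j)
        = (LINT u|dv. F j u * P u - F j u * P (p j))"
      using FPint[OF j] Fint[OF j] by simp
    also have "cmod \<dots> \<le> (LINT u|dv. cmod (F j u) * (16 * \<epsilon> * (H + G)))"
    proof (rule Bochner_Integration.integral_norm_bound_integral)
      show "integrable dv (\<lambda>u. F j u * P u - F j u * P (p j))"
        using FPint[OF j] Fint[OF j] by simp
      show "integrable dv (\<lambda>u. cmod (F j u) * (16 * \<epsilon> * (H + G)))"
        using Fint[OF j] by simp
      show "norm (F j u * P u - F j u * P (p j)) \<le> cmod (F j u) * (16 * \<epsilon> * (H + G))" for u
      proof (cases "F j u = 0")
        case False
        then show ?thesis using pt[OF supp[OF j False]]
          by (simp add: norm_mult mult_left_mono flip: right_diff_distrib)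
      qed simp
    qed
    finally show ?thesis by (simp add: H_def G_def)
  qed
  show ?thesis
  proof (rule has_sum_norm_le[OF diff])
    fix S assume S: "finite S" "S \<subseteq> J"
    let ?a = "\<lambda>j. (LINT u|dv. cmod (F j u)) / cell_vol (p j)"
    have "norm (\<Sum>j\<in>S. (LINT u|dv. F j u * P u) - (LINT u|dv. F j u) * P (p j))
       \<le> (\<Sum>j\<in>S. (LINT u|dv. cmod (F j u)) * (16 * \<epsilon> * (local_mean h (p j) + local_mean g (p j))))"
      by (rule sum_norm_le) (use each S in blast)
    \<comment> \<open>One factor 16 is the oscillation constant; the factor 16^n is that of
      \<open>local_mean\<close>.\<close>
    also have "\<dots> = 16 ^ Suc CARD('n) * \<epsilon> * ((\<Sum>j\<in>S. ?a j * local_mass h (cell (p j) (3/4)))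
        + (\<Sum>j\<in>S. ?a j * local_mass g (cell (p j) (3/4))))"
      by (simp add: local_mean_def sum_distrib_left sum.distrib[symmetric] algebra_simps
        add_divide_distrib)
    also have "\<dots> \<le> 16 ^ Suc CARD('n) * \<epsilon> * (N * (norm h)\<^sup>2 + N * (norm g)\<^sup>2)"
      by (intro mult_left_mono add_mono sum_local_mass_le N S) (use \<epsilon> in auto)
    finally show "norm (\<Sum>j\<in>S. (LINT u|dv. F j u * P u) - (LINT u|dv. F j u) * P (p j))
      \<le> 16 ^ Suc CARD('n) * \<epsilon> * N * ((norm h)\<^sup>2 + (norm g)\<^sup>2)"
      by (simp add: algebra_simps)
  qed
qed

text \<open>Two candidates for the projection have a difference orthogonal to the whole space, in
  particular to itself. Exhibiting the representing element thus evaluates the definite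
  description.\<close>

lemma bergman_proj_eqI:
  fixes u :: "'n::finite bergman"
  assumes int: "\<And>h :: 'n bergman. integrable dv (\<lambda>z. g z * cnj (bergman_fun h z))"
    and orth: "\<And>h. (LINT z|dv. g z * cnj (bergman_fun h z)) = cinner u h"
  shows "bergman_proj g = u"
proof -
  have split: "(LINT z|dv. (g z - bergman_fun v z) * cnj (bergman_fun h z))
      = cinner u h - cinner v h" for v h :: "'n bergman"
    unfolding left_diff_distrib cinner_def[of v]
    using int[of h] bergman_product_integrable[OF bergman_fun bergman_fun, of v h] orth[of h]
      by simp
  show ?thesis
    unfolding bergman_proj_def
  proof (rule the_equality)
    show "\<forall>h. (LINT z|dv. (g z - bergman_fun u z) * cnj (bergman_fun h z)) = 0" by (simp add: split)
    fix v assume "\<forall>h. (LINT z|dv. (g z - bergman_fun v z) * cnj (bergman_fun h z)) = 0"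
    then have "cinner u (u - v) - cinner v (u - v) = 0" by (simp only: split)
    then have "cinner (u - v) (u - v) = 0" by (simp add: cinner_diff_left)
    then show "v = u" using cinner_self_eq_0 by force
  qed
qed

text \<open>An operator with the right form exhibits all the values P(f h) at once, so existence of
  the projection and boundedness of the Toeplitz operator follow from having constructed
  \<open>T\<close>.\<close>

lemma toeplitz_eqI:
  fixes T :: "'n::finite bergman \<Rightarrow>\<^sub>L 'n bergman"
  assumes f: "f \<in> Linfty" and form: "\<And>h g. cinner (blinfun_apply T h) g = symbol_form f h g"
  shows "toeplitz f = T"
proof -
  obtain B where fm: "f \<in> borel_measurable dv" and B: "AE u in dv. cmod (f u) \<le> B"
    using f by (auto simp: Linfty_def)
  have "bergman_proj (\<lambda>z. f z * bergman_fun h z) = blinfun_apply T h" for h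
  proof (rule bergman_proj_eqI)
    show "integrable dv (\<lambda>z. f z * bergman_fun h z * cnj (bergman_fun g z))" for g :: "'n bergman"
      using integrable_symbol_form[OF fm B, of h g] by (simp add: mult.assoc)
    show "(LINT z|dv. f z * bergman_fun h z * cnj (bergman_fun g z)) = cinner (blinfun_apply T h) g"
      for g
      by (simp add: form symbol_form_def mult.assoc)
  qed
  then show ?thesis unfolding toeplitz_def by (simp add: blinfun_apply_inverse)
qed

subsection \<open>Toeplitz operators as limits of diagonal sums\<close>

text \<open>A maximal family with disjoint balls of radius \<open>a\<close>, from Zorn's lemma. By
  maximality the ball around any other point \<open>w\<close> meets the ball around some z in
  \<Gamma>, and a common point x compares \<open>w\<close> with z.\<close>

lemma polyball_net:
  fixes \<epsilon> :: real
  assumes \<epsilon>: "0 < \<epsilon>" "\<epsilon> \<le> 1/16"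
  obtains \<Gamma> :: "(complex ^ 'n::finite) set" where "separated_set \<Gamma>" "polydisk \<subseteq> (\<Union>z\<in>\<Gamma>. cell z \<epsilon>)"
proof -
  \<comment> \<open>Within distance \<open>a\<close> coordinates differ by at most 5 t =
    \<epsilon>/8 relative to the distance to the boundary. The two comparisons through x add up to
    at most 3/8 of \<epsilon>, the second one counted at most twice.\<close>
  define t where "t = \<epsilon> / 40"
  have t: "0 < t" "t \<le> 1/40" using \<epsilon> by (auto simp: t_def)
  define a where "a = artanh t"
  have a: "a > 0" using artanh_less_iff[of 0 t] t by (simp add: a_def)
  define \<A> where "\<A> = {\<Gamma> :: (complex ^ 'n) set. \<Gamma> \<subseteq> polydisk
      \<and> (\<forall>u\<in>\<Gamma>. \<forall>v\<in>\<Gamma>. u \<noteq> v \<longrightarrow> polyball u a \<inter> polyball v a = {})}"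
  have "\<exists>M\<in>\<A>. \<forall>X\<in>\<A>. M \<subseteq> X \<longrightarrow> X = M"
  proof (rule subset_Zorn_nonempty)
    show "\<A> \<noteq> {}" by (auto simp: \<A>_def)
    fix C assume C: "C \<noteq> {}" "subset.chain \<A> C"
    show "\<Union>C \<in> \<A>"
      unfolding \<A>_def mem_Collect_eq
    proof (intro conjI ballI impI)
      show "\<Union>C \<subseteq> polydisk" using C by (auto simp: subset_chain_def \<A>_def)
      fix u v assume u: "u \<in> \<Union>C" and v: "v \<in> \<Union>C" and uv: "u \<noteq> v"
      obtain U V where UV: "U \<in> C" "V \<in> C" "u \<in> U" "v \<in> V" using u v by blast
      then have "U \<subseteq> V \<or> V \<subseteq> U" using C by (auto simp: subset_chain_def)
      then obtain X where "X \<in> C" "u \<in> X" "v \<in> X" using UV by blast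
      then have "X \<in> \<A>" "u \<in> X" "v \<in> X" using C by (auto simp: subset_chain_def)
      then show "polyball u a \<inter> polyball v a = {}"
        using uv unfolding \<A>_def by blast
    qed
  qed
  then obtain \<Gamma> where \<Gamma>: "\<Gamma> \<in> \<A>" and mx: "\<And>X. X \<in> \<A> \<Longrightarrow> \<Gamma> \<subseteq> X \<Longrightarrow> X = \<Gamma>" by blast
  have pd: "\<Gamma> \<subseteq> polydisk" using \<Gamma> by (simp add: \<A>_def)
  have sep: "separated_set \<Gamma>" using \<Gamma> a by (auto simp: \<A>_def separated_set_def)
  have "\<exists>z\<in>\<Gamma>. w \<in> cell z \<epsilon>" if w: "w \<in> polydisk" for w
  proof (cases "w \<in> \<Gamma>")
    case True
    then show ?thesis using centre_in_cell[OF w \<epsilon>(1)] by blast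
  next
    case False
    have "insert w \<Gamma> \<notin> \<A>" using mx[of "insert w \<Gamma>"] False by blast
    have "\<exists>z\<in>\<Gamma>. polyball w a \<inter> polyball z a \<noteq> {}"
    proof (rule ccontr)
      assume "\<not> ?thesis"
      then have none: "polyball w a \<inter> polyball z a = {}" "polyball z a \<inter> polyball w a = {}"
        if "z \<in> \<Gamma>" for z
        using that by blast+
      have "polyball u a \<inter> polyball v a = {}" if "u \<in> insert w \<Gamma>" "v \<in> insert w \<Gamma>" "u \<noteq> v" for u v
        using that none \<Gamma> unfolding \<A>_def by blast
      then have "insert w \<Gamma> \<in> \<A>"
        using pd w unfolding \<A>_def by blast
      then show False using \<open>insert w \<Gamma> \<notin> \<A>\<close> by simp
    qed
    then obtain z where z: "z \<in> \<Gamma>" "polyball w a \<inter> polyball z a \<noteq> {}" by blast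
    then obtain x where x: "x \<in> polydisk" "polydist w x < a" "polydist z x < a"
      by (auto simp: polyball_def)
    have zpd: "z \<in> polydisk" using z pd by blast
    have near: "cmod (x $ i - y $ i) \<le> \<epsilon> / 8 * (1 - cmod (y $ i))"
      if y: "y \<in> polydisk" "polydist y x < a" for y i
    proof -
      have lt: "cmod (y $ i) < 1" "cmod (x $ i) < 1" using x y by (auto simp: polydisk_def)
      have ph: "cmod (phi (y $ i) (x $ i)) \<le> t"
        by (rule polydist_le_imp_phi[OF y(1) x(1)]) (use y t in \<open>auto simp: a_def\<close>)
      have "cmod (x $ i - y $ i) \<le> 4 / (1 - t\<^sup>2) * t * (1 - cmod (y $ i))"
        by (rule phi_comparable(3)[OF lt ph]) (use t in simp)
      also have "\<dots> \<le> 5 * t * (1 - cmod (y $ i))"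
      proof (intro mult_right_mono)
        have "t\<^sup>2 \<le> (1/40)\<^sup>2" using t by (intro power_mono) auto
        then show "4 / (1 - t\<^sup>2) \<le> 5" by (simp add: power2_eq_square divide_simps)
      qed (use t lt in auto)
      finally show ?thesis by (simp add: t_def)
    qed
    have "cmod (w $ i - z $ i) < \<epsilon> * (1 - cmod (z $ i))" for i
    proof -
      let ?d = "1 - cmod (z $ i)" and ?e = "1 - cmod (w $ i)"
      have d: "?d > 0" "?e > 0" using polydisk_gap_pos zpd w by auto
      have xz: "cmod (x $ i - z $ i) \<le> \<epsilon> / 8 * ?d" and xw: "cmod (x $ i - w $ i) \<le> \<epsilon> / 8 * ?e"
        using near zpd w x by auto
      have e: "\<epsilon> / 8 * ?d \<le> 1/8 * ?d" "\<epsilon> / 8 * ?e \<le> 1/8 * ?e"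
        using \<epsilon> d by (auto intro!: mult_right_mono)
      have tri: "cmod (w $ i - z $ i) \<le> cmod (x $ i - z $ i) + cmod (x $ i - w $ i)"
        using norm_triangle_ineq4[of "x $ i - z $ i" "x $ i - w $ i"] by simp
      have "cmod (z $ i) - cmod (w $ i) \<le> cmod (w $ i - z $ i)"
        using norm_triangle_ineq2[of "z $ i" "w $ i"] by (simp add: norm_minus_commute)
      \<comment> \<open>The distance of \<open>w\<close> to the boundary is at most twice that of z;
        the arithmetic is isolated over plain reals.\<close>
      moreover have "E \<le> 2 * D" if "Z - W \<le> s" "s \<le> p + q" "p \<le> p'" "q \<le> q'" "p' \<le> 1/8 * D" "q'
          \<le> 1/8 * E"
        "E = 1 - W" "D = 1 - Z" "0 < D" "0 < E" for D E Z W s p q p' q' :: real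
        using that by linarith
      ultimately have "?e \<le> 2 * ?d" using tri xz xw e d by blast
      then have "\<epsilon> / 8 * ?e \<le> \<epsilon> / 8 * (2 * ?d)" using \<epsilon> by (intro mult_left_mono) auto
      then have "cmod (w $ i - z $ i) \<le> \<epsilon> / 8 * ?d + \<epsilon> / 8 * (2 * ?d)" using tri xz xw by linarith
      also have "\<dots> = 3/8 * (\<epsilon> * ?d)" by simp
      also have "\<dots> < \<epsilon> * ?d" using \<epsilon> d by simp
      finally show ?thesis .
    qed
    then show ?thesis using z by (auto simp: cell_def)
  qed
  then show ?thesis using that[OF sep] by blast
qed

text \<open>The disjoint balls contain disjoint nonempty open cells, of which there are only
  countably many.\<close>

lemma separated_countable:
  assumes sep: "separated_set (\<Gamma> :: (complex ^ 'n::finite) set)"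
  shows "countable \<Gamma>"
proof -
  from sep obtain a where a: "a > 0" and \<Gamma>: "\<Gamma> \<subseteq> polydisk"
    and disj: "\<And>u v. u \<in> \<Gamma> \<Longrightarrow> v \<in> \<Gamma> \<Longrightarrow> u \<noteq> v \<Longrightarrow> polyball u a \<inter> polyball v a = {}"
    unfolding separated_set_def by blast
  have "0 \<le> a / CARD('n)" using a by simp
  then obtain c where c: "0 \<le> c" "c < 1" "artanh c = a / CARD('n)"
    using that[of "tanh (a / CARD('n))"] by (simp add: tanh_real_lt_1 artanh_tanh_real)
  have "c \<noteq> 0" using c(3) a by auto
  then have c0: "0 < c" using c by simp
  have sub: "cell z c \<subseteq> polyball z a" and ne: "z \<in> cell z c" if "z \<in> \<Gamma>" for z
    using cell_subset_polyball[of z c a] centre_in_cell[of z c] that \<Gamma> c c0 by auto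
  have dj: "cell u c \<inter> cell v c = {}" if "u \<in> \<Gamma>" "v \<in> \<Gamma>" "u \<noteq> v" for u v
    using disj[OF that] sub that by blast
  have "countable ((\<lambda>z. cell z c) ` \<Gamma>)"
    by (rule countable_disjoint_open_subsets) (use dj in \<open>auto simp: pairwise_def disjnt_def\<close>)
  moreover have "inj_on (\<lambda>z. cell z c) \<Gamma>"
    using dj ne by (intro inj_onI) blast
  ultimately show ?thesis by (rule countable_image_inj_on)
qed

lemma measure_dv_cell_le:
  fixes x :: "complex ^ 'n::finite"
  assumes x: "x \<in> polydisk" and R: "0 \<le> R"
  shows "measure dv (cell x R) \<le> (R\<^sup>2) ^ CARD('n) * cell_vol x"
proof -
  have "polydisk = cell (0 :: complex ^ 'n) 1" by (auto simp: polydisk_def cell_def)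
  then have V: "emeasure lborel (polydisk :: (complex ^ 'n) set) = ennreal (pi ^ CARD('n))"
    using emeasure_lborel_cell[of "0 :: complex ^ 'n" 1] by (simp add: cell_vol_def)
  have v: "cell_vol x > 0" by (rule cell_vol_pos[OF x])
  have "emeasure dv (cell x R) = emeasure lborel (polydisk \<inter> cell x R)
      / emeasure lborel (polydisk :: (complex ^ 'n) set)"
    unfolding dv_def by (rule emeasure_uniform_measure) auto
  also have "\<dots> \<le> emeasure lborel (cell x R) / emeasure lborel (polydisk :: (complex ^ 'n) set)"
    by (intro divide_right_mono_ennreal emeasure_mono) auto
  also have "\<dots> = ennreal ((pi * R\<^sup>2) ^ CARD('n) * cell_vol x / pi ^ CARD('n))"
    using v by (simp add: V emeasure_lborel_cell[OF x R] divide_ennreal less_imp_le)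
  also have "(pi * R\<^sup>2) ^ CARD('n) * cell_vol x / pi ^ CARD('n) = (R\<^sup>2) ^ CARD('n) * cell_vol x"
    by (simp add: power_mult_distrib)
  finally show ?thesis
    using v by (simp add: measure_def enn2real_leI)
qed

lemma phi_self [simp]: "phi u u = 0"
  by (simp add: phi_def)

lemma separated_bessel_kernel:
  fixes \<Gamma> :: "(complex ^ 'n::finite) set"
  assumes sep: "separated_set \<Gamma>" and t: "0 \<le> t" "t < 1"
  obtains A :: real where "0 \<le> A"
    "\<And>w h F. close_family t \<Gamma> w
     \<Longrightarrow> finite F \<Longrightarrow> F \<subseteq> \<Gamma> \<Longrightarrow> (\<Sum>z\<in>F. (cmod (cinner h (kernel (w z))))\<^sup>2) \<le> A * (norm h)\<^sup>2"
proof -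
  obtain K :: real where K: "0 \<le> K" "\<And>w h F. close_family t \<Gamma> w
     \<Longrightarrow> finite F \<Longrightarrow> F \<subseteq> \<Gamma> \<Longrightarrow> (\<Sum>z\<in>F. cell_vol (w z) * (cmod (bergman_fun h (w z)))\<^sup>2) \<le> K * (norm h)\<^sup>2"
    using separated_carleson[OF sep t] by blast
  show ?thesis
  proof
    show "0 \<le> 4 ^ CARD('n) * K" using K by simp
    fix w h F
    assume cf: "close_family t \<Gamma> w"
      and F: "finite F" "F \<subseteq> \<Gamma>"
    note w = close_familyD[OF cf]
    have "(\<Sum>z\<in>F. (cmod (cinner h (kernel (w z))))\<^sup>2)
        \<le> (\<Sum>z\<in>F. 4 ^ CARD('n) * (cell_vol (w z) * (cmod (bergman_fun h (w z)))\<^sup>2))"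
      by (intro sum_mono norm_cinner_kernel_square_le) (use w F in blast)
    also have "\<dots> \<le> 4 ^ CARD('n) * (K * (norm h)\<^sup>2)"
      unfolding sum_distrib_left[symmetric] by (intro mult_left_mono K(2)[OF cf F]) simp_all
    finally show "(\<Sum>z\<in>F. (cmod (cinner h (kernel (w z))))\<^sup>2) \<le> 4 ^ CARD('n) * K * (norm h)\<^sup>2"
      by (simp add: mult.assoc)
  qed
qed

lemma has_sum_cinner:
  fixes T :: "'n::finite bergman \<Rightarrow>\<^sub>L 'n bergman"
  assumes "((\<lambda>z. c z *\<^sub>c (cinner h (v z) *\<^sub>c u z)) has_sum blinfun_apply T h) I"
  shows "((\<lambda>z. c z * (cinner h (v z) * cnj (cinner g (u z))))
      has_sum cinner (blinfun_apply T h) g) I"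
proof -
  have "((\<lambda>z. cinner (c z *\<^sub>c (cinner h (v z) *\<^sub>c u z)) g) has_sum cinner (blinfun_apply T h) g) I"
    by (rule has_sum_bounded_linear[OF bounded_linear_cinner_left assms, unfolded o_def])
  then show ?thesis
    by (simp add: cinner_cscale_left cinner_commute[symmetric])
qed

text \<open>The approximating operator samples the symbol on the cells of a fine partition.\<close>

lemma symbol_form_approx:
  fixes f :: "complex ^ 'n::finite \<Rightarrow> complex"
  assumes fm: "f \<in> borel_measurable borel" and fB: "\<And>u. cmod (f u) \<le> B"
    and f0: "\<And>u. u \<notin> polydisk \<Longrightarrow> f u = 0" and \<epsilon>: "0 < \<epsilon>" "\<epsilon> \<le> 1/16"
  obtains T :: "'n bergman \<Rightarrow>\<^sub>L 'n bergman" where "T \<in> D0"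
    "\<And>h g. cmod (symbol_form f h g - cinner (blinfun_apply T h) g)
        \<le> 16 ^ Suc CARD('n) * \<epsilon> * (B * 64 ^ CARD('n)) * ((norm h)\<^sup>2 + (norm g)\<^sup>2)"
proof -
  interpret dv: prob_space "dv :: (complex ^ 'n) measure" by (rule prob_space_dv)
  have B0: "B \<ge> 0" using fB[of 0] norm_ge_zero order_trans by blast
  obtain \<Gamma> :: "(complex ^ 'n) set" where sep: "separated_set \<Gamma>"
    and cov: "polydisk \<subseteq> (\<Union>z\<in>\<Gamma>. cell z \<epsilon>)"
    by (rule polyball_net[OF \<epsilon>])
  have \<Gamma>pd: "\<Gamma> \<subseteq> polydisk" using sep by (simp add: separated_set_def)
  have cnt: "countable \<Gamma>" by (rule separated_countable[OF sep])
  let ?k = "to_nat_on \<Gamma>"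
  \<comment> \<open>Enumerating \<Gamma> and removing the earlier cells from each cell turns the
    overlapping cover into a Borel partition of the polydisk.\<close>
  define E where "E z = cell z \<epsilon> - (\<Union>z'\<in>{z'\<in>\<Gamma>. ?k z' < ?k z}. cell z' \<epsilon>)" for z
  have Em [measurable]: "E z \<in> sets borel" for z
    unfolding E_def by (intro sets.Diff sets.countable_UN' countable_subset[OF _ cnt]) auto
  have Esub: "E z \<subseteq> cell z \<epsilon>" for z by (auto simp: E_def)
  have Edisj: "z = z'" if "z \<in> \<Gamma>" "z' \<in> \<Gamma>" "u \<in> E z" "u \<in> E z'" for z z' u
  proof -
    have "\<not> ?k z < ?k z'" "\<not> ?k z' < ?k z" using that by (auto simp: E_def)
    then have "?k z = ?k z'" by simp
    then show ?thesis using inj_on_to_nat_on[OF cnt] that by (auto dest: inj_onD)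
  qed
  have Ecov: "\<exists>z\<in>\<Gamma>. u \<in> E z" if u: "u \<in> polydisk" for u
  proof -
    have "\<exists>z. z \<in> \<Gamma> \<and> u \<in> cell z \<epsilon>" using cov u by blast
    then obtain z where z: "z \<in> \<Gamma>" "u \<in> cell z \<epsilon>"
      and mn: "\<And>z'. z' \<in> \<Gamma> \<Longrightarrow> u \<in> cell z' \<epsilon> \<Longrightarrow> ?k z \<le> ?k z'"
      using ex_has_least_nat[of "\<lambda>z. z \<in> \<Gamma> \<and> u \<in> cell z \<epsilon>" _ ?k] by blast
    have "u \<in> E z" using z mn by (force simp: E_def not_less)
    then show ?thesis using z by blast
  qed
  define F where "F z u = indicator (E z) u * f u" for z u
  have Fm: "F z \<in> borel_measurable borel" for z
    unfolding F_def using fm by measurable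
  have Fsupp: "u \<in> cell z \<epsilon>" if "F z u \<noteq> 0" for z u
    using that Esub[of z] by (auto simp: F_def indicator_def split: if_splits)
  have FB: "cmod (F z u) \<le> B * indicator (E z) u" for z u
    using fB[of u] by (simp add: F_def norm_mult indicator_def)
  have indE: "(\<Sum>z\<in>S. indicator (E z) u) \<le> (1::real)" if S: "finite S" "S \<subseteq> \<Gamma>" for S u
  proof (cases "\<exists>z\<in>S. u \<in> E z")
    case True
    then obtain z where z: "z \<in> S" "u \<in> E z" by blast
    have "(\<Sum>z'\<in>S. indicator (E z') u) = (\<Sum>z'\<in>S. if z' = z then 1 else 0 :: real)"
      using z Edisj S by (intro sum.cong) (auto simp: indicator_def)
    then show ?thesis using S z by simp
  next
    case False
    then have "(\<Sum>z\<in>S. indicator (E z) u) = (0::real)"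
      by (intro sum.neutral) (auto simp: indicator_def)
    then show ?thesis by simp
  qed
  have sumF: "(\<Sum>z\<in>S. cmod (F z u)) \<le> B" if S: "finite S" "S \<subseteq> \<Gamma>" for S u
  proof -
    have "(\<Sum>z\<in>S. cmod (F z u)) \<le> (\<Sum>z\<in>S. B * indicator (E z) u)" by (intro sum_mono FB)
    also have "\<dots> \<le> B * 1" unfolding sum_distrib_left[symmetric] by (intro mult_left_mono indE S B0)
    finally show ?thesis by simp
  qed
  have hsF: "((\<lambda>z. F z u) has_sum f u) \<Gamma>" for u
  proof (cases "u \<in> polydisk")
    case True
    then obtain z where z: "z \<in> \<Gamma>" "u \<in> E z" using Ecov by blast
    have "((\<lambda>z. F z u) has_sum f u) {z}" using has_sum_finite[of "{z}" "\<lambda>z. F z u"] z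
      by (simp add: F_def)
    then show ?thesis
      by (rule has_sum_cong_neutral[THEN iffD1, rotated -1])
        (use z Edisj in \<open>auto simp: F_def indicator_def\<close>)
  qed (simp add: F_def f0)
  have absF: "(LINT u|dv. cmod (F z u)) \<le> B * measure dv (E z)" for z
  proof -
    have "(LINT u|dv. cmod (F z u)) \<le> (LINT u|dv. B * indicator (E z) u)"
    proof (rule integral_mono)
      show "integrable dv (\<lambda>u. cmod (F z u))"
        by (rule dv.integrable_const_bound[of _ B])
          (use order_trans[OF FB[of z]] B0 Fm in \<open>auto simp: indicator_def cong:
            measurable_cong_sets intro!: AE_I2\<close>)
      show "integrable dv (\<lambda>u. B * indicator (E z) u)"
        by (rule dv.integrable_const_bound[of _ B]) (use B0 in \<open>auto simp: indicator_def\<close>)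
    qed (rule FB)
    then show ?thesis by simp
  qed
  \<comment> \<open>The number of cells over \<open>x\<close> depends on the mesh, but the pieces
    \<open>E z\<close> with x in \<open>cell z (3/4)\<close> are disjoint and lie in
    \<open>cell x 4\<close>, of measure at most 16^n \<open>cell_vol x\<close>. Replacing
    \<open>cell_vol z\<close> by \<open>cell_vol x\<close> costs 4^n, which makes 64^n.\<close>
  have Nbound: "(\<Sum>z\<in>S. (LINT u|dv. cmod (F z u)) / cell_vol z * indicator (cell z (3/4)) x)
      \<le> B * 64 ^ CARD('n)"
    if S: "finite S" "S \<subseteq> \<Gamma>" for S x
  proof (cases "x \<in> polydisk")
    case False
    have "indicator (cell z (3/4)) x = (0::real)" if "z \<in> S" for z
      using cell_subset_polydisk[of z "3/4"] that S \<Gamma>pd False by (auto simp: indicator_def)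
    then show ?thesis using B0 by simp
  next
    case x: True
    define S' where "S' = {z \<in> S. x \<in> cell z (3/4)}"
    have S': "finite S'" "S' \<subseteq> \<Gamma>" using S by (auto simp: S'_def)
    have xv: "cell_vol x > 0" by (rule cell_vol_pos[OF x])
    have zz: "cell_vol x \<le> 4 ^ CARD('n) * cell_vol z" "E z \<subseteq> cell x 4" if z: "z \<in> S'" for z
    proof -
      have xc: "x \<in> cell z (3/4)" and zpd: "z \<in> polydisk" using z S \<Gamma>pd by (auto simp: S'_def)
      have gap: "1 - cmod (x $ i) \<le> 2 * (1 - cmod (z $ i))" "1 - cmod (z $ i)
          \<le> 4 * (1 - cmod (x $ i))" for i
        using cell_gap_le[OF xc, of i] polydisk_gap_pos[OF zpd, of i] by auto
      show "cell_vol x \<le> 4 ^ CARD('n) * cell_vol z"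
        using cell_vol_mono_factor[OF gap(1) x] by simp
      show "E z \<subseteq> cell x 4"
      proof
        fix u assume "u \<in> E z"
        then have u: "u \<in> cell z \<epsilon>" using Esub by blast
        have "cmod (u $ i - x $ i) < 4 * (1 - cmod (x $ i))" for i
        proof -
          have 1: "cmod (u $ i - z $ i) < \<epsilon> * (1 - cmod (z $ i))" using u by (simp add: cell_def)
          have 2: "\<epsilon> * (1 - cmod (z $ i)) \<le> 1/16 * (1 - cmod (z $ i))"
            using \<epsilon> polydisk_gap_pos[OF zpd, of i] by (intro mult_right_mono) auto
          have 3: "cmod (x $ i - z $ i) < 3/4 * (1 - cmod (z $ i))" using xc by (simp add: cell_def)
          have "cmod (u $ i - x $ i) \<le> cmod (u $ i - z $ i) + cmod (x $ i - z $ i)"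
            using norm_triangle_ineq4[of "u $ i - z $ i" "x $ i - z $ i"] by simp
          moreover have "U < 4 * X" if "U \<le> A + B" "A < 1/16 * G" "B < 3/4 * G" "G \<le> 4 * X" "0 < G"
            for U A B G X :: real
            using that by linarith
          ultimately show ?thesis
            using less_le_trans[OF 1 2] 3 gap(2)[of i] polydisk_gap_pos[OF zpd, of i] by blast
        qed
        then show "u \<in> cell x 4" by (simp add: cell_def)
      qed
    qed
    have "(\<Sum>z\<in>S. (LINT u|dv. cmod (F z u)) / cell_vol z * indicator (cell z (3/4)) x)
        = (\<Sum>z\<in>S'. (LINT u|dv. cmod (F z u)) / cell_vol z)"
      unfolding S'_def using S by (intro sum.mono_neutral_cong_right) (auto simp: indicator_def)
    also have "\<dots> \<le> (\<Sum>z\<in>S'. B * 4 ^ CARD('n) / cell_vol x * measure dv (E z))"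
    proof (rule sum_mono)
      fix z assume z: "z \<in> S'"
      have zv: "cell_vol z > 0" using z S' \<Gamma>pd by (intro cell_vol_pos) blast
      have "(LINT u|dv. cmod (F z u)) / cell_vol z \<le> B * measure dv (E z) / cell_vol z"
        using absF zv by (intro divide_right_mono) auto
      also have "\<dots> \<le> B * measure dv (E z) * (4 ^ CARD('n) / cell_vol x)"
        unfolding divide_inverse[of _ "cell_vol z"] using zz(1)[OF z] xv zv B0
        by (intro mult_left_mono) (auto simp: field_simps)
      finally show "(LINT u|dv. cmod (F z u)) / cell_vol z
          \<le> B * 4 ^ CARD('n) / cell_vol x * measure dv (E z)"
        by (simp add: mult_ac)
    qed
    also have "\<dots> = B * 4 ^ CARD('n) / cell_vol x * measure dv (\<Union>z\<in>S'. E z)"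
    proof -
      have "disjoint_family_on E S'"
        unfolding disjoint_family_on_def using Edisj S' by blast
      then have "measure dv (\<Union>z\<in>S'. E z) = (\<Sum>z\<in>S'. measure dv (E z))"
        using S' by (intro dv.finite_measure_finite_Union) auto
      then show ?thesis by (simp add: sum_distrib_left)
    qed
    also have "\<dots> \<le> B * 4 ^ CARD('n) / cell_vol x * (16 ^ CARD('n) * cell_vol x)"
    proof (rule mult_left_mono)
      have "measure dv (\<Union>z\<in>S'. E z) \<le> measure dv (cell x 4)"
        by (rule dv.finite_measure_mono) (use zz(2) in auto)
      also have "\<dots> \<le> 16 ^ CARD('n) * cell_vol x"
        using measure_dv_cell_le[OF x, of 4] by simp
      finally show "measure dv (\<Union>z\<in>S'. E z) \<le> 16 ^ CARD('n) * cell_vol x" .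
    qed (use B0 xv in simp)
    also have "\<dots> = B * 64 ^ CARD('n)"
      using xv by (simp flip: power_mult_distrib)
    finally show ?thesis .
  qed
  define K where "K z = (\<Prod>i\<in>UNIV. 1 - (cmod (z $ i))\<^sup>2)" for z :: "complex ^ 'n"
  \<comment> \<open>Pairing with \<open>kernel z\<close> multiplies the value at z by
    \<open>K z\<close>; both factors of the rank one operator do so, hence the square.\<close>
  define c where "c z = (LINT u|dv. F z u) / of_real ((K z)\<^sup>2)" for z
  have K: "K z > 0" "cell_vol z \<le> (K z)\<^sup>2" if z: "z \<in> polydisk" for z
  proof -
    have l: "0 \<le> 1 - cmod (z $ i) \<and> 1 - cmod (z $ i) \<le> 1 - (cmod (z $ i))\<^sup>2 \<and> 0 < 1 - cmod (z $ i)"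
      for i
    proof -
      have "cmod (z $ i) * cmod (z $ i) \<le> 1 * cmod (z $ i)"
        using z by (intro mult_right_mono) (auto simp: polydisk_def intro: less_imp_le)
      then show ?thesis using z by (auto simp: polydisk_def power2_eq_square intro: less_imp_le)
    qed
    have l': "0 < 1 - (cmod (z $ i))\<^sup>2" for i using l[of i] by linarith
    show "K z > 0" unfolding K_def by (intro prod_pos l')
    show "cell_vol z \<le> (K z)\<^sup>2"
      unfolding cell_vol_def K_def prod_power_distrib using l
        by (intro prod_mono conjI power_mono) auto
  qed
  have cB: "cmod (c z) \<le> B" if z: "z \<in> \<Gamma>" for z
  proof -
    have zpd: "z \<in> polydisk" using z \<Gamma>pd by blast
    have "cmod (LINT u|dv. F z u) \<le> (LINT u|dv. cmod (F z u))" by (rule integral_norm_bound)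
    also have "\<dots> \<le> B * measure dv (E z)" by (rule absF)
    also have "\<dots> \<le> B * measure dv (cell z \<epsilon>)"
      by (intro mult_left_mono dv.finite_measure_mono Esub B0) simp
    also have "\<dots> \<le> B * ((\<epsilon>\<^sup>2) ^ CARD('n) * cell_vol z)"
      using \<epsilon> by (intro mult_left_mono measure_dv_cell_le zpd B0) auto
    also have "\<dots> \<le> B * (1 * (K z)\<^sup>2)"
      using \<epsilon> K[OF zpd] cell_vol_pos[OF zpd] B0
      by (intro mult_left_mono mult_mono power_le_one) (auto simp: abs_square_le_1)
    finally show ?thesis
      using K(1)[OF zpd] by (simp add: c_def norm_divide norm_power divide_le_eq)
  qed
  obtain A :: real where A: "0 \<le> A" "\<And>w h F. close_family 0 \<Gamma> w
     \<Longrightarrow> finite F \<Longrightarrow> F \<subseteq> \<Gamma> \<Longrightarrow> (\<Sum>z\<in>F. (cmod (cinner h (kernel (w z))))\<^sup>2) \<le> A * (norm h)\<^sup>2"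
    using separated_bessel_kernel[OF sep order_refl zero_less_one] by blast
  have bes: "(\<Sum>z\<in>S. (cmod (cinner h (kernel z)))\<^sup>2) \<le> A * (norm h)\<^sup>2" if "finite S" "S \<subseteq> \<Gamma>" for S h
    using A(2)[of "\<lambda>z. z" S h] that \<Gamma>pd by (auto simp: close_family_def)
  have "\<exists>T. \<forall>h. ((\<lambda>z. c z *\<^sub>c (cinner h (kernel z) *\<^sub>c kernel z)) has_sum blinfun_apply T h) \<Gamma>"
  proof (rule bessel_operator[OF A(1) bes bes cB])
    fix T :: "'n bergman \<Rightarrow>\<^sub>L 'n bergman"
    assume "\<And>h. ((\<lambda>z. c z *\<^sub>c (cinner h (kernel z) *\<^sub>c kernel z)) has_sum blinfun_apply T h) \<Gamma>"
    then show ?thesis by blast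
  qed
  then obtain T :: "'n bergman \<Rightarrow>\<^sub>L 'n bergman"
    where T: "\<And>h. ((\<lambda>z. c z *\<^sub>c (cinner h (kernel z) *\<^sub>c kernel z)) has_sum blinfun_apply T h) \<Gamma>"
    by blast
  have "T \<in> D0"
    unfolding D0_def mem_Collect_eq
  proof (intro exI conjI)
    show "separated_set \<Gamma>" by (rule sep)
    show "bounded (c ` \<Gamma>)" using cB by (auto simp: bounded_iff)
    show "(\<lambda>z. z) ` \<Gamma> \<subseteq> polydisk" using \<Gamma>pd by auto
    show "(0::real) \<le> 0" by simp
    show "\<forall>z\<in>\<Gamma>. polydist z ((\<lambda>z. z) z) \<le> 0" by (simp add: polydist_def beta_eq_artanh)
    show "\<forall>h. ((\<lambda>z. blinfun_apply (op_cscale (c z) (kernel z \<otimes>\<^sub>b kernel ((\<lambda>z. z) z))) h)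
        has_sum blinfun_apply T h) \<Gamma>"
      using T by (simp add: op_cscale_apply rank_one_apply)
  qed
  moreover have "cmod (symbol_form f h g - cinner (blinfun_apply T h) g)
      \<le> 16 ^ Suc CARD('n) * \<epsilon> * (B * 64 ^ CARD('n)) * ((norm h)\<^sup>2 + (norm g)\<^sup>2)" for h g
  proof (rule quadrature[OF cnt, of "\<lambda>z. z" F])
    show "((\<lambda>z. (LINT u|dv. F z u) * (bergman_fun h z * cnj (bergman_fun g z)))
        has_sum cinner (blinfun_apply T h) g) \<Gamma>"
    proof (rule has_sum_cong[THEN iffD1, OF _ has_sum_cinner[OF T[of h], of g]])
      fix z assume z: "z \<in> \<Gamma>"
      then have zpd: "z \<in> polydisk" using \<Gamma>pd by blast
      have "c z * of_real ((K z)\<^sup>2) = (LINT u|dv. F z u)" using K(1)[OF zpd] by (simp add: c_def)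
      moreover have "c z * (cinner h (kernel z) * cnj (cinner g (kernel z)))
          = c z * of_real ((K z)\<^sup>2) * (bergman_fun h z * cnj (bergman_fun g z))"
        unfolding cinner_kernel[OF zpd] K_def[symmetric] by (simp add: power2_eq_square mult_ac)
      ultimately show "c z * (cinner h (kernel z) * cnj (cinner g (kernel z)))
          = (LINT u|dv. F z u) * (bergman_fun h z * cnj (bergman_fun g z))"
        by simp
    qed
  qed (use \<Gamma>pd Fm Fsupp \<epsilon> sumF Nbound hsF in auto)
  ultimately show ?thesis using that by blast
qed

text \<open>The sampling operators at all scales approximate the same form, so they are Cauchy in
  operator norm. Their limit has exactly this form and is therefore the Toeplitz operator, whose
  boundedness is obtained along the way.\<close>

lemma toeplitz_closure_D0:
  fixes f :: "complex ^ 'n::finite \<Rightarrow> complex"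
  assumes f: "f \<in> Linfty"
  shows "toeplitz f \<in> closure D0" and "cinner (blinfun_apply (toeplitz f) h) g = symbol_form f h g"
proof -
  obtain B where fm: "f \<in> borel_measurable dv" and B: "AE u in dv. cmod (f u) \<le> B"
    using f by (auto simp: Linfty_def)
  \<comment> \<open>The symbol is bounded only almost everywhere and arbitrary off the polydisk;
    this representative satisfies the bounds everywhere and has the same form.\<close>
  define f0 where "f0 u = (if u \<in> polydisk \<and> cmod (f u) \<le> \<bar>B\<bar> then f u else 0)" for u
  have [measurable]: "f \<in> borel_measurable borel" using fm by (simp cong: measurable_cong_sets)
  have f0m: "f0 \<in> borel_measurable borel" unfolding f0_def by measurable
  have form_eq: "symbol_form f h g = symbol_form f0 h g" for h g :: "'n bergman"
    unfolding symbol_form_def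
  proof (rule integral_cong_AE)
    show "AE u in dv. f u * (bergman_fun h u * cnj (bergman_fun g u))
        = f0 u * (bergman_fun h u * cnj (bergman_fun g u))"
      using B AE_dv_polydisk by eventually_elim (auto simp: f0_def)
    have f0m': "f0 \<in> borel_measurable dv" using f0m by (simp cong: measurable_cong_sets)
    show "(\<lambda>u. f u * (bergman_fun h u * cnj (bergman_fun g u))) \<in> borel_measurable dv"
      by (rule borel_measurable_integrable[OF integrable_symbol_form[OF fm B]])
    show "(\<lambda>u. f0 u * (bergman_fun h u * cnj (bergman_fun g u))) \<in> borel_measurable dv"
      by (rule borel_measurable_integrable[OF integrable_symbol_form[OF f0m', of "\<bar>B\<bar>"]])
        (auto simp: f0_def)
  qed
  define M where "M = 16 ^ Suc CARD('n) * (\<bar>B\<bar> * 64 ^ CARD('n))"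
  have M: "M \<ge> 0" by (simp add: M_def)
  \<comment> \<open>This is 1 / (m + 16), so the mesh is at most 1/16 from the start.\<close>
  define \<epsilon> where "\<epsilon> m = inverse (real (Suc (m + 15)))" for m
  have \<epsilon>: "0 < \<epsilon> m" "\<epsilon> m \<le> 1/16" for m by (auto simp: \<epsilon>_def field_simps)
  have \<epsilon>0: "\<epsilon> \<longlonglongrightarrow> 0"
    unfolding \<epsilon>_def by (rule LIMSEQ_ignore_initial_segment[OF LIMSEQ_inverse_real_of_nat])
  have "\<exists>T\<in>D0. \<forall>h g :: 'n bergman. cmod (symbol_form f0 h g - cinner (blinfun_apply T h) g)
      \<le> M * \<epsilon> m * ((norm h)\<^sup>2 + (norm g)\<^sup>2)" for m
  proof -
    obtain T :: "'n bergman \<Rightarrow>\<^sub>L 'n bergman" where "T \<in> D0"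
      "\<And>h g. cmod (symbol_form f0 h g - cinner (blinfun_apply T h) g)
          \<le> 16 ^ Suc CARD('n) * \<epsilon> m * (\<bar>B\<bar> * 64 ^ CARD('n)) * ((norm h)\<^sup>2 + (norm g)\<^sup>2)"
      by (rule symbol_form_approx[OF f0m _ _ \<epsilon>, of "\<bar>B\<bar>" m]) (auto simp: f0_def)
    then show ?thesis unfolding M_def by (intro bexI[of _ T] allI) (auto simp: mult_ac)
  qed
  then obtain T :: "nat \<Rightarrow> 'n bergman \<Rightarrow>\<^sub>L 'n bergman" where TD: "\<And>m. T m \<in> D0"
    and T: "\<And>m h g. cmod (symbol_form f0 h g - cinner (blinfun_apply (T m) h) g)
        \<le> M * \<epsilon> m * ((norm h)\<^sup>2 + (norm g)\<^sup>2)"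
    by metis
  have dist: "dist (T m) (T k) \<le> 2 * (M * (\<epsilon> m + \<epsilon> k))" for m k
    unfolding dist_norm
  proof (rule norm_blinfun_le_form)
    show "0 \<le> M * (\<epsilon> m + \<epsilon> k)" using M \<epsilon> by (simp add: less_imp_le)
    fix h g :: "'n bergman"
    have "cinner (blinfun_apply (T m - T k) h) g
        = (symbol_form f0 h g - cinner (blinfun_apply (T k) h) g) -
          (symbol_form f0 h g - cinner (blinfun_apply (T m) h) g)"
      by (simp add: blinfun.diff_left cinner_diff_left)
    then have "cmod (cinner (blinfun_apply (T m - T k) h) g)
        \<le> cmod (symbol_form f0 h g - cinner (blinfun_apply (T k) h) g) + cmod
          (symbol_form f0 h g - cinner (blinfun_apply (T m) h) g)"
      using norm_triangle_ineq4 by metis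
    also have "\<dots> \<le> M * \<epsilon> k * ((norm h)\<^sup>2 + (norm g)\<^sup>2) + M * \<epsilon> m * ((norm h)\<^sup>2 + (norm g)\<^sup>2)"
      by (intro add_mono T)
    finally show "cmod (cinner (blinfun_apply (T m - T k) h) g)
        \<le> M * (\<epsilon> m + \<epsilon> k) * ((norm h)\<^sup>2 + (norm g)\<^sup>2)"
      by (simp add: algebra_simps)
  qed
  have "Cauchy T"
  proof (rule metric_CauchyI)
    fix e :: real assume e: "e > 0"
    have "(\<lambda>m. 4 * M * \<epsilon> m) \<longlonglongrightarrow> 4 * M * 0" by (intro tendsto_intros \<epsilon>0)
    then have "\<forall>\<^sub>F m in sequentially. 4 * M * \<epsilon> m < e" using e by (auto dest: order_tendstoD(2))
    then obtain N where N: "\<And>m. m \<ge> N \<Longrightarrow> 4 * M * \<epsilon> m < e" unfolding eventually_sequentially by blast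
    have "dist (T m) (T k) < e" if "m \<ge> N" "k \<ge> N" for m k
    proof -
      have "dist (T m) (T k) \<le> (4 * M * \<epsilon> m + 4 * M * \<epsilon> k) / 2" using dist[of m k]
        by (simp add: algebra_simps)
      also have "\<dots> < e" using N[OF that(1)] N[OF that(2)] by simp
      finally show ?thesis .
    qed
    then show "\<exists>N. \<forall>m\<ge>N. \<forall>k\<ge>N. dist (T m) (T k) < e" by blast
  qed
  then obtain L where L: "T \<longlonglongrightarrow> L" using Cauchy_convergent_iff convergent_def by blast
  have form: "cinner (blinfun_apply L h) g = symbol_form f h g" for h g
  proof -
    have "(\<lambda>m. cinner (blinfun_apply (T m) h) g) \<longlonglongrightarrow> cinner (blinfun_apply L h) g"
      by (intro bounded_linear.tendsto[OF bounded_linear_cinner_left] blinfun.tendsto L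
        tendsto_const)
    moreover have "(\<lambda>m. cinner (blinfun_apply (T m) h) g) \<longlonglongrightarrow> symbol_form f0 h g"
    proof -
      have "(\<lambda>m. M * \<epsilon> m * ((norm h)\<^sup>2 + (norm g)\<^sup>2)) \<longlonglongrightarrow> M * 0 * ((norm h)\<^sup>2 + (norm g)\<^sup>2)"
        by (intro tendsto_intros \<epsilon>0)
      then have "(\<lambda>m. symbol_form f0 h g - cinner (blinfun_apply (T m) h) g) \<longlonglongrightarrow> 0"
        by (intro Lim_null_comparison[OF always_eventually[OF allI[OF T]]]) simp
      from tendsto_diff[OF tendsto_const[of "symbol_form f0 h g"] this] show ?thesis by simp
    qed
    ultimately show ?thesis unfolding form_eq using LIMSEQ_unique by blast
  qed
  have tp: "toeplitz f = L" by (rule toeplitz_eqI[OF f form])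
  show "toeplitz f \<in> closure D0"
    unfolding tp closure_sequential using TD L by blast
  show "cinner (blinfun_apply (toeplitz f) h) g = symbol_form f h g"
    unfolding tp by (rule form)
qed

subsection \<open>Localized operators as limits of Toeplitz operators\<close>

text \<open>The symbol spreads the mass c(z) \<open>cell_vol (w z)\<close> evenly over
  \<open>cell (w z) \<epsilon>\<close>. Its sup norm may grow like \<epsilon> to the power -2n, but
  quadrature sees only the masses relative to \<open>cell_vol\<close>, and these stay bounded. The
  Toeplitz operators of these symbols therefore converge to \<open>S\<close> in norm.\<close>

lemma diagonal_sum_in_closed:
  fixes A :: "('n::finite bergman \<Rightarrow>\<^sub>L 'n bergman) set"
  assumes A: "closed A" "toeplitz ` Linfty \<subseteq> A"
    and sep: "separated_set \<Gamma>" and t: "0 \<le> t" "t < 1"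
    and cf: "close_family t \<Gamma> w"
    and cB: "\<And>z. z \<in> \<Gamma> \<Longrightarrow> cmod (c z) \<le> B"
    and S: "\<And>h g. ((\<lambda>z. c z * of_real (cell_vol (w z))
        * (bergman_fun h (w z) * cnj (bergman_fun g (w z))))
        has_sum cinner (blinfun_apply S h) g) \<Gamma>"
  shows "S \<in> A"
proof -
  interpret dv: prob_space "dv :: (complex ^ 'n) measure" by (rule prob_space_dv)
  have cnt: "countable \<Gamma>" by (rule separated_countable[OF sep])
  obtain N :: real where N: "\<And>w x F. close_family t \<Gamma> w
     \<Longrightarrow> finite F \<Longrightarrow> F \<subseteq> \<Gamma> \<Longrightarrow> (\<Sum>z\<in>F. indicator (cell (w z) (3/4)) x) \<le> N"
    using separated_overlap[OF sep t] by blast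
  note w = close_familyD[OF cf] and Nw = N[OF cf]
  have N0: "N \<ge> 0" using Nw[of "{}" 0] by simp
  define B' where "B' = max B 0"
  have B': "B' \<ge> 0" "\<And>z. z \<in> \<Gamma> \<Longrightarrow> cmod (c z) \<le> B'" using cB
    by (auto simp: B'_def intro: max.coboundedI1)
  define M where "M = 16 ^ Suc CARD('n) * (B' * N)"
  have M: "M \<ge> 0" using B' N0 by (simp add: M_def)
  have approx: "\<exists>T\<in>A. norm (T - S) \<le> 2 * (M * \<epsilon>)" if \<epsilon>: "0 < \<epsilon>" "\<epsilon> \<le> 1/16" for \<epsilon>
  proof -
    define r where "r = \<epsilon> ^ (2 * CARD('n))"
    have r: "r > 0" using \<epsilon> by (simp add: r_def)
    \<comment> \<open>\<open>r\<close> is the measure of the small cell divided by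
      \<open>cell_vol (w z)\<close>, so the integral of \<open>F z\<close> is c(z)
      \<open>cell_vol (w z)\<close>.\<close>
    define F where "F z u = of_real (indicator (cell (w z) \<epsilon>) u) * (c z / of_real r)" for z u
    have Fm: "F z \<in> borel_measurable borel" for z
      unfolding F_def by measurable
    have absF: "cmod (F z u) = indicator (cell (w z) \<epsilon>) u * (cmod (c z) / r)" for z u
      using r by (simp add: F_def norm_mult norm_divide indicator_def)
    have mc: "measure dv (cell (w z) \<epsilon>) = r * cell_vol (w z)" if "z \<in> \<Gamma>" for z
      unfolding r_def using \<epsilon> w[OF that] by (intro measure_dv_cell) auto
    have intF: "(LINT u|dv. F z u) = c z * of_real (cell_vol (w z))" if z: "z \<in> \<Gamma>" for z
      using mc[OF z] r by (simp add: F_def)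
    have intabsF: "(LINT u|dv. cmod (F z u)) = cmod (c z) * cell_vol (w z)" if z: "z \<in> \<Gamma>" for z
      unfolding absF using mc[OF z] r by simp
    have sumF: "(\<Sum>z\<in>S. cmod (F z u)) \<le> B' / r * N" if S: "finite S" "S \<subseteq> \<Gamma>" for S u
    proof -
      have "(\<Sum>z\<in>S. cmod (F z u)) \<le> (\<Sum>z\<in>S. B' / r * indicator (cell (w z) (3/4)) u)"
      proof (rule sum_mono)
        fix z assume "z \<in> S"
        then have z: "z \<in> \<Gamma>" using S by blast
        have "indicator (cell (w z) \<epsilon>) u \<le> (indicator (cell (w z) (3/4)) u :: real)"
          using cell_mono[of "w z" \<epsilon> "3/4"] w[OF z] \<epsilon> by (auto simp: indicator_def)
        moreover have "cmod (c z) / r \<le> B' / r" using B'(2)[OF z] r by (simp add: divide_right_mono)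
        ultimately have "indicator (cell (w z) \<epsilon>) u * (cmod (c z) / r)
            \<le> indicator (cell (w z) (3/4)) u * (B' / r)"
          using r by (intro mult_mono) auto
        then show "cmod (F z u) \<le> B' / r * indicator (cell (w z) (3/4)) u"
          by (simp add: absF mult.commute)
      qed
      also have "\<dots> \<le> B' / r * N"
        unfolding sum_distrib_left[symmetric] using B' r by (intro mult_left_mono Nw S) auto
      finally show ?thesis .
    qed
    define f where "f u = (\<Sum>\<^sub>\<infinity>z\<in>\<Gamma>. F z u)" for u
    have hsF: "((\<lambda>z. F z u) has_sum f u) \<Gamma>" for u
      unfolding f_def
    proof (rule has_sum_infsum, rule abs_summable_summable, rule nonneg_bdd_above_summable_on)
      show "bdd_above (sum (\<lambda>z. norm (F z u)) ` {F. F \<subseteq> \<Gamma> \<and> finite F})"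
        by (rule bdd_aboveI2[of _ _ "B' / r * N"]) (use sumF in auto)
    qed simp
    have fm: "f \<in> borel_measurable borel"
      by (rule borel_measurable_has_sum[OF cnt Fm hsF])
    have fb: "cmod (f u) \<le> B' / r * N" for u
      by (rule has_sum_norm_le[OF hsF]) (use order_trans[OF norm_sum sumF] in blast)
    have fL: "f \<in> Linfty"
      unfolding Linfty_def using fm fb by (auto simp: measurable_cong_sets[OF sets_dv refl] intro!:
        exI[of _ "B' / r * N"])
    have "norm (toeplitz f - S) \<le> 2 * (M * \<epsilon>)"
    proof (rule norm_blinfun_le_form)
      show "0 \<le> M * \<epsilon>" using M \<epsilon> by simp
      fix h g :: "'n bergman"
      have "cmod (symbol_form f h g - cinner (blinfun_apply S h) g)
          \<le> 16 ^ Suc CARD('n) * \<epsilon> * (B' * N) * ((norm h)\<^sup>2 + (norm g)\<^sup>2)"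
      proof (rule quadrature[OF cnt, of w F])
        show "((\<lambda>z. (LINT u|dv. F z u) * (bergman_fun h (w z) * cnj (bergman_fun g (w z))))
            has_sum cinner (blinfun_apply S h) g) \<Gamma>"
          by (rule has_sum_cong[THEN iffD1, OF _ S]) (simp add: intF)
        show "u \<in> cell (w z) \<epsilon>" if "F z u \<noteq> 0" for z u
          using that by (auto simp: F_def indicator_def split: if_splits)
        show "(\<Sum>z\<in>S. (LINT u|dv. cmod (F z u)) / cell_vol (w z) * indicator (cell (w z) (3/4)) x)
            \<le> B' * N"
          if S: "finite S" "S \<subseteq> \<Gamma>" for S x
        proof -
          have "(\<Sum>z\<in>S. (LINT u|dv. cmod (F z u)) / cell_vol (w z) * indicator (cell (w z) (3/4)) x)
              \<le> (\<Sum>z\<in>S. B' * indicator (cell (w z) (3/4)) x)"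
          proof (rule sum_mono)
            fix z assume "z \<in> S"
            then have z: "z \<in> \<Gamma>" using S by blast
            have "cell_vol (w z) > 0" using w[OF z] by (intro cell_vol_pos) blast
            then have "(LINT u|dv. cmod (F z u)) / cell_vol (w z) = cmod (c z)"
              by (simp add: intabsF[OF z])
            then show "(LINT u|dv. cmod (F z u)) / cell_vol (w z) * indicator (cell (w z) (3/4)) x
                \<le> B' * indicator (cell (w z) (3/4)) x"
              using B'(2)[OF z] by (simp add: mult_right_mono)
          qed
          also have "\<dots> \<le> B' * N"
            unfolding sum_distrib_left[symmetric] by (intro mult_left_mono Nw S B')
          finally show ?thesis .
        qed
      qed (use w Fm \<epsilon> sumF hsF in auto)
      then show "cmod (cinner (blinfun_apply (toeplitz f - S) h) g)
          \<le> M * \<epsilon> * ((norm h)\<^sup>2 + (norm g)\<^sup>2)"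
        by (simp add: blinfun.diff_left cinner_diff_left toeplitz_closure_D0(2)[OF fL] M_def
          mult_ac)
    qed
    then show ?thesis using fL A(2) by blast
  qed
  have "S \<in> closure A"
    unfolding closure_approachable
  proof (intro allI impI)
    fix e :: real assume e: "e > 0"
    define \<epsilon> where "\<epsilon> = min (1/16) (e / (4 * (M + 1)))"
    have \<epsilon>: "0 < \<epsilon>" using e M by (simp add: \<epsilon>_def)
    have \<epsilon>16: "\<epsilon> \<le> 1/16" unfolding \<epsilon>_def by (rule min.cobounded1)
    obtain T where T: "T \<in> A" "norm (T - S) \<le> 2 * (M * \<epsilon>)" using approx[OF \<epsilon> \<epsilon>16] by blast
    have "M * \<epsilon> \<le> (M + 1) * (e / (4 * (M + 1)))"
      using M e \<epsilon> by (intro mult_mono) (auto simp: \<epsilon>_def)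
    also have "\<dots> = e / 4" using M by (simp add: field_simps)
    finally have "norm (T - S) < e" using T e by simp
    then show "\<exists>T\<in>A. dist T S < e" using T by (auto simp: dist_norm)
  qed
  then show ?thesis using A by simp
qed

section \<open>Approximating functionals by evaluations at real points\<close>

definition point_comb :: "(real \<times> complex) list \<Rightarrow> (complex \<Rightarrow> complex) \<Rightarrow> complex" where
  "point_comb L G = (\<Sum>(x, m)\<leftarrow>L. m * G (of_real x))"

definition bounded_holomorphic :: "real \<Rightarrow> (complex \<Rightarrow> complex) \<Rightarrow> real \<Rightarrow> bool" where
  "bounded_holomorphic R G B \<longleftrightarrow> G holomorphic_on ball 0 R \<and> (\<forall>x\<in>ball 0 R. cmod (G x) \<le> B)"

text \<open>The nodes and weights are chosen before the function, and the error scales with its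
  bound. This uniformity later turns an estimate for scalar functions into one for operators. The
  nodes are the parameters at which diagonal sums are available.\<close>

definition point_approx :: "real \<Rightarrow> ((complex \<Rightarrow> complex) \<Rightarrow> complex) \<Rightarrow> bool" where
  "point_approx R \<phi> \<longleftrightarrow> (\<forall>\<epsilon>>0. \<exists>L. fst ` set L \<subseteq> {-1<..<1} \<and>
     (\<forall>G B. bounded_holomorphic R G B \<longrightarrow> cmod (point_comb L G - \<phi> G) \<le> \<epsilon> * B))"

lemma bounded_holomorphic_nonneg: "bounded_holomorphic R G B \<Longrightarrow> 0 < R \<Longrightarrow> 0 \<le> B"
  unfolding bounded_holomorphic_def using order_trans[OF norm_ge_zero, of "G 0" B] by auto

lemma point_comb_append: "point_comb (L @ L') G = point_comb L G + point_comb L' G"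
  by (simp add: point_comb_def)

lemma point_comb_scale: "point_comb (map (\<lambda>(x, m). (x, a * m)) L) G = a * point_comb L G"
  by (induction L) (auto simp: point_comb_def algebra_simps)

lemma point_approx_eval:
  assumes "-1 < x" "x < 1" "0 < R"
  shows "point_approx R (\<lambda>G. G (of_real x))"
  unfolding point_approx_def
  by (intro allI impI exI[of _ "[(x, 1)]"] conjI)
    (use assms bounded_holomorphic_nonneg in \<open>auto simp: point_comb_def\<close>)

lemma point_approx_scale:
  assumes l: "point_approx R \<phi>" and R: "0 < R"
  shows "point_approx R (\<lambda>G. a * \<phi> G)"
  unfolding point_approx_def
proof (intro allI impI)
  fix \<epsilon> :: real assume \<epsilon>: "\<epsilon> > 0"
  let ?\<delta> = "\<epsilon> / (cmod a + 1)"
  have a: "cmod a + 1 > 0" by (simp add: add_nonneg_pos)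
  obtain L where L: "fst ` set L \<subseteq> {-1<..<1}" "\<And>G B. bounded_holomorphic R G B \<Longrightarrow>
      cmod (point_comb L G - \<phi> G) \<le> ?\<delta> * B"
    using l \<epsilon> a unfolding point_approx_def by (meson divide_pos_pos)
  show "\<exists>L. fst ` set L \<subseteq> {-1<..<1} \<and> (\<forall>G B. bounded_holomorphic R G B \<longrightarrow> cmod (point_comb L G
      - a * \<phi> G) \<le> \<epsilon> * B)"
  proof (intro exI[of _ "map (\<lambda>(x, m). (x, a * m)) L"] conjI allI impI)
    show "fst ` set (map (\<lambda>(x, m). (x, a * m)) L) \<subseteq> {-1<..<1}" using L(1) by force
    fix G B assume adm: "bounded_holomorphic R G B"
    have B: "B \<ge> 0" by (rule bounded_holomorphic_nonneg[OF adm R])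
    have "cmod (point_comb (map (\<lambda>(x, m). (x, a * m)) L) G - a * \<phi> G)
        = cmod a * cmod (point_comb L G - \<phi> G)"
      by (simp add: point_comb_scale flip: right_diff_distrib norm_mult)
    also have "\<dots> \<le> (cmod a + 1) * (?\<delta> * B)"
      using L(2)[OF adm] by (intro mult_mono) auto
    also have "\<dots> = \<epsilon> * B" using a by simp
    finally show "cmod (point_comb (map (\<lambda>(x, m). (x, a * m)) L) G - a * \<phi> G) \<le> \<epsilon> * B" .
  qed
qed

lemma point_approx_add:
  assumes l: "point_approx R \<phi>" "point_approx R \<phi>'"
  shows "point_approx R (\<lambda>G. \<phi> G + \<phi>' G)"
  unfolding point_approx_def
proof (intro allI impI)
  fix \<epsilon> :: real assume \<epsilon>: "\<epsilon> > 0"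
  obtain L where L: "fst ` set L \<subseteq> {-1<..<1}" "\<And>G B. bounded_holomorphic R G B \<Longrightarrow>
      cmod (point_comb L G - \<phi> G) \<le> \<epsilon> / 2 * B"
    using l(1) \<epsilon> unfolding point_approx_def by (meson half_gt_zero)
  obtain L' where L': "fst ` set L' \<subseteq> {-1<..<1}" "\<And>G B. bounded_holomorphic R G B \<Longrightarrow>
      cmod (point_comb L' G - \<phi>' G) \<le> \<epsilon> / 2 * B"
    using l(2) \<epsilon> unfolding point_approx_def by (meson half_gt_zero)
  show "\<exists>L. fst ` set L \<subseteq> {-1<..<1} \<and> (\<forall>G B. bounded_holomorphic R G B \<longrightarrow> cmod (point_comb L G
      - (\<phi> G + \<phi>' G)) \<le> \<epsilon> * B)"
  proof (intro exI[of _ "L @ L'"] conjI allI impI)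
    show "fst ` set (L @ L') \<subseteq> {-1<..<1}" using L(1) L'(1) by auto
    fix G B assume adm: "bounded_holomorphic R G B"
    have "cmod (point_comb (L @ L') G - (\<phi> G + \<phi>' G))
        \<le> cmod (point_comb L G - \<phi> G) + cmod (point_comb L' G - \<phi>' G)"
      using norm_triangle_ineq[of "point_comb L G - \<phi> G" "point_comb L' G - \<phi>' G"]
        by (simp add: point_comb_append algebra_simps)
    then show "cmod (point_comb (L @ L') G - (\<phi> G + \<phi>' G)) \<le> \<epsilon> * B" using L(2)[OF adm] L'(2)[OF adm]
      by simp
  qed
qed

lemma point_approx_sum:
  assumes R: "0 < R" and "\<And>k. k \<in> I \<Longrightarrow> point_approx R (\<phi> k)" and "finite I"
  shows "point_approx R (\<lambda>G. \<Sum>k\<in>I. \<phi> k G)"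
  using assms(3,2)
proof (induction I rule: finite_induct)
  case empty
  show ?case
    \<comment> \<open>The zero functional is 0 times the evaluation at 0.\<close>
    using point_approx_scale[OF point_approx_eval[of 0, OF _ _ R] R, of 0] by simp
next
  case (insert k I)
  then show ?case using point_approx_add[of R "\<phi> k" "\<lambda>G. \<Sum>k\<in>I. \<phi> k G"] by simp
qed

lemma point_approx_limit:
  assumes "\<And>\<epsilon>. \<epsilon> > 0 \<Longrightarrow> \<exists>\<phi>'. point_approx R \<phi>'
      \<and> (\<forall>G B. bounded_holomorphic R G B \<longrightarrow> cmod (\<phi>' G - \<phi> G) \<le> \<epsilon> * B)"
  shows "point_approx R \<phi>"
  unfolding point_approx_def
proof (intro allI impI)
  fix \<epsilon> :: real assume \<epsilon>: "\<epsilon> > 0"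
  obtain \<phi>' where l': "point_approx R \<phi>'" "\<And>G B. bounded_holomorphic R G B \<Longrightarrow>
      cmod (\<phi>' G - \<phi> G) \<le> \<epsilon> / 2 * B"
    using assms[of "\<epsilon> / 2"] \<epsilon> by auto
  obtain L where L: "fst ` set L \<subseteq> {-1<..<1}" "\<And>G B. bounded_holomorphic R G B \<Longrightarrow>
      cmod (point_comb L G - \<phi>' G) \<le> \<epsilon> / 2 * B"
    using l'(1) \<epsilon> unfolding point_approx_def by (meson half_gt_zero)
  show "\<exists>L. fst ` set L \<subseteq> {-1<..<1} \<and> (\<forall>G B. bounded_holomorphic R G B \<longrightarrow> cmod (point_comb L G - \<phi> G)
      \<le> \<epsilon> * B)"
  proof (intro exI[of _ L] conjI allI impI L(1))
    fix G B assume adm: "bounded_holomorphic R G B"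
    have "cmod (point_comb L G - \<phi> G) \<le> cmod (point_comb L G - \<phi>' G) + cmod (\<phi>' G - \<phi> G)"
      using norm_triangle_ineq[of "point_comb L G - \<phi>' G" "\<phi>' G - \<phi> G"] by simp
    then show "cmod (point_comb L G - \<phi> G) \<le> \<epsilon> * B" using L(2)[OF adm] l'(2)[OF adm] by simp
  qed
qed

lemma sums_geometric_tail:
  fixes c :: "nat \<Rightarrow> complex"
  assumes c: "c sums s" and bd: "\<And>k. cmod (c k) \<le> B * q ^ k" and q: "0 \<le> q" "q < 1"
  shows "cmod (s - (\<Sum>k<K. c k)) \<le> B * q ^ K / (1 - q)"
proof -
  have sm: "summable (\<lambda>k. B * q ^ (k + K))"
    using summable_mult[OF summable_mult2[OF summable_geometric[of q], of "q ^ K"], of B] q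
    by (simp add: power_add)
  have "s - (\<Sum>k<K. c k) = (\<Sum>k. c (k + K))"
    using suminf_minus_initial_segment[OF sums_summable[OF c], of K] sums_unique[OF c] by simp
  also have "cmod \<dots> \<le> (\<Sum>k. B * q ^ (k + K))"
    by (rule norm_suminf_le[OF bd sm])
  also have "\<dots> = B * q ^ K * (\<Sum>k. q ^ k)"
    using q suminf_mult[OF summable_geometric[of q], of "B * q ^ K"]
      by (simp add: power_add mult_ac)
  also have "\<dots> = B * q ^ K / (1 - q)" using q by (simp add: suminf_geometric)
  finally show ?thesis .
qed

definition taylor_coeff :: "nat \<Rightarrow> (complex \<Rightarrow> complex) \<Rightarrow> complex" where
  "taylor_coeff k G = (deriv ^^ k) G 0 / fact k"

lemma taylor_tail:
  assumes adm: "bounded_holomorphic R G B" and r: "0 < r" "r < R" and x: "cmod x < r"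
  shows "cmod (G x - (\<Sum>k<K. taylor_coeff k G * x ^ k)) \<le> B * (cmod x / r) ^ K / (1 - cmod x / r)"
proof (rule sums_geometric_tail)
  have hol: "G holomorphic_on ball 0 R" using adm by (simp add: bounded_holomorphic_def)
  show "(\<lambda>k. taylor_coeff k G * x ^ k) sums G x"
    using holomorphic_power_series[OF hol, of x] x r by (simp add: taylor_coeff_def)
  fix k
  have "cmod ((deriv ^^ k) G 0) \<le> fact k * B / r ^ k"
  proof (rule Cauchy_inequality)
    show "G holomorphic_on ball 0 r" using hol r by (auto intro: holomorphic_on_subset)
    show "continuous_on (cball 0 r) G"
      using holomorphic_on_imp_continuous_on[OF hol] r by (auto intro: continuous_on_subset)
    show "cmod (G x) \<le> B" if "cmod (0 - x) = r" for x
      using adm that r by (auto simp: bounded_holomorphic_def)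
  qed (rule r)
  then have "cmod (taylor_coeff k G) \<le> B / r ^ k"
    by (simp add: taylor_coeff_def norm_divide divide_le_eq mult.commute)
  then have "cmod (taylor_coeff k G) * cmod x ^ k \<le> B / r ^ k * cmod x ^ k"
    by (intro mult_right_mono) auto
  then show "cmod (taylor_coeff k G * x ^ k) \<le> B * (cmod x / r) ^ k"
    by (simp add: norm_mult norm_power power_divide)
qed (use x r in auto)

text \<open>The coefficient of order k is the limit, as t decreases to 0, of G(t) minus its Taylor
  polynomial of degree below k, divided by t^k. The lower coefficients in this quotient are
  approximable by induction.\<close>

lemma point_approx_taylor:
  assumes R: "1 < R"
  shows "point_approx R (taylor_coeff k)"
proof (induction k rule: less_induct)
  case (less k)
  have R0: "0 < R" using R by simp
  show ?case
  proof (rule point_approx_limit)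
    fix \<epsilon> :: real assume \<epsilon>: "\<epsilon> > 0"
    \<comment> \<open>The error of the quotient is at most B t / (1 - t); t \<le> 1/2 turns this
      into 2 t B, and 2 t \<le> \<epsilon>.\<close>
    define t where "t = min (1/2) (\<epsilon> / 2)"
    have t: "0 < t" "t \<le> 1/2" "2 * t \<le> \<epsilon>" using \<epsilon> by (auto simp: t_def)
    define \<phi>' where "\<phi>' G = of_real (1 / t ^ k)
        * (G (of_real t) + (\<Sum>j<k. of_real (- (t ^ j)) * taylor_coeff j G))" for G
    have "point_approx R \<phi>'"
      unfolding \<phi>'_def
      by (intro point_approx_scale point_approx_add point_approx_sum point_approx_eval R0)
        (use t less.IH in auto)
    moreover have "cmod (\<phi>' G - taylor_coeff k G) \<le> \<epsilon> * B"
      if adm: "bounded_holomorphic R G B" for G B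
    proof -
      have B: "B \<ge> 0" by (rule bounded_holomorphic_nonneg[OF adm R0])
      \<comment> \<open>The tail estimate is taken with radius r = 1, which is possible because 1 <
        R.\<close>
      have tail: "cmod (G (of_real t) - (\<Sum>j<Suc k. taylor_coeff j G * of_real t ^ j))
          \<le> B * t ^ Suc k / (1 - t)"
        using taylor_tail[OF adm _ R, of "of_real t" "Suc k"] t by simp
      have "of_real (t ^ k) * (\<phi>' G - taylor_coeff k G)
          = G (of_real t) - (\<Sum>j<Suc k. taylor_coeff j G * of_real t ^ j)"
        using t by (simp add: \<phi>'_def algebra_simps sum_negf)
      then have "t ^ k * cmod (\<phi>' G - taylor_coeff k G) \<le> B * t ^ Suc k / (1 - t)"
        using tail t by (metis abs_of_pos norm_mult norm_of_real zero_less_power)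
      also have "\<dots> \<le> t ^ k * (B * (2 * t))"
      proof -
        have "1 / (1 - t) \<le> 2" using t by (simp add: divide_simps)
        then have "B * t ^ Suc k * (1 / (1 - t)) \<le> B * t ^ Suc k * 2"
          using B t by (intro mult_left_mono) auto
        then show ?thesis by (simp add: mult_ac)
      qed
      finally have "cmod (\<phi>' G - taylor_coeff k G) \<le> B * (2 * t)" using t by simp
      also have "\<dots> \<le> B * \<epsilon>" using B t by (intro mult_left_mono) auto
      finally show ?thesis by (simp add: mult.commute)
    qed
    ultimately show "\<exists>\<phi>'. point_approx R \<phi>' \<and> (\<forall>G B. bounded_holomorphic R G B \<longrightarrow> cmod (\<phi>' G
        - taylor_coeff k G) \<le> \<epsilon> * B)"
      by blast
  qed
qed

text \<open>A quantitative identity theorem: the Taylor coefficients at \<open>0\<close> are limits of difference quotients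
  along the real axis, and they determine the value at \<open>\<i>\<close>.\<close>

lemma point_approx_imaginary_unit:
  assumes R: "1 < R"
  shows "point_approx R (\<lambda>G. G \<i>)"
proof (rule point_approx_limit)
  fix \<epsilon> :: real assume \<epsilon>: "\<epsilon> > 0"
  have R0: "0 < R" using R by simp
  \<comment> \<open>Cauchy's inequality on a circle of radius r > 1 makes the coefficients decay
    geometrically, so the Taylor series converges at \<i> with ratio 1 / r.\<close>
  obtain r where r: "1 < r" "r < R" using R dense by blast
  define q where "q = 1 / r"
  have q: "0 < q" "q < 1" using r by (auto simp: q_def)
  have "(\<lambda>K. q ^ K / (1 - q)) \<longlonglongrightarrow> 0 / (1 - q)"
    using q by (intro tendsto_divide LIMSEQ_power_zero) auto
  then have "\<forall>\<^sub>F K in sequentially. q ^ K / (1 - q) < \<epsilon>" using \<epsilon> by (auto dest: order_tendstoD(2))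
  then obtain K where K: "q ^ K / (1 - q) < \<epsilon>" unfolding eventually_sequentially by blast
  have "point_approx R (\<lambda>G. \<Sum>k<K. \<i> ^ k * taylor_coeff k G)"
    by (intro point_approx_sum point_approx_scale point_approx_taylor R R0) auto
  moreover have "cmod ((\<Sum>k<K. \<i> ^ k * taylor_coeff k G) - G \<i>) \<le> \<epsilon> * B"
    if adm: "bounded_holomorphic R G B" for G B
  proof -
    have B: "B \<ge> 0" by (rule bounded_holomorphic_nonneg[OF adm R0])
    have "cmod ((\<Sum>k<K. \<i> ^ k * taylor_coeff k G) - G \<i>)
        = cmod (G \<i> - (\<Sum>k<K. taylor_coeff k G * \<i> ^ k))"
      by (simp add: norm_minus_commute mult.commute)
    also have "\<dots> \<le> B * q ^ K / (1 - q)"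
      using taylor_tail[OF adm _ r(2), of \<i> K] r by (simp add: q_def)
    also have "\<dots> = B * (q ^ K / (1 - q))" by simp
    also have "\<dots> \<le> B * \<epsilon>" using K B by (intro mult_left_mono) auto
    finally show ?thesis by (simp add: mult.commute)
  qed
  ultimately show "\<exists>\<phi>'. point_approx R \<phi>' \<and> (\<forall>G B. bounded_holomorphic R G B \<longrightarrow> cmod (\<phi>' G - G \<i>)
      \<le> \<epsilon> * B)"
    by blast
qed

section \<open>Moebius curves of points and their holomorphic weights\<close>

definition mob_point :: "complex ^ 'n \<Rightarrow> complex ^ 'n \<Rightarrow> complex \<Rightarrow> complex ^ 'n" where
  "mob_point z v s = (\<chi> i. phi (z $ i) (s * v $ i))"

text \<open>Up to sign the complex Jacobian of the coordinatewise map \<phi>_z at s v. It depends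
  holomorphically on s, and at s = 0 it is the normalizing factor of
  \<open>kernel z\<close>.\<close>

definition mob_weight :: "complex ^ 'n::finite \<Rightarrow> complex ^ 'n \<Rightarrow> complex \<Rightarrow> complex" where
  "mob_weight z v s = (\<Prod>i\<in>UNIV. of_real (1 - (cmod (z $ i))\<^sup>2) / (1 - s * v $ i * cnj (z $ i))\<^sup>2)"

text \<open>Since \<phi> is an involution, the pseudohyperbolic distance from \<open>z\<close> to
  the point is |s v_i| in each coordinate. The modulus of the weight is the normalizing factor at
  the new point up to the factors 1 - |s v_i|^2, which lie between 1 - t^2 and 1.\<close>

lemma mob_point_props:
  fixes z v :: "complex ^ 'n::finite"
  assumes z: "z \<in> polydisk" and s: "\<And>i. cmod (s * v $ i) \<le> t" and t: "t < 1"
  shows "mob_point z v s \<in> polydisk" "cmod (phi (z $ i) (mob_point z v s $ i)) \<le> t"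
    "cmod (mob_weight z v s) = (\<Prod>i\<in>UNIV. (1 - (cmod (mob_point z v s $ i))\<^sup>2)
        / (1 - (cmod (s * v $ i))\<^sup>2))"
    "(cmod (mob_weight z v s))\<^sup>2 \<le> (4 / (1 - t\<^sup>2)\<^sup>2) ^ CARD('n) * cell_vol (mob_point z v s)"
proof -
  have zi: "cmod (z $ i) < 1" and si: "cmod (s * v $ i) < 1" for i
    using z le_less_trans[OF s t] by (auto simp: polydisk_def)
  show pd: "mob_point z v s \<in> polydisk"
    using norm_phi_less_1[OF zi si] by (simp add: mob_point_def polydisk_def)
  show "cmod (phi (z $ i) (mob_point z v s $ i)) \<le> t"
    using phi_involution[OF zi si] s by (simp add: mob_point_def)
  have t0: "0 \<le> t" using order_trans[OF norm_ge_zero s] .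
  have t2: "0 < 1 - t\<^sup>2" using t t0 by (simp add: abs_square_less_1)
  have fac: "cmod (of_real (1 - (cmod (z $ i))\<^sup>2) / (1 - s * v $ i * cnj (z $ i))\<^sup>2)
      = (1 - (cmod (mob_point z v s $ i))\<^sup>2) / (1 - (cmod (s * v $ i))\<^sup>2)" for i
  proof -
    have p: "0 < 1 - (cmod (z $ i))\<^sup>2" "0 < 1 - (cmod (s * v $ i))\<^sup>2"
      using zi[of i] si[of i] by (simp_all only: diff_gt_0_iff_gt abs_square_less_1 abs_norm_cancel)
    have "cmod (of_real (1 - (cmod (z $ i))\<^sup>2)) = 1 - (cmod (z $ i))\<^sup>2"
      unfolding norm_of_real using p(1) by simp
    moreover have "1 - (cmod (mob_point z v s $ i))\<^sup>2
        = (1 - (cmod (z $ i))\<^sup>2) * (1 - (cmod (s * v $ i))\<^sup>2)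
        / (cmod (1 - s * v $ i * cnj (z $ i)))\<^sup>2"
      unfolding mob_point_def vec_lambda_beta by (rule one_minus_phi_square[OF zi si])
    ultimately show ?thesis
      unfolding norm_divide norm_power using p(2) by simp
  qed
  show w: "cmod (mob_weight z v s) = (\<Prod>i\<in>UNIV. (1 - (cmod (mob_point z v s $ i))\<^sup>2)
      / (1 - (cmod (s * v $ i))\<^sup>2))"
    unfolding mob_weight_def prod_norm[symmetric] fac ..
  have "(cmod (mob_weight z v s))\<^sup>2 = (\<Prod>i\<in>UNIV. ((1 - (cmod (mob_point z v s $ i))\<^sup>2)
      / (1 - (cmod (s * v $ i))\<^sup>2))\<^sup>2)"
    unfolding w by (rule prod_power_distrib)
  also have "\<dots> \<le> (\<Prod>i\<in>UNIV. 4 / (1 - t\<^sup>2)\<^sup>2 * (1 - cmod (mob_point z v s $ i))\<^sup>2)"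
  proof (intro prod_mono conjI)
    fix i :: 'n
    let ?W = "cmod (mob_point z v s $ i)"
    have W: "?W < 1" using pd by (simp add: polydisk_def)
    have "1 - ?W\<^sup>2 \<le> 2 * (1 - ?W)"
      using zero_le_power2[of "?W - 1"] by (simp add: power2_diff)
    moreover have "1 - t\<^sup>2 \<le> 1 - (cmod (s * v $ i))\<^sup>2"
      using power_mono[OF s[of i], of 2] by simp
    moreover have "0 \<le> 1 - ?W\<^sup>2" using W by (simp add: abs_square_le_1)
    ultimately have "((1 - ?W\<^sup>2) / (1 - (cmod (s * v $ i))\<^sup>2))\<^sup>2 \<le> (2 * (1 - ?W) / (1 - t\<^sup>2))\<^sup>2"
      using t2 W by (intro power_mono frac_le divide_nonneg_pos) auto
    then show "((1 - ?W\<^sup>2) / (1 - (cmod (s * v $ i))\<^sup>2))\<^sup>2 \<le> 4 / (1 - t\<^sup>2)\<^sup>2 * (1 - ?W)\<^sup>2"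
      unfolding power_divide power_mult_distrib by simp
  qed simp
  also have "\<dots> = (4 / (1 - t\<^sup>2)\<^sup>2) ^ CARD('n) * cell_vol (mob_point z v s)"
    by (simp only: prod.distrib prod_constant cell_vol_def)
  finally show "(cmod (mob_weight z v s))\<^sup>2 \<le> (4 / (1 - t\<^sup>2)\<^sup>2) ^ CARD('n)
      * cell_vol (mob_point z v s)" .
qed

lemma mob_holomorphic:
  fixes z v :: "complex ^ 'n::finite"
  assumes z: "z \<in> polydisk" and s: "\<And>s i. s \<in> S \<Longrightarrow> cmod (s * v $ i) \<le> t" and t: "t < 1"
    and S: "open S"
  shows "(\<lambda>s. mob_weight z v s * bergman_fun h (mob_point z v s)) holomorphic_on S"
proof -
  have nz: "1 - s * v $ i * cnj (z $ i) \<noteq> 0" if "s \<in> S" for s i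
    using phi_denom_nonzero[of "z $ i" "s * v $ i"] le_less_trans[OF s[OF that] t] z
      by (simp add: polydisk_def)
  show ?thesis
  proof (rule holomorphic_on_mult)
    show "mob_weight z v holomorphic_on S"
      unfolding mob_weight_def by (intro holomorphic_intros) (use nz in auto)
    show "(\<lambda>s. bergman_fun h (mob_point z v s)) holomorphic_on S"
    proof (rule holomorphic_on_compose_polydisk[OF analytic_bergman_fun S])
      show "(\<lambda>s. mob_point z v s $ i) holomorphic_on S" for i
        unfolding mob_point_def vec_lambda_beta phi_def
          by (intro holomorphic_intros) (use nz in auto)
      show "mob_point z v s \<in> polydisk" if "s \<in> S" for s
        by (rule mob_point_props(1)[OF z s[OF that] t])
    qed
  qed
qed

lemma has_sum_point_comb:
  assumes "\<And>x m. (x, m) \<in> set L \<Longrightarrow> ((\<lambda>z. f z (of_real x)) has_sum s (of_real x)) I"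
  shows "((\<lambda>z. point_comb L (f z)) has_sum point_comb L s) I"
  using assms
proof (induction L)
  case Nil
  then show ?case by (simp add: point_comb_def)
next
  case (Cons p L)
  obtain x m where p: "p = (x, m)" by (cases p)
  have "((\<lambda>z. m * f z (of_real x) + point_comb L (f z))
      has_sum (m * s (of_real x) + point_comb L s)) I"
    using Cons by (intro has_sum_add has_sum_cmult_right) (auto simp: p)
  then show ?case by (simp add: p point_comb_def)
qed

lemma point_comb_sum: "(\<Sum>z\<in>F. point_comb L (f z)) = point_comb L (\<lambda>x. \<Sum>z\<in>F. f z x)"
  by (induction L) (auto simp: point_comb_def sum.distrib sum_distrib_left)

text \<open>With \<open>v = \<phi>\<^sub>z(\<gamma>(z))\<close>, the curve \<open>s \<mapsto> \<phi>\<^sub>z(s v)\<close> joins \<open>z\<close> (at \<open>s = 0\<close>) to \<open>\<gamma>(z)\<close> (at \<open>s = 1\<close>).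
  Put \<open>s = (1 - \<i> x) / 2\<close> in one factor and the value at \<open>cnj x\<close> in the other: real \<open>x\<close> gives diagonal
  sums, \<open>x = \<i>\<close> gives the required one, and the matrix coefficients are holomorphic in \<open>x\<close>.\<close>

lemma D0_in_closed:
  fixes A :: "('n::finite bergman \<Rightarrow>\<^sub>L 'n bergman) set"
  assumes A: "closed A" "toeplitz ` Linfty \<subseteq> A" "cop.subspace A" and T: "T \<in> D0"
  shows "T \<in> A"
proof -
  obtain \<Gamma> c \<gamma> C where sep: "separated_set \<Gamma>" and bc: "bounded (c ` \<Gamma>)" and \<gamma>: "\<gamma> ` \<Gamma> \<subseteq> polydisk"
    and C: "C \<ge> 0" "\<And>z. z \<in> \<Gamma> \<Longrightarrow> polydist z (\<gamma> z) \<le> C"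
    and hsT: "\<And>h. ((\<lambda>z. blinfun_apply (op_cscale (c z) (kernel z \<otimes>\<^sub>b kernel (\<gamma> z))) h)
        has_sum blinfun_apply T h) \<Gamma>"
    using T unfolding D0_def by blast
  obtain B0 where "\<And>z. z \<in> \<Gamma> \<Longrightarrow> cmod (c z) \<le> B0" using bc by (auto simp: bounded_iff)
  define B where "B = max B0 0"
  have B: "B \<ge> 0" "\<And>z. z \<in> \<Gamma> \<Longrightarrow> cmod (c z) \<le> B"
    using \<open>\<And>z. z \<in> \<Gamma> \<Longrightarrow> cmod (c z) \<le> B0\<close> by (auto simp: B_def intro: max.coboundedI1)
  have \<Gamma>pd: "z \<in> polydisk" if "z \<in> \<Gamma>" for z using sep that by (auto simp: separated_set_def)
  have \<gamma>pd: "\<gamma> z \<in> polydisk" if "z \<in> \<Gamma>" for z using \<gamma> that by auto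
  obtain t where t: "0 \<le> t" "t < 1" "artanh t = C"
    using that[of "tanh C"] C(1) by (simp add: tanh_real_lt_1 artanh_tanh_real)
  define v where "v z = (\<chi> i. phi (z $ i) (\<gamma> z $ i))" for z
  have vt: "cmod (v z $ i) \<le> t" if z: "z \<in> \<Gamma>" for z i
    unfolding v_def vec_lambda_beta
    by (rule polydist_le_imp_phi[OF \<Gamma>pd[OF z] \<gamma>pd[OF z] _ t(1,2)]) (use C(2)[OF z] t(3) in simp)
  \<comment> \<open>For |x| \<le> R the parameter (1 - \<i> x) / 2 has modulus at most R' = (1 + R)
    / 2. The choice R = 2 - t exceeds 1 and keeps R' t below 1, as this means (1 - t)(2 - t) >
    0.\<close>
  define R where "R = 2 - t"
  define R' where "R' = (1 + R) / 2"
  define t' where "t' = R' * t"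
  have R: "1 < R" "1 < R'" using t by (auto simp: R_def R'_def)
  have t': "0 \<le> t'" "t' < 1"
  proof -
    show "0 \<le> t'" using t R by (simp add: t'_def)
    have "0 < (1 - t) * (2 - t)" using t by (intro mult_pos_pos) auto
    then show "t' < 1" by (simp add: t'_def R'_def R_def algebra_simps)
  qed
  have sv: "cmod (s * v z $ i) \<le> t'" if "z \<in> \<Gamma>" "cmod s \<le> R'" for z i s
    unfolding t'_def norm_mult using that vt t R by (intro mult_mono) auto
  define W where "W z s = mob_point z (v z) s" for z s
  define m where "m z s = mob_weight z (v z) s" for z s
  \<comment> \<open>A holomorphic substitute for the pairing of \<open>h\<close> with the kernel at
    the moving point.\<close>
  define E where "E h z s = m z s * bergman_fun h (W z s)" for h :: "'n bergman" and z s
  define \<kappa> where "\<kappa> = (4 / (1 - t'\<^sup>2)\<^sup>2) ^ CARD('n)"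
  have \<kappa>: "\<kappa> \<ge> 0" by (simp add: \<kappa>_def)
  have W: "W z s \<in> polydisk \<and> (\<forall>i. cmod (phi (z $ i) (W z s $ i)) \<le> t')"
    and m: "(cmod (m z s))\<^sup>2 \<le> \<kappa> * cell_vol (W z s)"
    if z: "z \<in> \<Gamma>" and s: "cmod s \<le> R'" for z s
    using mob_point_props[OF \<Gamma>pd[OF z] sv[OF z s] t'(2)] unfolding W_def m_def \<kappa>_def by blast+
  obtain K :: real where K: "0 \<le> K" "\<And>w h F. close_family t' \<Gamma> w
     \<Longrightarrow> finite F \<Longrightarrow> F \<subseteq> \<Gamma> \<Longrightarrow> (\<Sum>z\<in>F. cell_vol (w z) * (cmod (bergman_fun h (w z)))\<^sup>2) \<le> K * (norm h)\<^sup>2"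
    using separated_carleson[OF sep t'] by blast
  have sumE: "(\<Sum>z\<in>F. (cmod (E h z s))\<^sup>2) \<le> \<kappa> * K * (norm h)\<^sup>2" if F: "finite F" "F \<subseteq> \<Gamma>"
    and s: "cmod s \<le> R'" for F h s
  proof -
    have "(\<Sum>z\<in>F. (cmod (E h z s))\<^sup>2) \<le> (\<Sum>z\<in>F. \<kappa>
        * (cell_vol (W z s) * (cmod (bergman_fun h (W z s)))\<^sup>2))"
    proof (rule sum_mono)
      fix z assume "z \<in> F"
      then have "(cmod (m z s))\<^sup>2 * (cmod (bergman_fun h (W z s)))\<^sup>2
          \<le> \<kappa> * cell_vol (W z s) * (cmod (bergman_fun h (W z s)))\<^sup>2"
        using F s by (intro mult_right_mono m) auto
      then show "(cmod (E h z s))\<^sup>2 \<le> \<kappa> * (cell_vol (W z s) * (cmod (bergman_fun h (W z s)))\<^sup>2)"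
        by (simp add: E_def norm_mult power_mult_distrib mult.assoc)
    qed
    also have "\<dots> \<le> \<kappa> * (K * (norm h)\<^sup>2)"
      unfolding sum_distrib_left[symmetric] by (intro mult_left_mono K(2) F \<kappa>)
        (use W s in \<open>simp add: close_family_def\<close>)
    finally show ?thesis by (simp add: mult.assoc)
  qed
  define P where "P w = (\<Prod>i\<in>UNIV. 1 - (cmod (w $ i))\<^sup>2)" for w :: "complex ^ 'n"
  \<comment> \<open>The vector representing h \<mapsto> \<open>E h z s\<close>: division by
    \<open>P\<close> removes the nonholomorphic normalization of \<open>kernel\<close>. With these
    vectors \<open>bessel_operator\<close> realizes the diagonal forms.\<close>
  define e where "e s z = (cnj (m z s) / of_real (P (W z s))) *\<^sub>c kernel (W z s)" for s z
  have ce: "cinner h (e s z) = E h z s" if z: "z \<in> \<Gamma>" and s: "cmod s \<le> R'" for h s z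
  proof -
    have pd: "W z s \<in> polydisk" using W[OF z s] by blast
    have "0 < P (W z s)"
      unfolding P_def using pd by (intro prod_pos) (auto simp: polydisk_def abs_square_less_1)
    then show ?thesis
      unfolding e_def cinner_cscale_right cinner_kernel[OF pd, folded P_def] by (simp add: E_def)
  qed
  \<comment> \<open>At s = 1 the weight differs from the normalizing factor of
    \<open>kernel (\<gamma> z)\<close>. The quotient has modulus equal to the product of the 1 -
    |v_i|^2, at most 1, and is absorbed into the coefficients.\<close>
  define \<rho> where "\<rho> z = of_real (\<Prod>i\<in>UNIV. 1 - (cmod (\<gamma> z $ i))\<^sup>2) / m z 1" for z
  define c' where "c' z = c z * \<rho> z" for z
  have W1: "W z 1 = \<gamma> z" and W0: "W z 0 = z" if z: "z \<in> \<Gamma>" for z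
    using \<Gamma>pd[OF z] \<gamma>pd[OF z]
    by (auto simp: W_def mob_point_def v_def vec_eq_iff polydisk_def phi_involution)
  have m0: "m z 0 = of_real (\<Prod>i\<in>UNIV. 1 - (cmod (z $ i))\<^sup>2)" for z
    by (simp add: m_def mob_weight_def)
  have \<rho>: "cmod (\<rho> z) \<le> 1" "m z 1 \<noteq> 0" if z: "z \<in> \<Gamma>" for z
  proof -
    have p: "0 < 1 - (cmod (\<gamma> z $ i))\<^sup>2" for i
      using \<gamma>pd[OF z] by (simp add: polydisk_def abs_square_less_1)
    have q: "0 < 1 - (cmod (v z $ i))\<^sup>2" for i
      using le_less_trans[OF vt[OF z] t(2)] by (simp add: abs_square_less_1)
    have r1: "cmod (1::complex) \<le> R'" using R by simp
    have "cmod (m z 1) = (\<Prod>i\<in>UNIV. (1 - (cmod (\<gamma> z $ i))\<^sup>2) / (1 - (cmod (v z $ i))\<^sup>2))"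
      using mob_point_props(3)[OF \<Gamma>pd[OF z] sv[OF z r1] t'(2)] W1[OF z] by (simp add: m_def W_def)
    also have "\<dots> = (\<Prod>i\<in>UNIV. 1 - (cmod (\<gamma> z $ i))\<^sup>2) / (\<Prod>i\<in>UNIV. 1 - (cmod (v z $ i))\<^sup>2)"
      by (rule prod_dividef)
    finally have cm: "cmod (m z 1) = (\<Prod>i\<in>UNIV. 1 - (cmod (\<gamma> z $ i))\<^sup>2)
        / (\<Prod>i\<in>UNIV. 1 - (cmod (v z $ i))\<^sup>2)" .
    have pp: "0 < (\<Prod>i\<in>UNIV. 1 - (cmod (\<gamma> z $ i))\<^sup>2)" "0 < (\<Prod>i\<in>UNIV. 1 - (cmod (v z $ i))\<^sup>2)"
      by (auto intro!: prod_pos p q)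
    then show "m z 1 \<noteq> 0" using cm by (metis divide_pos_pos less_irrefl norm_zero)
    have "\<bar>a\<bar> / (a / b) = b" if "0 < a" "0 < b" for a b :: real using that by simp
    from this[OF pp] have "cmod (\<rho> z) = (\<Prod>i\<in>UNIV. 1 - (cmod (v z $ i))\<^sup>2)"
      unfolding \<rho>_def norm_divide cm norm_of_real .
    also have "\<dots> \<le> 1" by (rule prod_le_1) (use q in \<open>auto intro: less_imp_le\<close>)
    finally show "cmod (\<rho> z) \<le> 1" .
  qed
  have c'B: "cmod (c' z) \<le> B" if z: "z \<in> \<Gamma>" for z
    using mult_mono[OF B(2)[OF z] \<rho>(1)[OF z] B(1)] by (simp add: c'_def norm_mult)
  have Tform: "((\<lambda>z. c' z * (E h z 1 * cnj (E g z 0))) has_sum cinner (blinfun_apply T h) g) \<Gamma>"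
    for h g
  proof (rule has_sum_cong[THEN iffD1, OF _ has_sum_cinner])
    show "((\<lambda>z. c z *\<^sub>c (cinner h (kernel (\<gamma> z)) *\<^sub>c kernel z)) has_sum blinfun_apply T h) \<Gamma>"
      using hsT[of h] by (simp add: op_cscale_apply rank_one_apply)
    fix z assume z: "z \<in> \<Gamma>"
    have "cinner h (kernel (\<gamma> z)) = \<rho> z * E h z 1"
      using \<rho>(2)[OF z] unfolding cinner_kernel[OF \<gamma>pd[OF z]] by (simp add: \<rho>_def E_def W1[OF z])
    moreover have "cinner g (kernel z) = E g z 0"
      unfolding cinner_kernel[OF \<Gamma>pd[OF z]] by (simp add: E_def W0[OF z] m0)
    ultimately show "c z * (cinner h (kernel (\<gamma> z)) * cnj (cinner g (kernel z)))
        = c' z * (E h z 1 * cnj (E g z 0))"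
      by (simp add: c'_def)
  qed
  define \<sigma> where "\<sigma> x = (1 - \<i> * x) / 2" for x :: complex
  have \<sigma>: "cmod (\<sigma> x) \<le> R'" if "cmod x \<le> R" for x
    using norm_triangle_ineq4[of 1 "\<i> * x"] that by (simp add: \<sigma>_def norm_divide norm_mult R'_def)
  have diag: "\<exists>S\<in>A. \<forall>h g. ((\<lambda>z. c' z * (E h z (\<sigma> (of_real x)) * cnj (E g z (\<sigma> (of_real x)))))
      has_sum cinner (blinfun_apply S h) g) \<Gamma>"
    if x: "x \<in> {-1<..<1}" for x :: real
  proof -
    define s where "s = \<sigma> (of_real x)"
    have s: "cmod s \<le> R'" unfolding s_def using x R by (intro \<sigma>) auto
    have bes: "(\<Sum>z\<in>F. (cmod (cinner h (e s z)))\<^sup>2) \<le> \<kappa> * K * (norm h)\<^sup>2"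
      if F: "finite F" "F \<subseteq> \<Gamma>" for F h
    proof -
      have "(\<Sum>z\<in>F. (cmod (cinner h (e s z)))\<^sup>2) = (\<Sum>z\<in>F. (cmod (E h z s))\<^sup>2)"
        by (rule sum.cong) (use ce s F in auto)
      then show ?thesis using sumE[OF F s] by simp
    qed
    have "\<kappa> * K \<ge> 0" using \<kappa> K by simp
    then have "\<exists>S. \<forall>h. ((\<lambda>z. c' z *\<^sub>c (cinner h (e s z) *\<^sub>c e s z)) has_sum blinfun_apply S h) \<Gamma>"
    proof (rule bessel_operator[OF _ bes bes c'B])
      fix S :: "'n bergman \<Rightarrow>\<^sub>L 'n bergman"
      assume "\<And>h. ((\<lambda>z. c' z *\<^sub>c (cinner h (e s z) *\<^sub>c e s z)) has_sum blinfun_apply S h) \<Gamma>"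
      then show ?thesis by blast
    qed
    then obtain S :: "'n bergman \<Rightarrow>\<^sub>L 'n bergman"
      where S: "\<And>h. ((\<lambda>z. c' z *\<^sub>c (cinner h (e s z) *\<^sub>c e s z)) has_sum blinfun_apply S h) \<Gamma>"
        by blast
    have Sform: "((\<lambda>z. c' z * (E h z s * cnj (E g z s))) has_sum cinner (blinfun_apply S h) g) \<Gamma>"
      for h g
      by (rule has_sum_cong[THEN iffD1, OF _ has_sum_cinner[OF S]]) (simp add: ce s)
    \<comment> \<open>On the diagonal the weight contributes |m|^2, bounded by \<kappa>
      \<open>cell_vol\<close>; the quotient gives bounded coefficients of the shape required for
      diagonal sums.\<close>
    define a where "a z = c' z * of_real ((cmod (m z s))\<^sup>2 / cell_vol (W z s))" for z
    have "S \<in> A"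
    proof (rule diagonal_sum_in_closed[OF A(1,2) sep t', of "\<lambda>z. W z s" a "B * \<kappa>"])
      show "close_family t' \<Gamma> (\<lambda>z. W z s)"
        using W s by (simp add: close_family_def)
      have cv: "cell_vol (W z s) > 0" if "z \<in> \<Gamma>" for z
        using W[OF that s] by (intro cell_vol_pos) blast
      show "cmod (a z) \<le> B * \<kappa>" if z: "z \<in> \<Gamma>" for z
      proof -
        have "(cmod (m z s))\<^sup>2 / cell_vol (W z s) \<le> \<kappa>"
          using m[OF z s] cv[OF z] by (simp add: divide_le_eq)
        then show ?thesis
          unfolding a_def norm_mult norm_of_real using c'B[OF z] B(1) cv[OF z]
          by (intro mult_mono) auto
      qed
      show "((\<lambda>z. a z * of_real (cell_vol (W z s))
          * (bergman_fun h (W z s) * cnj (bergman_fun g (W z s))))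
          has_sum cinner (blinfun_apply S h) g) \<Gamma>" for h g
      proof (rule has_sum_cong[THEN iffD1, OF _ Sform])
        fix z assume z: "z \<in> \<Gamma>"
        have "a z * of_real (cell_vol (W z s)) = c' z * of_real ((cmod (m z s))\<^sup>2)"
          using cv[OF z] by (simp add: a_def)
        also have "of_real ((cmod (m z s))\<^sup>2) = m z s * cnj (m z s)" by (rule complex_norm_square)
        finally show "c' z * (E h z s * cnj (E g z s))
            = a z * of_real (cell_vol (W z s))
            * (bergman_fun h (W z s) * cnj (bergman_fun g (W z s)))"
          by (simp add: E_def mult_ac)
      qed
    qed
    then show ?thesis using Sform unfolding s_def by blast
  qed
  then obtain S where SA: "\<And>x. x \<in> {-1<..<1} \<Longrightarrow> S x \<in> A"
    and S: "\<And>x h g. x \<in> {-1<..<1} \<Longrightarrow> ((\<lambda>z. c' z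
        * (E h z (\<sigma> (of_real x)) * cnj (E g z (\<sigma> (of_real x)))))
        has_sum cinner (blinfun_apply (S x) h) g) \<Gamma>"
    by metis
  \<comment> \<open>For real \<open>x\<close> both parameters agree and these are the diagonal
    terms. Conjugating argument and value keeps the second factor holomorphic in
    \<open>x\<close>.\<close>
  define H where "H h g z x = c' z * (E h z (\<sigma> x) * cnj (E g z (\<sigma> (cnj x))))" for h g z x
  define M where "M = B * (\<kappa> * K)"
  have M: "M \<ge> 0" using B \<kappa> K by (simp add: M_def)
  have holE: "(\<lambda>x. E h z (\<sigma> x)) holomorphic_on ball 0 R" if z: "z \<in> \<Gamma>" for h z
  proof -
    have "(\<lambda>s. mob_weight z (v z) s * bergman_fun h (mob_point z (v z) s)) holomorphic_on ball 0 (R'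
        + 1) \<inter> {s. cmod s < R'}"
      by (rule mob_holomorphic[OF \<Gamma>pd[OF z] _ t'(2)])
        (use sv[OF z] in \<open>auto intro!: open_Int open_Collect_less continuous_intros\<close>)
    then have "E h z holomorphic_on ball 0 R'"
      unfolding E_def m_def W_def by (rule holomorphic_on_subset) auto
    moreover have "\<sigma> holomorphic_on ball 0 R" unfolding \<sigma>_def by (intro holomorphic_intros) auto
    moreover have "\<sigma> ` ball 0 R \<subseteq> ball 0 R'"
    proof
      fix y assume "y \<in> \<sigma> ` ball 0 R"
      then obtain x where x: "cmod x < R" "y = \<sigma> x" by auto
      have "cmod (1 - \<i> * x) < 1 + R"
        using norm_triangle_ineq4[of 1 "\<i> * x"] x by (simp add: norm_mult)
      then show "y \<in> ball 0 R'" by (simp add: x \<sigma>_def norm_divide R'_def)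
    qed
    ultimately show ?thesis using holomorphic_on_compose_gen[of \<sigma> "ball 0 R" "E h z" "ball 0 R'"]
      by (simp add: o_def)
  qed
  \<comment> \<open>The bound comes from the Carleson estimate, uniform in the parameter and
    independent of \<open>F\<close>, so one combination of nodes serves all partial sums.\<close>
  have adm: "bounded_holomorphic R (\<lambda>x. \<Sum>z\<in>F. H h g z x) (M * ((norm h)\<^sup>2 + (norm g)\<^sup>2))"
    if F: "finite F" "F \<subseteq> \<Gamma>" for F h g
    unfolding bounded_holomorphic_def
  proof (intro conjI ballI)
    show "(\<lambda>x. \<Sum>z\<in>F. H h g z x) holomorphic_on ball 0 R"
      unfolding H_def
    proof (intro holomorphic_on_sum holomorphic_on_mult holomorphic_on_const)
      fix z assume "z \<in> F"
      then have z: "z \<in> \<Gamma>" using F by blast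
      show "(\<lambda>x. E h z (\<sigma> x)) holomorphic_on ball 0 R" by (rule holE[OF z])
      have "cnj ` ball 0 R = ball 0 R"
        by (auto simp: image_iff intro!: bexI[of _ "cnj _"])
      then show "(\<lambda>x. cnj (E g z (\<sigma> (cnj x)))) holomorphic_on ball 0 R"
        using holomorphic_on_compose_cnj_cnj[of "\<lambda>x. E g z (\<sigma> x)" "ball 0 R"] holE[OF z, of g]
          by (simp add: o_def)
    qed
    fix x assume x: "x \<in> ball (0::complex) R"
    have s: "cmod (\<sigma> x) \<le> R'" "cmod (\<sigma> (cnj x)) \<le> R'" using x by (auto intro!: \<sigma>)
    have "cmod (\<Sum>z\<in>F. H h g z x) \<le> (\<Sum>z\<in>F. B * ((cmod (E h z (\<sigma> x)))\<^sup>2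
        + (cmod (E g z (\<sigma> (cnj x))))\<^sup>2))"
    proof (rule sum_norm_le)
      fix z assume "z \<in> F"
      then have z: "z \<in> \<Gamma>" using F by blast
      let ?a = "cmod (E h z (\<sigma> x))" and ?b = "cmod (E g z (\<sigma> (cnj x)))"
      have "2 * (?a * ?b) \<le> ?a\<^sup>2 + ?b\<^sup>2" using sum_squares_bound[of ?a ?b] by (simp add: mult.assoc)
      moreover have "0 \<le> ?a * ?b" by simp
      ultimately have "?a * ?b \<le> ?a\<^sup>2 + ?b\<^sup>2" by linarith
      then show "cmod (H h g z x) \<le> B * (?a\<^sup>2 + ?b\<^sup>2)"
        unfolding H_def norm_mult complex_mod_cnj using c'B[OF z] B(1) by (intro mult_mono) auto
    qed
    also have "\<dots> = B * ((\<Sum>z\<in>F. (cmod (E h z (\<sigma> x)))\<^sup>2) + (\<Sum>z\<in>F. (cmod (E g z (\<sigma> (cnj x))))\<^sup>2))"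
      by (simp only: sum_distrib_left[symmetric] sum.distrib)
    also have "\<dots> \<le> B * (\<kappa> * K * (norm h)\<^sup>2 + \<kappa> * K * (norm g)\<^sup>2)"
      by (intro mult_left_mono add_mono sumE F s B(1))
    also have "\<dots> = M * ((norm h)\<^sup>2 + (norm g)\<^sup>2)" by (simp add: M_def algebra_simps)
    finally show "cmod (\<Sum>z\<in>F. H h g z x) \<le> M * ((norm h)\<^sup>2 + (norm g)\<^sup>2)" .
  qed
  have "T \<in> closure A"
    unfolding closure_approachable
  proof (intro allI impI)
    fix \<epsilon> :: real assume \<epsilon>: "\<epsilon> > 0"
    define \<delta> where "\<delta> = \<epsilon> / (4 * (M + 1))"
    have \<delta>: "\<delta> > 0" using \<epsilon> M by (simp add: \<delta>_def)
    obtain L where L: "fst ` set L \<subseteq> {-1<..<1}"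
      and Lb: "\<And>G B. bounded_holomorphic R G B \<Longrightarrow> cmod (point_comb L G - G \<i>) \<le> \<delta> * B"
      using point_approx_imaginary_unit[OF R(1)] \<delta> unfolding point_approx_def by meson
    \<comment> \<open>The chosen combination of evaluations, applied to the diagonal operators
      instead of to a scalar function.\<close>
    define Op where "Op = (\<Sum>(x, a)\<leftarrow>L. op_cscale a (S x))"
    have OpA: "Op \<in> A"
      unfolding Op_def using L
    proof (induction L)
      case Nil
      then show ?case using cop.subspace_0[OF A(3)] by simp
    next
      case (Cons p L)
      obtain x a where p: "p = (x, a)" by (cases p)
      have "S x \<in> A" using Cons.prems by (intro SA) (auto simp: p)
      then show ?case
        using Cons by (auto simp: p intro!: cop.subspace_add[OF A(3)] cop.subspace_scale[OF A(3)])
    qed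
    \<comment> \<open>\<open>point_comb\<close> evaluates at complex arguments, whereas
      \<open>S\<close> is indexed by reals; at the nodes \<open>Re\<close> recovers the
      index.\<close>
    have Opform: "cinner (blinfun_apply Op h) g
        = point_comb L (\<lambda>x. cinner (blinfun_apply (S (Re x)) h) g)" for h g
      unfolding Op_def point_comb_def
      by (induction L) (auto simp: blinfun.zero_left cinner_zero_left blinfun.add_left
        cinner_add_left op_cscale_apply cinner_cscale_left)
    have "norm (Op - T) \<le> 2 * (\<delta> * M)"
    proof (rule norm_blinfun_le_form)
      show "0 \<le> \<delta> * M" using \<delta> M by simp
      fix h g :: "'n bergman"
      have hs: "((\<lambda>z. point_comb L (H h g z)) has_sum cinner (blinfun_apply Op h) g) \<Gamma>"
        unfolding Opform
      proof (rule has_sum_point_comb)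
        fix x a assume "(x, a) \<in> set L"
        then have "x \<in> {-1<..<1}" using L by force
        from S[OF this, of h g] show "((\<lambda>z. H h g z (of_real x))
            has_sum cinner (blinfun_apply (S (Re (of_real x))) h) g) \<Gamma>"
          by (simp add: H_def)
      qed
      \<comment> \<open>The curves end at \<gamma>(z) in the first factor and start at z in the
        second, which reproduces the off-diagonal term.\<close>
      have "\<sigma> \<i> = 1" "\<sigma> (cnj \<i>) = 0" by (auto simp: \<sigma>_def)
      then have "((\<lambda>z. H h g z \<i>) has_sum cinner (blinfun_apply T h) g) \<Gamma>"
        using Tform[of h g] by (simp only: H_def)
      from has_sum_add[OF hs has_sum_cmult_right[OF this, of "-1"]]
      have diff: "((\<lambda>z. point_comb L (H h g z) - H h g z \<i>)
          has_sum cinner (blinfun_apply (Op - T) h) g) \<Gamma>"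
        by (simp add: blinfun.diff_left cinner_diff_left)
      have "cmod (cinner (blinfun_apply (Op - T) h) g) \<le> \<delta> * (M * ((norm h)\<^sup>2 + (norm g)\<^sup>2))"
      proof (rule has_sum_norm_le[OF diff])
        fix F assume F: "finite F" "F \<subseteq> \<Gamma>"
        show "norm (\<Sum>z\<in>F. point_comb L (H h g z) - H h g z \<i>) \<le> \<delta> * (M * ((norm h)\<^sup>2 + (norm g)\<^sup>2))"
          using Lb[OF adm[OF F]] by (simp add: sum_subtractf point_comb_sum)
      qed
      then show "cmod (cinner (blinfun_apply (Op - T) h) g) \<le> \<delta> * M * ((norm h)\<^sup>2 + (norm g)\<^sup>2)"
        by (simp add: mult.assoc)
    qed
    moreover have "\<delta> * M \<le> \<epsilon> / 4"
    proof -
      have "\<delta> * M \<le> \<delta> * (M + 1)" using \<delta> by simp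
      also have "\<dots> = \<epsilon> / 4" using M by (simp add: \<delta>_def field_simps)
      finally show ?thesis .
    qed
    ultimately have "dist Op T < \<epsilon>" using \<epsilon> by (simp add: dist_norm)
    then show "\<exists>T'\<in>A. dist T' T < \<epsilon>" using OpA by blast
  qed
  then show ?thesis using A(1) by simp
qed

theorem theoremB:
  shows "cstar_generated (loc_ops :: ('n::finite bergman \<Rightarrow>\<^sub>L 'n bergman) set) = toeplitz_algebra"
proof -
  have "loc_ops \<subseteq> A \<longleftrightarrow> toeplitz ` Linfty \<subseteq> A" if "cstar_subalgebra A"
    for A :: "('n bergman \<Rightarrow>\<^sub>L 'n bergman) set"
  proof
    have A: "closed A" "cop.subspace A" using that by (auto simp: cstar_subalgebra_def)
    assume "loc_ops \<subseteq> A"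
    moreover have "closure D0 \<subseteq> (loc_ops :: ('n bergman \<Rightarrow>\<^sub>L 'n bergman) set)"
      unfolding loc_ops_def by (intro closure_mono cop.span_superset)
    ultimately show "toeplitz ` Linfty \<subseteq> A" using toeplitz_closure_D0(1) by blast
  next
    have A: "closed A" "cop.subspace A" using that by (auto simp: cstar_subalgebra_def)
    assume "toeplitz ` Linfty \<subseteq> A"
    then have "D0 \<subseteq> A" using D0_in_closed[OF A(1) _ A(2)] by blast
    then have "cop.span D0 \<subseteq> A" using A(2) by (rule cop.span_minimal)
    then show "loc_ops \<subseteq> A" unfolding loc_ops_def using A(1) by (rule closure_minimal)
  qed
  then have "{A. cstar_subalgebra A \<and> loc_ops \<subseteq> A}
      = {A :: ('n bergman \<Rightarrow>\<^sub>L 'n bergman) set. cstar_subalgebra A \<and> toeplitz ` Linfty \<subseteq> A}"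
    by blast
  then show ?thesis
    unfolding cstar_generated_def toeplitz_algebra_def hull_def by simp
qed

end
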